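(* Let $H$ be a graded connected Hopf algebra over $\Bbbk$ with finite-dimensional homogeneous components $H_m$ and antipode $S$. For all scalars $n\in\Bbbk$ and nonnegative integers $m$, $$\operatorname{trace}\bigl(\Psi_n|_{H_m}\bigr)=\sum_{k=0}^m n^k\,\mathrm{mul}(k,m).$$ In particular, $$\operatorname{trace}\bigl(S|_{H_m}\bigr)=\sum_{k=0}^m(-1)^k\,\mathrm{mul}(k,m)=\mathrm{emul}(m)-\mathrm{omul}(m).$$
   Context: $\Bbbk$ is a field of characteristic zero. A graded connected Hopf algebra is a bialgebra $H$ with unit map $\iota$, counit $\varepsilon$, product $\mu$, coproduct $\Delta$ and a decomposition $H=\bigoplus_{m\ge 0}H_m$ such that $\mu(H_p\otimes H_q)\subseteq H_{p+q}$, $\Delta(H_m)\subseteq\bigoplus_{p+q=m}H_p\otimes H_q$, $1\in H_0$, $\varepsilon(H_m)=0$ for $m>0$, and $\dim H_0=1$ (it then automatically has an antipode $S$, which preserves the grading). The convolution product on linear endomorphisms of $H$ is $P\ast Q=\mu\circ(P\otimes Q)\circ\Delta$, with unit $\iota\circ\varepsilon$. For every scalar $n\in\Bbbk$ the Adams operator is $\Psi_n=\sum_{k\ge 0}\binom{n}{k}(\mathrm{id}-\iota\circ\varepsilon)^{\ast k}$, where $\binom nk=n(n-1)\cdots(n-k+1)/k!$; on $H_m$ only the terms with $k\le m$ are nonzero, and $\Psi_n$ preserves $H_m$. For integers $n$, $\Psi_n=\mathrm{id}^{\ast n}$; in particular $\Psi_{-1}=S$. The convention $n^0=1$ is used, also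 for $n=0$. Let $H^{(0)}\subseteq H^{(1)}\subseteq\cdots$ be the coradical filtration of $H$ and $\mathrm{gr}\,H=H^{(0)}\oplus\bigoplus_{j\ge1}H^{(j)}/H^{(j-1)}$ the associated graded Hopf algebra. It carries a second grading $(\mathrm{gr}\,H)_m=(H^{(0)}\cap H_m)\oplus\bigoplus_{j\ge 1}(H^{(j)}\cap H_m)/(H^{(j-1)}\cap H_m)$. Let $\widetilde H=\bigoplus_m ((\mathrm{gr}\,H)_m)^*$ be the graded dual of $\mathrm{gr}\,H$ with respect to this second grading; it is a graded connected cocommutative Hopf algebra. Let $\mathfrak g=\{x\in\widetilde H:\Delta(x)=1\otimes x+x\otimes 1\}$ be its graded Lie algebra of primitive elements and $g_i=\dim\mathfrak g_i$ for $i\ge1$. (The integers $g_i$ are related to the dimension sequence of $H$ by $1+\sum_{m\ge1}(\dim H_m)t^m=\prod_{i\ge1}(1-t^i)^{-g_i}$.) For a partition $\lambda=1^{k_1}2^{k_2}\cdots r^{k_r}$ put $|\lambda|=k_1+2k_2+\cdots+rk_r$, $\ell(\lambda)=k_1+\cdots+k_r$, and $\binom{\underline g}{\lambda}=\prod_{i=1}^r\binom{g_i+k_i-1}{k_i}$. For nonnegative integers $k,m$ set $\mathrm{mul}(k,m)=\sum_{|\lambda|=m,\ \ell(\lambda)=k}\binom{\underline g}{\lambda}$. Also $\mathrm{emul}(m)=\sum_{k\text{ even}}\mathrm{mul}(k,m)$ and $\mathrm{omul}(m)=\sum_{k\text{ odd}}\mathrm{mul}(k,m)$. *)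

theory Defs
  imports
    Complex_Main
    "HOL-Library.Function_Algebras"
    "HOL-Library.Groups_Big_Fun"
    "HOL-Library.Multiset"
begin

section \<open>Spaces of scalar-valued functions\<close>

definition fun_scale :: "'k::field \<Rightarrow> ('x \<Rightarrow> 'k) \<Rightarrow> 'x \<Rightarrow> 'k"
  where "fun_scale c f = (\<lambda>x. c * f x)"

global_interpretation fun_vs: vector_space "fun_scale :: 'k::field \<Rightarrow> ('x \<Rightarrow> 'k) \<Rightarrow> 'x \<Rightarrow> 'k"
  by unfold_locales (auto simp: fun_scale_def plus_fun_def algebra_simps)

section \<open>Tensor products\<close>

text \<open>
  Scalar multiplications are explicit arguments: \<open>sA\<close> and \<open>sB\<close> make the types
  \<open>'a\<close> and \<open>'b\<close> vector spaces over the field \<open>'k\<close>.  The tensor product is realised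
  inside the dual of the space of bilinear forms: \<open>a \<otimes> b\<close> is evaluation of bilinear
  forms at \<open>(a, b)\<close>, and for subspaces \<open>A\<close>, \<open>B\<close> the space \<open>A \<otimes> B\<close> is the span of
  the \<open>a \<otimes> b\<close> with \<open>a \<in> A\<close>, \<open>b \<in> B\<close>.  Over a field this is the algebraic tensor
  product, since bilinear forms separate its points.
\<close>

definition bilinear_form ::
  "('k::field \<Rightarrow> 'a::ab_group_add \<Rightarrow> 'a) \<Rightarrow> ('k \<Rightarrow> 'b::ab_group_add \<Rightarrow> 'b) \<Rightarrow> ('a \<Rightarrow> 'b \<Rightarrow> 'k) \<Rightarrow> bool"
  where "bilinear_form sA sB \<beta> \<longleftrightarrow>
    (\<forall>b. Vector_Spaces.linear sA (*) (\<lambda>a. \<beta> a b)) \<and> (\<forall>a. Vector_Spaces.linear sB (*) (\<lambda>b. \<beta> a b))"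

type_synonym ('a, 'b, 'k) tensor = "('a \<Rightarrow> 'b \<Rightarrow> 'k) \<Rightarrow> 'k"

definition pure_tensor ::
  "('k::field \<Rightarrow> 'a::ab_group_add \<Rightarrow> 'a) \<Rightarrow> ('k \<Rightarrow> 'b::ab_group_add \<Rightarrow> 'b) \<Rightarrow> 'a \<Rightarrow> 'b \<Rightarrow> ('a, 'b, 'k) tensor"
  where "pure_tensor sA sB a b = (\<lambda>\<beta>. if bilinear_form sA sB \<beta> then \<beta> a b else 0)"

definition tensor_space ::
  "('k::field \<Rightarrow> 'a::ab_group_add \<Rightarrow> 'a) \<Rightarrow> ('k \<Rightarrow> 'b::ab_group_add \<Rightarrow> 'b) \<Rightarrow> 'a set \<Rightarrow> 'b set \<Rightarrow> ('a, 'b, 'k) tensor set"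
  where "tensor_space sA sB A B = fun_vs.span {pure_tensor sA sB a b | a b. a \<in> A \<and> b \<in> B}"

text \<open>
  The linear map on \<open>A \<otimes> B\<close> induced by a map \<open>\<phi>\<close> that is bilinear on \<open>A \<times> B\<close>,
  sending \<open>\<Sum> a\<^sub>i \<otimes> b\<^sub>i\<close> to \<open>\<Sum> \<phi> a\<^sub>i b\<^sub>i\<close>.  The subspaces \<open>A\<close> and \<open>B\<close> matter when
  \<open>\<phi>\<close> is not bilinear on the whole types, as for \<open>A\<close> itself a tensor product.
\<close>

definition tensor_lift ::
  "('k::field \<Rightarrow> 'a::ab_group_add \<Rightarrow> 'a) \<Rightarrow> ('k \<Rightarrow> 'b::ab_group_add \<Rightarrow> 'b) \<Rightarrow> 'a set \<Rightarrow> 'b set \<Rightarrow>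
    ('a \<Rightarrow> 'b \<Rightarrow> 'c::ab_group_add) \<Rightarrow> ('a, 'b, 'k) tensor \<Rightarrow> 'c"
  where "tensor_lift sA sB A B \<phi> t = (THE z. \<exists>ps. set ps \<subseteq> A \<times> B \<and>
    t = (\<Sum>(a, b)\<leftarrow>ps. pure_tensor sA sB a b) \<and> z = (\<Sum>(a, b)\<leftarrow>ps. \<phi> a b))"

definition tensor_mult ::
  "('k::field \<Rightarrow> 'a::ring_1 \<Rightarrow> 'a) \<Rightarrow> ('a, 'a, 'k) tensor \<Rightarrow> ('a, 'a, 'k) tensor \<Rightarrow> ('a, 'a, 'k) tensor"
  where "tensor_mult s t u =
    tensor_lift s s UNIV UNIV (\<lambda>a b. tensor_lift s s UNIV UNIV (\<lambda>c d. pure_tensor s s (a * c) (b * d)) u) t"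

definition tensor_assoc ::
  "('k::field \<Rightarrow> 'a::ab_group_add \<Rightarrow> 'a) \<Rightarrow> (('a, 'a, 'k) tensor, 'a, 'k) tensor \<Rightarrow> ('a, ('a, 'a, 'k) tensor, 'k) tensor"
  where "tensor_assoc s =
    tensor_lift fun_scale s (tensor_space s s UNIV UNIV) UNIV
      (\<lambda>t c. tensor_lift s s UNIV UNIV (\<lambda>a b. pure_tensor s fun_scale a (pure_tensor s s b c)) t)"

section \<open>Traces\<close>

text \<open>
  The trace of a linear map \<open>f\<close> restricted to a finite-dimensional subspace \<open>V\<close> with
  \<open>f ` V \<subseteq> V\<close>, computed in an arbitrary basis of \<open>V\<close>.
\<close>

definition (in vector_space) trace_on :: "'b set \<Rightarrow> ('b \<Rightarrow> 'b) \<Rightarrow> 'a"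
  where "trace_on V f =
    (let B = (SOME B. independent B \<and> span B = V) in \<Sum>b\<in>B. representation B (f b) b)"

definition (in vector_space) finite_dim :: "'b set \<Rightarrow> bool"
  where "finite_dim V \<longleftrightarrow> (\<exists>B. finite B \<and> span B = V)"

section \<open>Bialgebras and Adams operators\<close>

text \<open>
  The underlying ring is the type \<open>'h\<close>; the unit map is \<open>c \<mapsto> c *s 1\<close>.
\<close>

locale bialgebra = vector_space scale
  for scale :: "'k::field_char_0 \<Rightarrow> 'h::ring_1 \<Rightarrow> 'h" (infixr \<open>*s\<close> 75) +
  fixes \<Delta> :: "'h \<Rightarrow> ('h, 'h, 'k) tensor"
    and \<epsilon> :: "'h \<Rightarrow> 'k"
  assumes scale_mult_left: "(c *s x) * y = c *s (x * y)"
    and scale_mult_right: "x * (c *s y) = c *s (x * y)"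
    and comult_in: "\<Delta> x \<in> tensor_space scale scale UNIV UNIV"
    and comult_linear: "Vector_Spaces.linear scale fun_scale \<Delta>"
    and counit_linear: "Vector_Spaces.linear scale (*) \<epsilon>"
    and coassoc:
      "tensor_assoc scale (tensor_lift scale scale UNIV UNIV (\<lambda>a b. pure_tensor fun_scale scale (\<Delta> a) b) (\<Delta> x)) =
       tensor_lift scale scale UNIV UNIV (\<lambda>a b. pure_tensor scale fun_scale a (\<Delta> b)) (\<Delta> x)"
    and counit_left: "tensor_lift scale scale UNIV UNIV (\<lambda>a b. \<epsilon> a *s b) (\<Delta> x) = x"
    and counit_right: "tensor_lift scale scale UNIV UNIV (\<lambda>a b. \<epsilon> b *s a) (\<Delta> x) = x"
    and comult_mult: "\<Delta> (x * y) = tensor_mult scale (\<Delta> x) (\<Delta> y)"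
    and comult_one: "\<Delta> 1 = pure_tensor scale scale 1 1"
    and counit_mult: "\<epsilon> (x * y) = \<epsilon> x * \<epsilon> y"
    and counit_one: "\<epsilon> 1 = 1"
begin

definition tensor_map :: "('h \<Rightarrow> 'h) \<Rightarrow> ('h \<Rightarrow> 'h) \<Rightarrow> ('h, 'h, 'k) tensor \<Rightarrow> ('h, 'h, 'k) tensor"
  where "tensor_map P Q = tensor_lift scale scale UNIV UNIV (\<lambda>a b. pure_tensor scale scale (P a) (Q b))"

definition mult_map :: "('h, 'h, 'k) tensor \<Rightarrow> 'h"
  where "mult_map = tensor_lift scale scale UNIV UNIV (*)"

definition convolution :: "('h \<Rightarrow> 'h) \<Rightarrow> ('h \<Rightarrow> 'h) \<Rightarrow> 'h \<Rightarrow> 'h"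
  where "convolution P Q = mult_map \<circ> tensor_map P Q \<circ> \<Delta>"

definition conv_unit :: "'h \<Rightarrow> 'h"
  where "conv_unit x = \<epsilon> x *s 1"

definition conv_power :: "('h \<Rightarrow> 'h) \<Rightarrow> nat \<Rightarrow> 'h \<Rightarrow> 'h"
  where "conv_power P k = (convolution P ^^ k) conv_unit"

text \<open>
  \<open>Sum_any\<close> adds up the nonzero terms; in a graded connected bialgebra only finitely many
  terms are nonzero for each \<open>x\<close>.
\<close>

definition adams :: "'k \<Rightarrow> 'h \<Rightarrow> 'h"
  where "adams n x = Sum_any (\<lambda>k. (n gchoose k) *s conv_power (\<lambda>y. y - conv_unit y) k x)"

text \<open>An antipode is unique, and it exists for the graded connected bialgebras below.\<close>

definition is_antipode :: "('h \<Rightarrow> 'h) \<Rightarrow> bool"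
  where "is_antipode S \<longleftrightarrow> Vector_Spaces.linear scale scale S \<and>
    convolution S id = conv_unit \<and> convolution id S = conv_unit"

definition antipode :: "'h \<Rightarrow> 'h"
  where "antipode = (THE S. is_antipode S)"

section \<open>The coradical filtration\<close>

definition subcoalgebra :: "'h set \<Rightarrow> bool"
  where "subcoalgebra C \<longleftrightarrow> subspace C \<and> \<Delta> ` C \<subseteq> tensor_space scale scale C C"

definition simple_subcoalgebra :: "'h set \<Rightarrow> bool"
  where "simple_subcoalgebra C \<longleftrightarrow> subcoalgebra C \<and> C \<noteq> {0} \<and>
    (\<forall>D. subcoalgebra D \<and> D \<subseteq> C \<longrightarrow> D = {0} \<or> D = C)"

definition coradical :: "'h set"
  where "coradical = span (\<Union>{C. simple_subcoalgebra C})"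

primrec corad_filt :: "nat \<Rightarrow> 'h set" where
  "corad_filt 0 = coradical"
| "corad_filt (Suc j) = {x. \<exists>t \<in> tensor_space scale scale UNIV (corad_filt j).
                            \<exists>u \<in> tensor_space scale scale coradical UNIV. \<Delta> x = t + u}"

text \<open>The term preceding \<open>corad_filt j\<close> in the filtration, with \<open>0\<close> preceding the coradical.\<close>

definition corad_below :: "nat \<Rightarrow> 'h set"
  where "corad_below j = (case j of 0 \<Rightarrow> {0} | Suc i \<Rightarrow> corad_filt i)"

section \<open>The associated graded algebra\<close>

text \<open>
  An element of \<open>gr H\<close> is a sequence \<open>X\<close> with \<open>X j\<close> a coset of \<open>corad_below j\<close> in
  \<open>corad_filt j\<close>, equal to the zero coset for almost all \<open>j\<close>.  Sums, scalar multiples and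
  products are given by those of representatives.
\<close>

definition corad_coset :: "nat \<Rightarrow> 'h \<Rightarrow> 'h set"
  where "corad_coset j x = {y. y - x \<in> corad_below j}"

definition gr :: "(nat \<Rightarrow> 'h set) set"
  where "gr = {X. (\<forall>j. \<exists>x \<in> corad_filt j. X j = corad_coset j x) \<and> finite {j. X j \<noteq> corad_coset j 0}}"

definition gr_add :: "(nat \<Rightarrow> 'h set) \<Rightarrow> (nat \<Rightarrow> 'h set) \<Rightarrow> nat \<Rightarrow> 'h set"
  where "gr_add X Y j = \<Union>{corad_coset j (x + y) | x y. x \<in> X j \<and> y \<in> Y j}"

definition gr_scale :: "'k \<Rightarrow> (nat \<Rightarrow> 'h set) \<Rightarrow> nat \<Rightarrow> 'h set"
  where "gr_scale c X j = \<Union>{corad_coset j (c *s x) | x. x \<in> X j}"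

definition gr_mult :: "(nat \<Rightarrow> 'h set) \<Rightarrow> (nat \<Rightarrow> 'h set) \<Rightarrow> nat \<Rightarrow> 'h set"
  where "gr_mult X Y j =
    \<Union>{corad_coset j (\<Sum>i\<le>j. x i * y (j - i)) | x y. (\<forall>i. x i \<in> X i) \<and> (\<forall>i. y i \<in> Y i)}"

text \<open>The counit vanishes in positive degree; \<open>X 0\<close> is a singleton since \<open>corad_below 0 = {0}\<close>.\<close>

definition gr_counit :: "(nat \<Rightarrow> 'h set) \<Rightarrow> 'k"
  where "gr_counit X = \<epsilon> (the_elem (X 0))"

end

section \<open>Graded connected Hopf algebras\<close>

locale graded_connected_hopf_algebra = bialgebra scale \<Delta> \<epsilon>
  for scale :: "'k::field_char_0 \<Rightarrow> 'h::ring_1 \<Rightarrow> 'h" (infixr \<open>*s\<close> 75)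
    and \<Delta> :: "'h \<Rightarrow> ('h, 'h, 'k) tensor"
    and \<epsilon> :: "'h \<Rightarrow> 'k" +
  fixes H :: "nat \<Rightarrow> 'h set"
  assumes subspace_H: "subspace (H m)"
    and direct_sum_H:
      "\<exists>!c. (\<forall>m. c m \<in> H m) \<and> finite {m. c m \<noteq> 0} \<and> x = Sum_any c"
    and mult_H: "x \<in> H p \<Longrightarrow> y \<in> H q \<Longrightarrow> x * y \<in> H (p + q)"
    and comult_H: "x \<in> H m \<Longrightarrow>
      \<Delta> x \<in> fun_vs.span (\<Union>{tensor_space scale scale (H p) (H q) | p q. p + q = m})"
    and one_H: "1 \<in> H 0"
    and counit_H: "m > 0 \<Longrightarrow> x \<in> H m \<Longrightarrow> \<epsilon> x = 0"
    and connected: "dim (H 0) = 1"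
begin

text \<open>
  The second grading of \<open>gr H\<close>, induced by that of \<open>H\<close>; the quotient of
  \<open>corad_filt j \<inter> H m\<close> by \<open>corad_below j \<inter> H m\<close> is identified with its image in the
  quotient of \<open>corad_filt j\<close> by \<open>corad_below j\<close>.
\<close>

definition gr_grade :: "nat \<Rightarrow> (nat \<Rightarrow> 'h set) set"
  where "gr_grade m = {X \<in> gr. \<forall>j. \<exists>x \<in> corad_filt j \<inter> H m. X j = corad_coset j x}"

text \<open>
  The graded dual with respect to the second grading: linear functionals on \<open>gr H\<close>,
  extended by \<open>0\<close> outside the carrier, that vanish on all but finitely many of the
  components \<open>gr_grade m\<close>.  The dual of \<open>gr_grade m\<close> consists of the functionals that
  vanish on the other components.
\<close>

definition gr_dual :: "((nat \<Rightarrow> 'h set) \<Rightarrow> 'k) set"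
  where "gr_dual = {f.
    (\<forall>X. X \<notin> gr \<longrightarrow> f X = 0) \<and>
    (\<forall>X\<in>gr. \<forall>Y\<in>gr. f (gr_add X Y) = f X + f Y) \<and>
    (\<forall>c. \<forall>X\<in>gr. f (gr_scale c X) = c * f X) \<and>
    finite {m. \<exists>X\<in>gr_grade m. f X \<noteq> 0}}"

definition gr_dual_grade :: "nat \<Rightarrow> ((nat \<Rightarrow> 'h set) \<Rightarrow> 'k) set"
  where "gr_dual_grade m = {f \<in> gr_dual. \<forall>i. i \<noteq> m \<longrightarrow> (\<forall>X\<in>gr_grade i. f X = 0)}"

definition dual_one :: "(nat \<Rightarrow> 'h set) \<Rightarrow> 'k"
  where "dual_one X = (if X \<in> gr then gr_counit X else 0)"

text \<open>
  The coproduct of the graded dual is dual to the product of \<open>gr H\<close>: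
  \<open>\<langle>\<Delta> f, X \<otimes> Y\<rangle> = \<langle>f, X Y\<rangle>\<close>, where \<open>\<langle>\<phi> \<otimes> \<psi>, X \<otimes> Y\<rangle> = \<phi> X * \<psi> Y\<close>.
\<close>

definition dual_comult ::
  "((nat \<Rightarrow> 'h set) \<Rightarrow> 'k) \<Rightarrow> ((nat \<Rightarrow> 'h set) \<Rightarrow> 'k, (nat \<Rightarrow> 'h set) \<Rightarrow> 'k, 'k) tensor"
  where "dual_comult f = (THE t. t \<in> tensor_space fun_scale fun_scale gr_dual gr_dual \<and>
    (\<forall>X\<in>gr. \<forall>Y\<in>gr. tensor_lift fun_scale fun_scale gr_dual gr_dual (\<lambda>\<phi> \<psi>. \<phi> X * \<psi> Y) t = f (gr_mult X Y)))"

definition primitives :: "((nat \<Rightarrow> 'h set) \<Rightarrow> 'k) set"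
  where "primitives = {f \<in> gr_dual. dual_comult f =
    pure_tensor fun_scale fun_scale dual_one f + pure_tensor fun_scale fun_scale f dual_one}"

definition prim_dim :: "nat \<Rightarrow> nat"
  where "prim_dim i = fun_vs.dim (primitives \<inter> gr_dual_grade i)"

text \<open>
  Partitions are multisets of positive integers: \<open>|\<pi>|\<close> is \<open>\<Sum>\<^sub># \<pi>\<close>, the length is
  \<open>size \<pi>\<close>, and \<open>k\<^sub>i\<close> is \<open>count \<pi> i\<close>.  In the product, indices with \<open>k\<^sub>i = 0\<close>
  contribute a factor \<open>1\<close>.
\<close>

definition partition_binomial :: "nat multiset \<Rightarrow> nat"
  where "partition_binomial \<pi> = (\<Prod>i\<in>set_mset \<pi>. (prim_dim i + count \<pi> i - 1) choose count \<pi> i)"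

definition mul :: "nat \<Rightarrow> nat \<Rightarrow> nat"
  where "mul k m = (\<Sum>\<pi> | 0 \<notin># \<pi> \<and> \<Sum>\<^sub># \<pi> = m \<and> size \<pi> = k. partition_binomial \<pi>)"

text \<open>The sums are finite, as \<open>mul k m = 0\<close> for \<open>k > m\<close>.\<close>

definition emul :: "nat \<Rightarrow> nat"
  where "emul m = Sum_any (\<lambda>k. if even k then mul k m else 0)"

definition omul :: "nat \<Rightarrow> nat"
  where "omul m = Sum_any (\<lambda>k. if odd k then mul k m else 0)"

end

end

theory Submission
  imports Defs "HOL-Library.FuncSet" "HOL-Computational_Algebra.Polynomial"
begin

text \<open>
  Write \<open>F j\<close> for \<open>corad_filt j\<close> and \<open>F (-1) = 0\<close>, so that \<open>corad_below j\<close> is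
  \<open>F (j - 1)\<close>. The Adams operators preserve the coradical filtration, so their traces can be
  computed on \<open>gr H\<close>. This is a commutative connected Hopf algebra in characteristic
  zero, hence a polynomial algebra; \<open>\<Psi>\<^sub>n\<close> is multiplicative on it and acts as \<open>n\<close> on the
  indecomposables, so a monomial of length \<open>k\<close> contributes \<open>n ^ k\<close>. The generators of
  degree \<open>i\<close> are dual to the primitive elements of degree \<open>i\<close> of the graded dual, so there
  are \<open>g\<^sub>i\<close> of them, and counting the monomials of length \<open>k\<close> and degree \<open>m\<close> gives
  \<open>mul k m\<close>.

  The argument is carried out in \<open>H\<close> itself, modulo lower terms of the filtration, and tensors
  are handled by letting a functional \<open>f\<close> act as \<open>lact f = (f \<otimes> id) \<circ> \<Delta>\<close>. Since \<open>H 0\<close>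
  is the line of \<open>1\<close>, so is the coradical, and \<open>F (j + 1)\<close> consists of the \<open>x\<close> with
  \<open>lact f x \<in> F j\<close> whenever \<open>f 1 = 0\<close> (\<open>corad_below_Suc_iff\<close>). It follows that \<open>lact f\<close>
  lowers the filtration degree by \<open>b\<close> if \<open>f\<close> kills \<open>F (b - 1)\<close> (\<open>lact_annihilator\<close>), which
  is dual to \<open>\<Delta> (F a) \<subseteq> (\<Sum>i\<le>a. F i \<otimes> F (a - i))\<close> (\<open>filtered_sweedlerE\<close>). With this,
  products add filtration degrees, and commutators have degree one less than expected
  (\<open>commutator_corad_below\<close>): this is the commutativity of \<open>gr H\<close>.

  Choose homogeneous generators in each positive filtration degree, complementing the
  decomposable elements. Monomials in them span by induction
  (\<open>corad_below_span_mon\<close>). For their independence, let \<open>f\<close> be the functional dual to a generator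
  \<open>v\<close> that kills decomposables. Then \<open>lact f\<close> is a derivation modulo lower terms
  (\<open>lact_derivation\<close>), and on polynomials in generators of degree at most that of \<open>v\<close> it
  is the partial derivative with respect to \<open>v\<close> (\<open>lact_mon\<close>). Differentiating a relation
  of least degree by a generator of highest degree in it yields a smaller relation, with
  coefficients multiplied by exponents; in characteristic zero this is absurd
  (\<open>mon_independent_graded\<close>).

  For a natural number \<open>n\<close>, \<open>\<Psi>\<^sub>n\<close> is the convolution power \<open>id\<^sup>*\<^sup>n\<close>. By commutativity of
  \<open>gr H\<close> it is multiplicative modulo lower terms (\<open>ipower_mult\<close>), and it multiplies a generator by
  \<open>n\<close> modulo decomposables (\<open>ipower_decomposables\<close>). So it maps a monomial of length \<open>k\<close> to
  \<open>n ^ k\<close> times itself plus other monomials, which do not affect the trace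
  (\<open>trace_on_eigenfamily\<close>). Both sides of the formula are polynomials in \<open>n\<close>, so it extends from
  natural numbers to all scalars (\<open>trace_adams\<close>), and the antipode is the case \<open>n = -1\<close>.

  It remains to see that the generators of degree \<open>i\<close> are counted by \<open>prim_dim i\<close>
  (\<open>prim_dim_eq\<close>). The coproduct of the graded dual is specified by its pairing with
  \<open>gr H \<times> gr H\<close>; existence uses a basis of \<open>H\<close> adapted to both the filtration and the grading
  (\<open>dual_comult_exists\<close>). A functional of positive degree is then primitive if and only if it kills
  products of elements of positive filtration degree, so the primitives are dual to the generators.
\<close>

section \<open>Linear algebra\<close>

lemma linearI:
  assumes "vector_space s1" "vector_space s2"
    and "\<And>x y. f (x + y) = f x + f y" "\<And>c x. f (s1 c x) = s2 c (f x)"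
  shows "Vector_Spaces.linear s1 s2 f"
  using assms by (auto simp: Vector_Spaces.linear_iff)

lemma linearD:
  assumes "Vector_Spaces.linear s1 s2 f"
  shows "f (x + y) = f x + f y" "f (s1 c x) = s2 c (f x)" "f 0 = 0" "f (x - y) = f x - f y"
    "f (- x) = - f x" "f (\<Sum>i\<in>I. g i) = (\<Sum>i\<in>I. f (g i))"
    "f (sum_list xs) = (\<Sum>x\<leftarrow>xs. f x)"
proof -
  interpret l: Vector_Spaces.linear s1 s2 f by fact
  show "f (x + y) = f x + f y" "f (s1 c x) = s2 c (f x)" "f 0 = 0" "f (x - y) = f x - f y"
    "f (- x) = - f x" "f (\<Sum>i\<in>I. g i) = (\<Sum>i\<in>I. f (g i))"
    by (simp_all add: l.add l.scale l.zero l.diff l.neg l.sum)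
  show "f (sum_list xs) = (\<Sum>x\<leftarrow>xs. f x)"
    by (induction xs) (auto simp: l.zero l.add)
qed

lemma linear_vector_spaceD:
  assumes "Vector_Spaces.linear s1 s2 f"
  shows "vector_space s1" "vector_space s2"
  using assms by (auto simp: Vector_Spaces.linear_iff)

lemma vector_space_field: "vector_space ((*) :: 'k::field \<Rightarrow> 'k \<Rightarrow> 'k)"
  by unfold_locales (auto simp: algebra_simps)

context vector_space
begin

lemma exists_functional:
  assumes "subspace S" "v \<notin> S"
  obtains h where "Vector_Spaces.linear scale (*) h" "h v = 1" "\<And>x. x \<in> S \<Longrightarrow> h x = 0"
proof -
  interpret vp: vector_space_pair scale "(*) :: 'a \<Rightarrow> _"
    by (intro vector_space_pair.intro vector_space_field vector_space_axioms)
  obtain B where B: "B \<subseteq> S" "independent B" "S \<subseteq> span B"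
    using maximal_independent_subset[of S] by blast
  have sB: "span B = S" using B assms by (simp add: span_subspace)
  have ind: "independent (insert v B)" using B assms sB by (simp add: independent_insertI)
  obtain g where g: "Vector_Spaces.linear scale (*) g"
      "\<And>x. x \<in> insert v B \<Longrightarrow> g x = (if x = v then 1 else 0)"
    using vp.linear_independent_extend[OF ind, of "\<lambda>x. if x = v then 1 else 0"] by blast
  have "g x = 0" if "x \<in> S" for x
  proof -
    have "x \<in> span B" using that sB by simp
    moreover have "\<And>b. b \<in> B \<Longrightarrow> g b = 0" using g(2) B assms by auto
    ultimately show ?thesis
      using module_hom.eq_0_on_span[of scale "(*)" g B x] g(1) by (auto simp: Vector_Spaces.linear_def)
  qed
  then show ?thesis using g(1) g(2)[of v] that[of g] by simp
qed

lemma functionals_separate: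
  assumes "\<And>h. Vector_Spaces.linear scale (*) h \<Longrightarrow> h x = h y"
  shows "x = y"
proof (rule ccontr)
  assume "x \<noteq> y"
  then have "x - y \<notin> {0}" by simp
  then obtain h where "Vector_Spaces.linear scale (*) h" "h (x - y) = 1"
    using exists_functional[OF subspace_single_0] by blast
  then show False using assms[of h] by (simp add: linearD)
qed

lemma exists_projection:
  assumes "subspace S"
  obtains P where "Vector_Spaces.linear scale scale P" "\<And>x. P x \<in> S" "\<And>x. x \<in> S \<Longrightarrow> P x = x"
proof -
  interpret vp: vector_space_pair scale scale
    by (intro vector_space_pair.intro vector_space_axioms)
  obtain B where B: "B \<subseteq> S" "independent B" "S \<subseteq> span B"
    using maximal_independent_subset[of S] by blast
  have sB: "span B = S" using B assms by (simp add: span_subspace)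
  obtain g where g: "\<forall>x\<in>B. g x = x" "Vector_Spaces.linear scale scale g" "range g = span (id ` B)"
    using vp.linear_independent_extend_subspace[OF B(2), of id] by auto
  have gS: "g x = x" if "x \<in> S" for x
  proof -
    have "x \<in> span B" using that sB by simp
    then show ?thesis
    proof (induction rule: span_induct_alt)
      case base then show ?case using g(2) by (simp add: linearD)
    next
      case (step c x y) then show ?case using g by (simp add: linearD)
    qed
  qed
  show ?thesis using that[of g] g gS sB by auto
qed

lemma linear_representation_UNIV:
  assumes "independent B" "span B = UNIV"
  shows "Vector_Spaces.linear scale (*) (\<lambda>v. representation B v b)"
  using assms by (intro linearI vector_space_axioms vector_space_field)
    (auto simp: representation_add representation_scale)

lemma representation_span_subset:
  assumes "independent B" "x \<in> span C" "C \<subseteq> B" "b \<notin> C"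
  shows "representation B x b = 0"
proof -
  have "representation B x = representation C x"
    using assms by (intro representation_extend) auto
  moreover have "independent C" using assms independent_mono by blast
  ultimately show ?thesis using assms representation_ne_zero by metis
qed

subsection \<open>Traces\<close>

text \<open>
  Expand each basis by the other: both sides become the same double sum of products of
  coefficients, in the two orders of summation.
\<close>

lemma trace_basis_independent:
  assumes B: "finite B" "independent B" "span B = V"
    and B': "finite B'" "independent B'" "span B' = V"
    and f: "Vector_Spaces.linear scale scale f" "f ` V \<subseteq> V"
  shows "(\<Sum>b\<in>B. representation B (f b) b) = (\<Sum>b\<in>B'. representation B' (f b) b)"
proof -
  have BV: "b \<in> V" if "b \<in> B" for b using that B span_base by auto
  have B'V: "b \<in> V" if "b \<in> B'" for b using that B' span_base by auto
  have eB': "(\<Sum>c\<in>B'. representation B' x c *s c) = x" if "x \<in> V" for x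
    using sum_representation_eq[of B' x B'] B' that by auto
  have eB: "(\<Sum>c\<in>B. representation B x c *s c) = x" if "x \<in> V" for x
    using sum_representation_eq[of B x B] B that by auto
  have "(\<Sum>b\<in>B. representation B (f b) b) = (\<Sum>b\<in>B. \<Sum>c\<in>B'. representation B' b c * representation B (f c) b)"
  proof (rule sum.cong[OF refl])
    fix b assume b: "b \<in> B"
    have "f b = f (\<Sum>c\<in>B'. representation B' b c *s c)" using eB' BV b by simp
    also have "\<dots> = (\<Sum>c\<in>B'. representation B' b c *s f c)" using f by (simp add: linearD)
    finally have "representation B (f b) b = representation B (\<Sum>c\<in>B'. representation B' b c *s f c) b" by simp
    also have "\<dots> = (\<Sum>c\<in>B'. representation B (representation B' b c *s f c) b)"
      using B B'V f by (subst representation_sum) (auto intro!: subspace_scale)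
    also have "\<dots> = (\<Sum>c\<in>B'. representation B' b c * representation B (f c) b)"
      using B B'V f by (intro sum.cong refl) (auto simp: representation_scale image_subset_iff)
    finally show "representation B (f b) b = (\<Sum>c\<in>B'. representation B' b c * representation B (f c) b)" .
  qed
  also have "\<dots> = (\<Sum>c\<in>B'. \<Sum>b\<in>B. representation B' b c * representation B (f c) b)"
    by (rule sum.swap)
  also have "\<dots> = (\<Sum>c\<in>B'. representation B' (f c) c)"
  proof (rule sum.cong[OF refl])
    fix c assume c: "c \<in> B'"
    then have fc: "f c \<in> V" using B'V f by auto
    have "representation B' (f c) c = representation B' (\<Sum>b\<in>B. representation B (f c) b *s b) c"
      using eB fc by simp
    also have "\<dots> = (\<Sum>b\<in>B. representation B' (representation B (f c) b *s b) c)"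
      using B' BV by (subst representation_sum) (auto intro!: subspace_scale)
    also have "\<dots> = (\<Sum>b\<in>B. representation B' b c * representation B (f c) b)"
      using B' BV by (intro sum.cong refl) (auto simp: representation_scale)
    finally show "(\<Sum>b\<in>B. representation B' b c * representation B (f c) b) = representation B' (f c) c" by simp
  qed
  finally show ?thesis .
qed

lemma trace_on_basis:
  assumes B: "finite B" "independent B" "span B = V"
    and f: "Vector_Spaces.linear scale scale f" "f ` V \<subseteq> V"
  shows "trace_on V f = (\<Sum>b\<in>B. representation B (f b) b)"
proof -
  define C where "C = (SOME B. independent B \<and> span B = V)"
  have C: "independent C \<and> span C = V"
    unfolding C_def by (rule someI_ex) (use B in auto)
  have "C \<subseteq> span B" using C B span_superset by auto
  then have "finite C" using independent_span_bound[OF B(1), of C] C by auto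
  then show ?thesis
    unfolding trace_on_def C_def[symmetric] Let_def
    using trace_basis_independent[OF _ _ _ B f, of C] C by auto
qed


end

lemma (in vector_space) independent_family:
  fixes b :: "'i \<Rightarrow> 'b"
  assumes I: "finite I" and ind: "\<And>c. (\<Sum>i\<in>I. c i *s b i) = 0 \<Longrightarrow> \<forall>i\<in>I. c i = 0"
  shows "inj_on b I" "independent (b ` I)"
proof -
  show inj: "inj_on b I"
  proof (rule inj_onI, rule ccontr)
    fix i j assume ij: "i \<in> I" "j \<in> I" "b i = b j" "i \<noteq> j"
    have "(\<Sum>k\<in>I. (if k = i then 1 else if k = j then - 1 else 0) *s b k) =
        (\<Sum>k\<in>{i,j}. (if k = i then 1 else if k = j then - 1 else 0) *s b k)"
      using ij I by (intro sum.mono_neutral_right) auto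
    also have "\<dots> = 0" using ij by simp
    finally show False using ind[of "\<lambda>k. if k = i then 1 else if k = j then - 1 else 0"] ij by auto
  qed
  show "independent (b ` I)"
  proof (rule independent_if_scalars_zero)
    show "finite (b ` I)" using I by simp
    fix u x assume u: "(\<Sum>x\<in>b ` I. u x *s x) = 0" and "x \<in> b ` I"
    then obtain i where i: "i \<in> I" "x = b i" by blast
    have "(\<Sum>i\<in>I. u (b i) *s b i) = 0" using u inj by (simp add: sum.reindex)
    then show "u x = 0" using ind[of "\<lambda>i. u (b i)"] i by auto
  qed
qed

text \<open>
  The trace sees only the coefficient of \<open>b i\<close> in \<open>f (b i)\<close>. The condition that the error term
  avoids \<open>b i\<close> in the basis stands in for triangularity with respect to some order.
\<close>

lemma (in vector_space) trace_on_eigenfamily: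
  fixes b :: "'i \<Rightarrow> 'b"
  assumes I: "finite I" and ind: "\<And>c. (\<Sum>i\<in>I. c i *s b i) = 0 \<Longrightarrow> \<forall>i\<in>I. c i = 0"
    and sp: "span (b ` I) = V"
    and f: "Vector_Spaces.linear scale scale f" "f ` V \<subseteq> V"
    and eig: "\<And>i. i \<in> I \<Longrightarrow> f (b i) - \<mu> i *s b i \<in> span (b ` (I - {i}))"
  shows "trace_on V f = (\<Sum>i\<in>I. \<mu> i)"
proof -
  note inj = independent_family(1)[OF I ind] and indep = independent_family(2)[OF I ind]
  have bV: "b i \<in> V" if "i \<in> I" for i using that sp span_base by auto
  have "trace_on V f = (\<Sum>x\<in>b ` I. representation (b ` I) (f x) x)"
    using I indep sp f by (intro trace_on_basis) auto
  also have "\<dots> = (\<Sum>i\<in>I. representation (b ` I) (f (b i)) (b i))"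
    using inj by (simp add: sum.reindex)
  also have "\<dots> = (\<Sum>i\<in>I. \<mu> i)"
  proof (rule sum.cong[OF refl])
    fix i assume i: "i \<in> I"
    let ?d = "f (b i) - \<mu> i *s b i"
    have d: "?d \<in> span (b ` (I - {i}))" using eig i by simp
    have 0: "representation (b ` I) ?d (b i) = 0"
      using indep d by (rule representation_span_subset) (use inj i in \<open>auto dest: inj_onD\<close>)
    have "f (b i) = ?d + \<mu> i *s b i" by simp
    also have "representation (b ` I) \<dots> (b i) =
        representation (b ` I) ?d (b i) + representation (b ` I) (\<mu> i *s b i) (b i)"
    proof -
      have "?d \<in> span (b ` I)" using d span_mono[of "b ` (I - {i})" "b ` I"] by auto
      moreover have "\<mu> i *s b i \<in> span (b ` I)" using bV[OF i] sp by (auto intro: span_scale)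
      ultimately have "representation (b ` I) (?d + \<mu> i *s b i) =
          (\<lambda>x. representation (b ` I) ?d x + representation (b ` I) (\<mu> i *s b i) x)"
        using indep by (intro representation_add)
      then show ?thesis by (rule fun_cong)
    qed
    also have "\<dots> = \<mu> i"
    proof -
      have "b i \<in> b ` I" using i by simp
      then have "representation (b ` I) (\<mu> i *s b i) (b i) = \<mu> i"
        using indep by (simp add: representation_scale representation_basis span_base)
      with 0 show ?thesis by simp
    qed
    finally show "representation (b ` I) (f (b i)) (b i) = \<mu> i" .
  qed
  finally show ?thesis .
qed

lemma (in vector_space) trace_on_cong:
  assumes B: "independent B" "span B = V" and eq: "\<And>x. x \<in> V \<Longrightarrow> f x = g x"
  shows "trace_on V f = trace_on V g"
proof -
  define C where "C = (SOME B. independent B \<and> span B = V)"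
  have "independent C \<and> span C = V"
    unfolding C_def by (rule someI_ex) (use B in auto)
  then have "C \<subseteq> V" using span_superset by blast
  then show ?thesis
    unfolding trace_on_def C_def[symmetric] Let_def using eq by (intro sum.cong) auto
qed

section \<open>Sums of pure tensors\<close>

definition bilin ::
  "('k::field \<Rightarrow> 'a::ab_group_add \<Rightarrow> 'a) \<Rightarrow> ('k \<Rightarrow> 'b::ab_group_add \<Rightarrow> 'b) \<Rightarrow> ('k \<Rightarrow> 'c::ab_group_add \<Rightarrow> 'c) \<Rightarrow> ('a \<Rightarrow> 'b \<Rightarrow> 'c) \<Rightarrow> bool"
  where "bilin sA sB sC \<phi> \<longleftrightarrow>
    (\<forall>b. Vector_Spaces.linear sA sC (\<lambda>a. \<phi> a b)) \<and> (\<forall>a. Vector_Spaces.linear sB sC (\<lambda>b. \<phi> a b))"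

lemma bilinear_form_bilin: "bilinear_form sA sB \<beta> \<longleftrightarrow> bilin sA sB (*) \<beta>"
  by (simp add: bilinear_form_def bilin_def)

lemma bilinI:
  assumes "vector_space sA" "vector_space sB" "vector_space sC"
    and "\<And>a a' b. \<phi> (a + a') b = \<phi> a b + \<phi> a' b" "\<And>a b b'. \<phi> a (b + b') = \<phi> a b + \<phi> a b'"
    and "\<And>c a b. \<phi> (sA c a) b = sC c (\<phi> a b)" "\<And>c a b. \<phi> a (sB c b) = sC c (\<phi> a b)"
  shows "bilin sA sB sC \<phi>"
  using assms unfolding bilin_def by (auto intro!: linearI)

lemma bilinD:
  assumes "bilin sA sB sC \<phi>"
  shows "\<phi> (a + a') b = \<phi> a b + \<phi> a' b" "\<phi> a (b + b') = \<phi> a b + \<phi> a b'"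
    "\<phi> (sA c a) b = sC c (\<phi> a b)" "\<phi> a (sB c b) = sC c (\<phi> a b)"
    "\<phi> 0 b = 0" "\<phi> a 0 = 0"
    "\<phi> (a - a') b = \<phi> a b - \<phi> a' b" "\<phi> a (b - b') = \<phi> a b - \<phi> a b'"
  using assms unfolding bilin_def by (auto dest: linearD)

lemma bilin_vector_space:
  assumes "bilin sA sB sC \<phi>"
  shows "vector_space sA" "vector_space sB" "vector_space sC"
  using assms unfolding bilin_def by (auto dest: linear_vector_spaceD)

lemma bilin_compose:
  assumes "bilin sA sB sC \<phi>" "Vector_Spaces.linear sC sD h"
  shows "bilin sA sB sD (\<lambda>a b. h (\<phi> a b))"
  using bilin_vector_space[OF assms(1)] linear_vector_spaceD[OF assms(2)]
  by (intro bilinI) (auto simp: bilinD[OF assms(1)] linearD[OF assms(2)])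

text \<open>
  Tensors are treated as formal sums of pairs: the lists \<open>ps\<close> are the summation ranges of
  Sweedler notation.
\<close>

definition tsum ::
  "('k::field \<Rightarrow> 'a::ab_group_add \<Rightarrow> 'a) \<Rightarrow> ('k \<Rightarrow> 'b::ab_group_add \<Rightarrow> 'b) \<Rightarrow> ('a \<times> 'b) list \<Rightarrow> ('a, 'b, 'k) tensor"
  where "tsum sA sB ps = (\<Sum>(a, b)\<leftarrow>ps. pure_tensor sA sB a b)"

lemma tsum_simps [simp]:
  "tsum sA sB [] = 0" "tsum sA sB ((a, b) # ps) = pure_tensor sA sB a b + tsum sA sB ps"
  "tsum sA sB (ps @ qs) = tsum sA sB ps + tsum sA sB qs"
  by (auto simp: tsum_def)

lemma tsum_apply:
  "tsum sA sB ps \<beta> = (if bilinear_form sA sB \<beta> then \<Sum>(a, b)\<leftarrow>ps. \<beta> a b else 0)"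
  by (induction ps) (auto simp: pure_tensor_def)

lemma tsum_eqI:
  assumes "\<And>\<beta>. bilinear_form sA sB \<beta> \<Longrightarrow> (\<Sum>(a, b)\<leftarrow>ps. \<beta> a b) = (\<Sum>(a, b)\<leftarrow>qs. \<beta> a b)"
  shows "tsum sA sB ps = tsum sA sB qs"
  using assms by (intro ext) (auto simp: tsum_apply)

text \<open>
  The universal property of the tensor product, reduced to its definition by bilinear forms
  with values in the field, since functionals separate the points of the target.
\<close>

lemma tsum_eq_imp_sum_eq:
  assumes \<phi>: "bilin sA sB sC \<phi>" and eq: "tsum sA sB ps = tsum sA sB qs"
  shows "(\<Sum>(a, b)\<leftarrow>ps. \<phi> a b) = (\<Sum>(a, b)\<leftarrow>qs. \<phi> a b)"
proof -
  interpret C: vector_space sC using bilin_vector_space[OF \<phi>] by auto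
  show ?thesis
  proof (rule C.functionals_separate)
    fix h assume h: "Vector_Spaces.linear sC (*) h"
    have b: "bilinear_form sA sB (\<lambda>a b. h (\<phi> a b))"
      using bilin_compose[OF \<phi> h] by (simp add: bilinear_form_bilin)
    have *: "h (\<Sum>(a, b)\<leftarrow>rs. \<phi> a b) = tsum sA sB rs (\<lambda>a b. h (\<phi> a b))" for rs
      using b by (simp add: tsum_apply linearD(7)[OF h] o_def case_prod_unfold)
    show "h (\<Sum>(a, b)\<leftarrow>ps. \<phi> a b) = h (\<Sum>(a, b)\<leftarrow>qs. \<phi> a b)"
      by (simp add: * eq)
  qed
qed

text \<open>
  Defining \<open>\<psi>\<close> on a subspace only is covered by asking for some bilinear extension \<open>\<phi>\<close> to the
  whole types.
\<close>

lemma tensor_lift_tsum: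
  assumes \<phi>: "bilin sA sB sC \<phi>" and ps: "set ps \<subseteq> A \<times> B"
    and eq: "\<And>a b. a \<in> A \<Longrightarrow> b \<in> B \<Longrightarrow> \<psi> a b = \<phi> a b"
  shows "tensor_lift sA sB A B \<psi> (tsum sA sB ps) = (\<Sum>(a, b)\<leftarrow>ps. \<phi> a b)"
proof -
  have *: "(\<Sum>(a, b)\<leftarrow>rs. \<psi> a b) = (\<Sum>(a, b)\<leftarrow>rs. \<phi> a b)" if "set rs \<subseteq> A \<times> B" for rs
    using that eq by (intro arg_cong[of _ _ sum_list] map_cong) auto
  show ?thesis
    unfolding tensor_lift_def
  proof (rule the_equality)
    show "\<exists>qs. set qs \<subseteq> A \<times> B \<and> tsum sA sB ps = (\<Sum>(a, b)\<leftarrow>qs. pure_tensor sA sB a b) \<and>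
        (\<Sum>(a, b)\<leftarrow>ps. \<phi> a b) = (\<Sum>(a, b)\<leftarrow>qs. \<psi> a b)"
      using ps *[OF ps] by (intro exI[of _ ps]) (auto simp: tsum_def)
  next
    fix z assume "\<exists>qs. set qs \<subseteq> A \<times> B \<and> tsum sA sB ps = (\<Sum>(a, b)\<leftarrow>qs. pure_tensor sA sB a b) \<and>
        z = (\<Sum>(a, b)\<leftarrow>qs. \<psi> a b)"
    then obtain qs where qs: "set qs \<subseteq> A \<times> B" "tsum sA sB ps = tsum sA sB qs"
        "z = (\<Sum>(a, b)\<leftarrow>qs. \<psi> a b)" by (auto simp: tsum_def)
    then show "z = (\<Sum>(a, b)\<leftarrow>ps. \<phi> a b)"
      using tsum_eq_imp_sum_eq[OF \<phi> qs(2)] * by simp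
  qed
qed

lemma bilin_pure_tensor:
  assumes "vector_space sA" "vector_space sB"
  shows "bilin sA sB fun_scale (pure_tensor sA sB)"
proof (rule bilinI[OF assms fun_vs.vector_space_axioms])
qed (auto simp: pure_tensor_def fun_eq_iff fun_scale_def bilinear_form_bilin bilinD)

lemma scale_tsum:
  assumes "vector_space sA" "vector_space sB"
  shows "fun_scale c (tsum sA sB ps) = tsum sA sB (map (\<lambda>(a, b). (sA c a, b)) ps)"
proof (induction ps)
  case Nil
  show ?case by (simp add: fun_scale_def fun_eq_iff)
next
  case (Cons p ps)
  then show ?case
    by (cases p) (simp only: tsum_simps fun_vs.scale_right_distrib list.map prod.case
        bilinD(3)[OF bilin_pure_tensor[OF assms]])
qed

lemma span_pure_tensors:
  assumes vs: "vector_space sA" "vector_space sB"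
    and t: "t \<in> fun_vs.span {pure_tensor sA sB a b | a b. R a b}"
    and R: "\<And>c a b. R a b \<Longrightarrow> R (sA c a) b"
  obtains ps where "t = tsum sA sB ps" "\<And>a b. (a, b) \<in> set ps \<Longrightarrow> R a b"
proof -
  have "\<exists>ps. t = tsum sA sB ps \<and> (\<forall>(a, b)\<in>set ps. R a b)"
    using t
  proof (induction rule: fun_vs.span_induct_alt)
    case base
    show ?case by (intro exI[of _ "[]"]) auto
  next
    case (step c x y)
    then obtain a b ps where *: "x = pure_tensor sA sB a b" "R a b" "y = tsum sA sB ps" "\<forall>(a, b)\<in>set ps. R a b"
      by blast
    then show ?case using R[of a b c]
      by (intro exI[of _ "(sA c a, b) # ps"]) (auto simp: bilinD[OF bilin_pure_tensor[OF vs]])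
  qed
  then show ?thesis using that by auto
qed

lemma tsum_in_span:
  assumes "\<And>a b. (a, b) \<in> set ps \<Longrightarrow> R a b"
  shows "tsum sA sB ps \<in> fun_vs.span {pure_tensor sA sB a b | a b. R a b}"
  using assms
proof (induction ps)
  case (Cons p ps)
  obtain a b where p: "p = (a, b)" by force
  then have "pure_tensor sA sB a b \<in> {pure_tensor sA sB a b | a b. R a b}" using Cons.prems by auto
  with Cons p show ?case
    by (simp only: tsum_simps) (rule fun_vs.span_add; simp add: fun_vs.span_base)
qed (auto simp: fun_vs.span_zero)

lemma tensor_spaceE:
  assumes "vector_space sA" "vector_space sB" "module.subspace sA A" "t \<in> tensor_space sA sB A B"
  obtains ps where "t = tsum sA sB ps" "set ps \<subseteq> A \<times> B"
proof -
  interpret A: vector_space sA by fact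
  show ?thesis
    using assms(4) unfolding tensor_space_def
  proof (rule span_pure_tensors[OF assms(1,2)])
    show "sA c a \<in> A \<and> b \<in> B" if "a \<in> A \<and> b \<in> B" for c a b
      using that assms(3) by (simp add: A.subspace_scale)
  qed (use that in fastforce)
qed

lemma tsum_in_tensor_space: "set ps \<subseteq> A \<times> B \<Longrightarrow> tsum sA sB ps \<in> tensor_space sA sB A B"
  unfolding tensor_space_def by (rule tsum_in_span) auto

text \<open>
  The tensor product is separated by products of functionals. By expanding the first factors in a
  basis, a tensor is determined by its contractions with the coordinate functionals.
\<close>

lemma tensor_eqI:
  assumes vs: "vector_space sA" "vector_space sB"
    and eq: "\<And>f g. Vector_Spaces.linear sA (*) f \<Longrightarrow> Vector_Spaces.linear sB (*) g \<Longrightarrow>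
      (\<Sum>(a, b)\<leftarrow>ps. f a * g b) = (\<Sum>(a, b)\<leftarrow>qs. f a * g b)"
  shows "tsum sA sB ps = tsum sA sB qs"
proof (rule tsum_eqI)
  fix \<beta> assume \<beta>: "bilinear_form sA sB \<beta>"
  interpret A: vector_space sA by fact
  interpret B: vector_space sB by fact
  \<comment> \<open>expand the first factors in a basis; \<open>F\<close> collects the basis elements that occur\<close>
  obtain C where C: "A.independent C" "UNIV \<subseteq> A.span C"
    using A.maximal_independent_subset[of UNIV] by auto
  define F where "F = (\<Union>(a, b)\<in>set (ps @ qs). {c. A.representation C a c \<noteq> 0})"
  have F: "finite F" unfolding F_def by (auto simp: A.finite_representation)
  have lin: "Vector_Spaces.linear sA (*) (\<lambda>v. A.representation C v c)" for c
    using C by (intro A.linear_representation_UNIV) auto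
  have expand: "(\<Sum>(a, b)\<leftarrow>rs. \<beta> a b) = (\<Sum>c\<in>F. \<beta> c (\<Sum>(a, b)\<leftarrow>rs. sB (A.representation C a c) b))"
    if rs: "set rs \<subseteq> set (ps @ qs)" for rs
    using rs
  proof (induction rs)
    case Nil
    then show ?case using \<beta> by (auto simp: bilinear_form_bilin bilinD)
  next
    case (Cons p rs)
    obtain a b where p: "p = (a, b)" by force
    have sub: "{c. A.representation C a c \<noteq> 0} \<subseteq> F" using Cons.prems p unfolding F_def by auto
    have "a = (\<Sum>c\<in>{c. A.representation C a c \<noteq> 0}. sA (A.representation C a c) c)"
      using C by (subst A.sum_nonzero_representation_eq) auto
    also have "\<dots> = (\<Sum>c\<in>F. sA (A.representation C a c) c)"
      using F sub by (intro sum.mono_neutral_left) auto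
    finally have "\<beta> a b = \<beta> (\<Sum>c\<in>F. sA (A.representation C a c) c) b" by simp
    also have "\<dots> = (\<Sum>c\<in>F. \<beta> (sA (A.representation C a c) c) b)"
      using \<beta> linearD(6)[of sA "(*)" "\<lambda>a. \<beta> a b"] by (auto simp: bilinear_form_def)
    also have "\<dots> = (\<Sum>c\<in>F. \<beta> c (sB (A.representation C a c) b))"
      using \<beta> by (simp add: bilinear_form_bilin bilinD)
    finally show ?case using Cons p \<beta>
      by (simp add: bilinear_form_bilin bilinD sum.distrib)
  qed
  have "(\<Sum>(a, b)\<leftarrow>ps. sB (A.representation C a c) b) = (\<Sum>(a, b)\<leftarrow>qs. sB (A.representation C a c) b)" for c
  proof (rule B.functionals_separate)
    fix h assume h: "Vector_Spaces.linear sB (*) h"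
    show "h (\<Sum>(a, b)\<leftarrow>ps. sB (A.representation C a c) b) = h (\<Sum>(a, b)\<leftarrow>qs. sB (A.representation C a c) b)"
      using eq[OF lin h, of c]
      by (simp add: linearD(7)[OF h] linearD(2)[OF h] o_def case_prod_unfold)
  qed
  then show "(\<Sum>(a, b)\<leftarrow>ps. \<beta> a b) = (\<Sum>(a, b)\<leftarrow>qs. \<beta> a b)"
    using expand[of ps] expand[of qs] by simp
qed

section \<open>Sums over Sweedler representatives\<close>

lemma sum_list_concat_map: "(\<Sum>x\<leftarrow>concat (map f xs). g x) = (\<Sum>x\<leftarrow>xs. \<Sum>y\<leftarrow>f x. (g y :: 'b::comm_monoid_add))"
  by (induction xs) auto

lemma sum_list_pair_cong:
  assumes "\<And>a b. (a, b) \<in> set ps \<Longrightarrow> f a b = g a b"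
  shows "(\<Sum>(a, b)\<leftarrow>ps. f a b) = (\<Sum>(a, b)\<leftarrow>ps. g a b)"
  using assms by (intro arg_cong[of _ _ sum_list] map_cong) auto

lemma linear_sum_list_pair:
  assumes "Vector_Spaces.linear s1 s2 f"
  shows "f (\<Sum>(a, b)\<leftarrow>ps. g a b) = (\<Sum>(a, b)\<leftarrow>ps. f (g a b))"
  by (simp add: linearD(7)[OF assms] o_def case_prod_unfold)

lemma sum_list_pair_add:
  "(\<Sum>(a, b)\<leftarrow>ps. f a b + g a b) = (\<Sum>(a, b)\<leftarrow>ps. f a b) + (\<Sum>(a, b)\<leftarrow>ps. (g a b :: 'c::comm_monoid_add))"
  by (simp add: case_prod_unfold sum_list_addf)

lemma sum_list_pair_diff:
  "(\<Sum>(a, b)\<leftarrow>ps. f a b - g a b) = (\<Sum>(a, b)\<leftarrow>ps. f a b) - (\<Sum>(a, b)\<leftarrow>ps. (g a b :: 'c::ab_group_add))"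
  by (simp add: case_prod_unfold sum_list_subtractf)

lemma sum_list_pair_const_mult:
  "(c :: 'r::semiring_0) * (\<Sum>(a, b)\<leftarrow>ps. f a b) = (\<Sum>(a, b)\<leftarrow>ps. c * f a b)"
  by (simp add: case_prod_unfold sum_list_const_mult)

lemma sum_list_pair_mult_const:
  "(\<Sum>(a, b)\<leftarrow>ps. f a b) * (c :: 'r::semiring_0) = (\<Sum>(a, b)\<leftarrow>ps. f a b * c)"
  by (simp add: case_prod_unfold sum_list_mult_const)

lemma sum_list_pair_swap:
  "(\<Sum>(a, b)\<leftarrow>ps. \<Sum>(c, d)\<leftarrow>qs. f a b c d) = (\<Sum>(c, d)\<leftarrow>qs. \<Sum>(a, b)\<leftarrow>ps. (f a b c d :: 'z::comm_monoid_add))"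
  by (induction ps) (auto simp: sum_list_pair_add split_def sum_list_addf)

lemma sum_list_pair_product:
  "(\<Sum>(a, b)\<leftarrow>ps. f a b) * (\<Sum>(c, d)\<leftarrow>qs. g c d) =
    (\<Sum>(a, b)\<leftarrow>ps. \<Sum>(c, d)\<leftarrow>qs. f a b * (g c d :: 'r::semiring_0))"
  unfolding sum_list_pair_mult_const by (intro sum_list_pair_cong) (rule sum_list_pair_const_mult)

lemma (in module) subspace_sum_list_pair:
  assumes "subspace S" "\<And>a b. (a, b) \<in> set ps \<Longrightarrow> f a b \<in> S"
  shows "(\<Sum>(a, b)\<leftarrow>ps. f a b) \<in> S"
  using assms(2)
proof (induction ps)
  case Nil
  then show ?case using assms(1) by (simp add: subspace_0)
next
  case (Cons p ps)
  then show ?case using assms(1) by (cases p) (simp add: subspace_add)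
qed

text \<open>
  Evaluations are far from spanning the dual of a space of functions. Still they separate
  tensors: for fixed \<open>Y\<close> the contraction with evaluation at \<open>Y\<close> is itself a function,
  known pointwise, so any functional may be applied to it; then the same for the other factor.
\<close>

lemma tensor_eqI_eval:
  fixes ps qs :: "(('x \<Rightarrow> 'k::field) \<times> ('y \<Rightarrow> 'k)) list"
  assumes eq: "\<And>X Y. (\<Sum>(f, g)\<leftarrow>ps. f X * g Y) = (\<Sum>(f, g)\<leftarrow>qs. f X * g Y)"
  shows "tsum fun_scale fun_scale ps = tsum fun_scale fun_scale qs"
proof (rule tensor_eqI[OF fun_vs.vector_space_axioms fun_vs.vector_space_axioms])
  fix F :: "('x \<Rightarrow> 'k) \<Rightarrow> 'k" and G :: "('y \<Rightarrow> 'k) \<Rightarrow> 'k"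
  assume F: "Vector_Spaces.linear fun_scale (*) F" and G: "Vector_Spaces.linear fun_scale (*) G"
  have apply_sum: "(\<Sum>(f, g)\<leftarrow>rs. h f g) X = (\<Sum>(f, g)\<leftarrow>rs. h f g X)"
    for rs :: "(('x \<Rightarrow> 'k) \<times> ('y \<Rightarrow> 'k)) list" and h :: "_ \<Rightarrow> _ \<Rightarrow> 'z \<Rightarrow> 'k" and X
    by (induction rs) auto
  have "(\<Sum>(f, g)\<leftarrow>ps. F f * g Y) = (\<Sum>(f, g)\<leftarrow>qs. F f * g Y)" for Y
  proof -
    have "(\<Sum>(f, g)\<leftarrow>ps. fun_scale (g Y) f) = (\<Sum>(f, g)\<leftarrow>qs. fun_scale (g Y) f)"
      by (rule ext) (use eq[of _ Y] in \<open>simp add: apply_sum fun_scale_def mult.commute\<close>)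
    then have "F (\<Sum>(f, g)\<leftarrow>ps. fun_scale (g Y) f) = F (\<Sum>(f, g)\<leftarrow>qs. fun_scale (g Y) f)" by simp
    then show ?thesis by (simp add: linear_sum_list_pair[OF F] linearD(2)[OF F] mult.commute)
  qed
  then have "(\<Sum>(f, g)\<leftarrow>ps. fun_scale (F f) g) = (\<Sum>(f, g)\<leftarrow>qs. fun_scale (F f) g)"
    by (intro ext) (simp add: apply_sum fun_scale_def)
  then have "G (\<Sum>(f, g)\<leftarrow>ps. fun_scale (F f) g) = G (\<Sum>(f, g)\<leftarrow>qs. fun_scale (F f) g)" by simp
  then show "(\<Sum>(f, g)\<leftarrow>ps. F f * G g) = (\<Sum>(f, g)\<leftarrow>qs. F f * G g)"
    by (simp add: linear_sum_list_pair[OF G] linearD(2)[OF G])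
qed

context bialgebra
begin

abbreviation functional :: "('h \<Rightarrow> 'k) \<Rightarrow> bool"
  where "functional f \<equiv> Vector_Spaces.linear scale (*) f"

abbreviation endo :: "('h \<Rightarrow> 'h) \<Rightarrow> bool"
  where "endo f \<equiv> Vector_Spaces.linear scale scale f"

abbreviation tens :: "('h \<times> 'h) list \<Rightarrow> ('h, 'h, 'k) tensor"
  where "tens ps \<equiv> tsum scale scale ps"

lemma vs: "vector_space scale" by (rule vector_space_axioms)

lemma functionalI:
  assumes "\<And>x y. f (x + y) = f x + f y" "\<And>c x. f (c *s x) = c * f x"
  shows "functional f"
  using assms by (intro linearI vs vector_space_field)

lemma endoI:
  assumes "\<And>x y. f (x + y) = f x + f y" "\<And>c x. f (c *s x) = c *s f x"
  shows "endo f"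
  using assms by (intro linearI vs)

lemma bilin_scale_left: "functional f \<Longrightarrow> bilin scale scale scale (\<lambda>a b. f a *s b)"
  by (intro bilinI vs) (auto simp: linearD algebra_simps)

lemma bilin_scale_right: "functional f \<Longrightarrow> bilin scale scale scale (\<lambda>a b. f b *s a)"
  by (intro bilinI vs) (auto simp: linearD algebra_simps)

lemma bilin_mult: "bilin scale scale scale (*)"
  by (intro bilinI vs) (auto simp: algebra_simps scale_mult_left scale_mult_right)

lemma bilin_mult_map: "endo P \<Longrightarrow> endo Q \<Longrightarrow> bilin scale scale scale (\<lambda>a b. P a * Q b)"
  by (intro bilinI vs) (auto simp: linearD algebra_simps scale_mult_left scale_mult_right)

lemma bilin_functionals: "functional f \<Longrightarrow> functional g \<Longrightarrow> bilin scale scale (*) (\<lambda>a b. f a * g b)"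
  by (intro bilinI vs vector_space_field) (auto simp: linearD algebra_simps)

lemma sweedlerE:
  obtains ps where "\<Delta> x = tens ps"
  using tensor_spaceE[OF vs vs subspace_UNIV comult_in[of x]] by metis

lemma lift_tens:
  assumes "bilin scale scale sC \<phi>"
  shows "tensor_lift scale scale UNIV UNIV \<phi> (tens ps) = (\<Sum>(a, b)\<leftarrow>ps. \<phi> a b)"
  using assms by (rule tensor_lift_tsum) auto

lemma sweedler_add: "\<Delta> x = tens ps \<Longrightarrow> \<Delta> y = tens qs \<Longrightarrow> \<Delta> (x + y) = tens (ps @ qs)"
  using comult_linear by (simp add: linearD)

lemma sweedler_scale: "\<Delta> x = tens ps \<Longrightarrow> \<Delta> (c *s x) = tens (map (\<lambda>(a, b). (c *s a, b)) ps)"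
  using comult_linear by (simp add: linearD scale_tsum[OF vs vs])

lemma linear_lift_comult:
  assumes "bilin scale scale sC \<phi>"
  shows "Vector_Spaces.linear scale sC (\<lambda>x. tensor_lift scale scale UNIV UNIV \<phi> (\<Delta> x))"
proof -
  interpret C: vector_space sC using bilin_vector_space[OF assms] by auto
  have add: "tensor_lift scale scale UNIV UNIV \<phi> (\<Delta> (x + y)) =
      tensor_lift scale scale UNIV UNIV \<phi> (\<Delta> x) + tensor_lift scale scale UNIV UNIV \<phi> (\<Delta> y)" for x y
  proof -
    obtain ps qs where pq: "\<Delta> x = tens ps" "\<Delta> y = tens qs" by (meson sweedlerE)
    show ?thesis
      unfolding sweedler_add[OF pq] pq lift_tens[OF assms] by simp
  qed
  have scale: "tensor_lift scale scale UNIV UNIV \<phi> (\<Delta> (c *s x)) =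
      sC c (tensor_lift scale scale UNIV UNIV \<phi> (\<Delta> x))" for c x
  proof -
    obtain ps where p: "\<Delta> x = tens ps" by (meson sweedlerE)
    have "(\<Sum>(a, b)\<leftarrow>map (\<lambda>(a, b). (c *s a, b)) ps. \<phi> a b) = sC c (\<Sum>(a, b)\<leftarrow>ps. \<phi> a b)"
    proof (induction ps)
      case (Cons p ps)
      then show ?case by (cases p) (simp add: bilinD[OF assms] C.scale_right_distrib)
    qed simp
    then show ?thesis
      unfolding sweedler_scale[OF p] p lift_tens[OF assms] .
  qed
  show ?thesis
    by (rule linearI) (auto simp: vs C.vector_space_axioms add scale)
qed

section \<open>Functionals acting on the bialgebra\<close>

text \<open>
  The convolution algebra of functionals acts on \<open>H\<close> on both sides, by
  \<open>lact f = (f \<otimes> id) \<circ> \<Delta>\<close> and \<open>ract f = (id \<otimes> f) \<circ> \<Delta>\<close>. The two actions commute, and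
  both \<open>g (lact f x)\<close> and \<open>f (ract g x)\<close> are the convolution product of \<open>f\<close> and \<open>g\<close> at \<open>x\<close>. So statements
  about \<open>\<Delta>\<close> turn into statements about linear maps of \<open>H\<close>.
\<close>

definition lact :: "('h \<Rightarrow> 'k) \<Rightarrow> 'h \<Rightarrow> 'h"
  where "lact f x = tensor_lift scale scale UNIV UNIV (\<lambda>a b. f a *s b) (\<Delta> x)"

definition ract :: "('h \<Rightarrow> 'k) \<Rightarrow> 'h \<Rightarrow> 'h"
  where "ract f x = tensor_lift scale scale UNIV UNIV (\<lambda>a b. f b *s a) (\<Delta> x)"

lemma lact_sweedler: "functional f \<Longrightarrow> \<Delta> x = tens ps \<Longrightarrow> lact f x = (\<Sum>(a, b)\<leftarrow>ps. f a *s b)"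
  unfolding lact_def by (simp add: lift_tens[OF bilin_scale_left])

lemma ract_sweedler: "functional f \<Longrightarrow> \<Delta> x = tens ps \<Longrightarrow> ract f x = (\<Sum>(a, b)\<leftarrow>ps. f b *s a)"
  unfolding ract_def by (simp add: lift_tens[OF bilin_scale_right])

lemma endo_lact: "functional f \<Longrightarrow> endo (lact f)"
  unfolding lact_def by (rule linear_lift_comult) (rule bilin_scale_left)

lemma endo_ract: "functional f \<Longrightarrow> endo (ract f)"
  unfolding ract_def by (rule linear_lift_comult) (rule bilin_scale_right)

lemma functional_lact:
  assumes "functional f" "functional g" "\<Delta> x = tens ps"
  shows "g (lact f x) = (\<Sum>(a, b)\<leftarrow>ps. f a * g b)"
  using assms by (simp add: lact_sweedler linear_sum_list_pair[OF assms(2)] linearD)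

lemma functional_ract:
  assumes "functional f" "functional g" "\<Delta> x = tens ps"
  shows "f (ract g x) = (\<Sum>(a, b)\<leftarrow>ps. f a * g b)"
  using assms by (simp add: ract_sweedler linear_sum_list_pair[OF assms(1)] linearD mult.commute)

lemma lact_ract_adjoint:
  assumes "functional f" "functional g"
  shows "g (lact f x) = f (ract g x)"
  using sweedlerE[of x] functional_lact[OF assms] functional_ract[OF assms] by metis

lemma functional_comp_lact: "functional f \<Longrightarrow> functional g \<Longrightarrow> functional (\<lambda>x. g (lact f x))"
  using endo_lact[of f] by (intro functionalI) (auto simp: linearD)

lemma functional_counit: "functional \<epsilon>"
  using counit_linear .

lemma lact_counit: "lact \<epsilon> x = x"
  unfolding lact_def by (rule counit_left)

lemma ract_counit: "ract \<epsilon> x = x"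
  unfolding ract_def by (rule counit_right)

lemma counit_sweedler:
  assumes "\<Delta> x = tens ps"
  shows "(\<Sum>(a, b)\<leftarrow>ps. \<epsilon> a *s b) = x" "(\<Sum>(a, b)\<leftarrow>ps. \<epsilon> b *s a) = x"
  using lact_sweedler[OF functional_counit assms] ract_sweedler[OF functional_counit assms]
  by (simp_all add: lact_counit ract_counit)

lemma sweedler_one: "\<Delta> 1 = tens [(1, 1)]"
  by (simp add: comult_one)

lemma lact_one: "functional f \<Longrightarrow> lact f 1 = f 1 *s 1"
  by (simp add: lact_sweedler[OF _ sweedler_one])

lemma lact_scale: "functional f \<Longrightarrow> lact (\<lambda>x. c * f x) x = c *s lact f x"
proof -
  assume f: "functional f"
  obtain ps where ps: "\<Delta> x = tens ps" by (rule sweedlerE)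
  have h: "functional (\<lambda>x. c * f x)"
    using f by (intro functionalI) (auto simp: linearD algebra_simps)
  have e: "endo (\<lambda>x. c *s x)" by (intro endoI) (auto simp: algebra_simps)
  show ?thesis
    unfolding lact_sweedler[OF f ps] lact_sweedler[OF h ps] linear_sum_list_pair[OF e] by simp
qed

subsection \<open>Coassociativity\<close>

text \<open>
  Coassociativity, paired with \<open>f \<otimes> g \<otimes> h\<close>; such functionals separate triple tensors.
\<close>

lemma coassoc_functionals:
  assumes f: "functional f" and g: "functional g" and h: "functional h" and x: "\<Delta> x = tens ps"
  shows "(\<Sum>(a, b)\<leftarrow>ps. g (lact f a) * h b) = (\<Sum>(a, b)\<leftarrow>ps. f a * h (lact g b))"
proof -
  let ?gh = "\<lambda>b c. g b * h c"
  \<comment> \<open>a tensor is itself a function of bilinear forms, so evaluation at \<open>?gh\<close> is linear in \<open>t\<close>\<close>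
  define \<beta> where "\<beta> = (\<lambda>a (t :: ('h, 'h, 'k) tensor). f a * t ?gh)"
  have bgh: "bilinear_form scale scale ?gh"
    using bilin_functionals[OF g h] by (simp add: bilinear_form_bilin)
  have \<beta>: "bilinear_form scale fun_scale \<beta>"
    unfolding bilinear_form_bilin \<beta>_def
    by (intro bilinI vs vector_space_field fun_vs.vector_space_axioms)
      (auto simp: linearD[OF f] algebra_simps fun_scale_def)
  have \<Delta>_gh: "\<Delta> y ?gh = h (lact g y)" for y
  proof -
    obtain qs where "\<Delta> y = tens qs" by (rule sweedlerE)
    then show ?thesis using functional_lact[OF g h] bgh by (simp add: tsum_apply)
  qed
  have bR: "bilin scale scale fun_scale (\<lambda>a b. pure_tensor scale fun_scale a (\<Delta> b))"
    using bilinD[OF bilin_pure_tensor[OF vs fun_vs.vector_space_axioms]] comult_linear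
    by (intro bilinI vs fun_vs.vector_space_axioms) (auto simp: linearD)
  have "tensor_lift scale scale UNIV UNIV (\<lambda>a b. pure_tensor scale fun_scale a (\<Delta> b)) (\<Delta> x) =
      (\<Sum>(a, b)\<leftarrow>ps. pure_tensor scale fun_scale a (\<Delta> b))"
    unfolding x by (rule lift_tens[OF bR])
  also have "\<dots> = tsum scale fun_scale (map (\<lambda>(a, b). (a, \<Delta> b)) ps)"
    by (simp add: tsum_def o_def case_prod_unfold)
  finally have rhs: "tensor_lift scale scale UNIV UNIV (\<lambda>a b. pure_tensor scale fun_scale a (\<Delta> b)) (\<Delta> x) \<beta> =
      (\<Sum>(a, b)\<leftarrow>ps. f a * h (lact g b))"
    using \<beta> by (simp add: tsum_apply \<beta>_def o_def case_prod_unfold \<Delta>_gh)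
  let ?T = "tensor_space scale scale UNIV UNIV"
  have bL: "bilin scale scale fun_scale (\<lambda>a b. pure_tensor fun_scale scale (\<Delta> a) b)"
    using bilinD[OF bilin_pure_tensor[OF fun_vs.vector_space_axioms vs]] comult_linear
    by (intro bilinI vs fun_vs.vector_space_axioms) (auto simp: linearD)
  have "tensor_lift scale scale UNIV UNIV (\<lambda>a b. pure_tensor fun_scale scale (\<Delta> a) b) (\<Delta> x) =
      (\<Sum>(a, b)\<leftarrow>ps. pure_tensor fun_scale scale (\<Delta> a) b)"
    unfolding x by (rule lift_tens[OF bL])
  also have "\<dots> = tsum fun_scale scale (map (\<lambda>(a, b). (\<Delta> a, b)) ps)"
    by (simp add: tsum_def o_def case_prod_unfold)
  finally have l1: "tensor_lift scale scale UNIV UNIV (\<lambda>a b. pure_tensor fun_scale scale (\<Delta> a) b) (\<Delta> x) =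
      tsum fun_scale scale (map (\<lambda>(a, b). (\<Delta> a, b)) ps)" .
  \<comment> \<open>the lift that defines \<open>tensor_assoc\<close> is bilinear on tensors only; a projection onto them extends it\<close>
  have subT: "fun_vs.subspace ?T" unfolding tensor_space_def by simp
  obtain P where P: "Vector_Spaces.linear fun_scale fun_scale P" "\<And>t. P t \<in> ?T" "\<And>t. t \<in> ?T \<Longrightarrow> P t = t"
    using fun_vs.exists_projection[OF subT] by metis
  define \<phi> where "\<phi> = (\<lambda>t c. tensor_lift scale scale UNIV UNIV
      (\<lambda>a b. pure_tensor scale fun_scale a (pure_tensor scale scale b c)) t)"
  have bi: "bilin scale scale fun_scale (\<lambda>a b. pure_tensor scale fun_scale a (pure_tensor scale scale b c))" for c
    using bilinD[OF bilin_pure_tensor[OF vs fun_vs.vector_space_axioms]] bilinD[OF bilin_pure_tensor[OF vs vs]]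
    by (intro bilinI vs fun_vs.vector_space_axioms) auto
  have \<phi>_tens: "\<phi> (tens qs) c = (\<Sum>(a, b)\<leftarrow>qs. pure_tensor scale fun_scale a (pure_tensor scale scale b c))" for qs c
    unfolding \<phi>_def by (rule lift_tens[OF bi])
  have TE: "\<exists>qs. t = tens qs" if "t \<in> ?T" for t
    using tensor_spaceE[OF vs vs subspace_UNIV that] by metis
  have \<phi>_c: "\<phi> t (c + d) = \<phi> t c + \<phi> t d" "\<phi> t (r *s c) = fun_scale r (\<phi> t c)" if t: "t \<in> ?T" for t c d r
  proof -
    obtain qs where qs: "t = tens qs" using TE[OF t] by blast
    show "\<phi> t (c + d) = \<phi> t c + \<phi> t d"
      unfolding qs \<phi>_tens sum_list_pair_add[symmetric]
      by (intro sum_list_pair_cong) (simp only: bilinD(2,4)[OF bilin_pure_tensor[OF vs fun_vs.vector_space_axioms]]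
        bilinD(2,4)[OF bilin_pure_tensor[OF vs vs]])
    have ls: "Vector_Spaces.linear fun_scale fun_scale (fun_scale r)"
      by (intro linearI fun_vs.vector_space_axioms) (auto simp: fun_scale_def fun_eq_iff algebra_simps)
    show "\<phi> t (r *s c) = fun_scale r (\<phi> t c)"
      unfolding qs \<phi>_tens linear_sum_list_pair[OF ls]
      by (intro sum_list_pair_cong) (simp only: bilinD(2,4)[OF bilin_pure_tensor[OF vs fun_vs.vector_space_axioms]]
        bilinD(2,4)[OF bilin_pure_tensor[OF vs vs]])
  qed
  have \<phi>_t: "\<phi> (t + u) c = \<phi> t c + \<phi> u c" "\<phi> (fun_scale r t) c = fun_scale r (\<phi> t c)"
    if t: "t \<in> ?T" "u \<in> ?T" for t u c r
  proof -
    obtain qs rs where qs: "t = tens qs" "u = tens rs" using TE[OF t(1)] TE[OF t(2)] by blast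
    have "\<phi> (tens (qs @ rs)) c = \<phi> t c + \<phi> u c" unfolding qs \<phi>_tens by simp
    then show "\<phi> (t + u) c = \<phi> t c + \<phi> u c" using qs by simp
    have ls: "Vector_Spaces.linear fun_scale fun_scale (fun_scale r)"
      by (intro linearI fun_vs.vector_space_axioms) (auto simp: fun_scale_def fun_eq_iff algebra_simps)
    show "\<phi> (fun_scale r t) c = fun_scale r (\<phi> t c)"
      unfolding qs scale_tsum[OF vs vs] \<phi>_tens linear_sum_list_pair[OF ls]
      by (simp add: o_def case_prod_unfold bilinD(3)[OF bilin_pure_tensor[OF vs fun_vs.vector_space_axioms]])
  qed
  have b\<phi>: "bilin fun_scale scale fun_scale (\<lambda>t c. \<phi> (P t) c)"
    by (intro bilinI vs fun_vs.vector_space_axioms) (simp_all only: linearD[OF P(1)] \<phi>_t(1) \<phi>_t(2)[OF P(2) P(2)] \<phi>_c P(2))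
  have "tensor_assoc scale (tsum fun_scale scale (map (\<lambda>(a, b). (\<Delta> a, b)) ps)) =
      (\<Sum>(t, c)\<leftarrow>map (\<lambda>(a, b). (\<Delta> a, b)) ps. \<phi> (P t) c)"
    unfolding tensor_assoc_def
  proof (rule tensor_lift_tsum[OF b\<phi>])
    show "set (map (\<lambda>(a, b). (\<Delta> a, b)) ps) \<subseteq> ?T \<times> UNIV" using comult_in by auto
  qed (simp add: P(3) \<phi>_def)
  also have "\<dots> = (\<Sum>(a, b)\<leftarrow>ps. \<phi> (\<Delta> a) b)"
    using comult_in by (simp add: o_def case_prod_unfold P(3))
  finally have l2: "tensor_assoc scale (tsum fun_scale scale (map (\<lambda>(a, b). (\<Delta> a, b)) ps)) =
      (\<Sum>(a, b)\<leftarrow>ps. \<phi> (\<Delta> a) b)" .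
  have "(\<Sum>(a, b)\<leftarrow>ps. \<phi> (\<Delta> a) b) \<beta> = (\<Sum>(a, b)\<leftarrow>ps. \<phi> (\<Delta> a) b \<beta>)"
    by (induction ps) auto
  also have "\<dots> = (\<Sum>(a, b)\<leftarrow>ps. g (lact f a) * h b)"
  proof (rule sum_list_pair_cong)
    fix a b
    obtain qs where qs: "\<Delta> a = tens qs" by (rule sweedlerE)
    have "\<phi> (\<Delta> a) b \<beta> = tsum scale fun_scale (map (\<lambda>(a1, a2). (a1, pure_tensor scale scale a2 b)) qs) \<beta>"
      unfolding qs \<phi>_tens by (simp add: tsum_def o_def case_prod_unfold)
    also have "\<dots> = (\<Sum>(a1, a2)\<leftarrow>qs. f a1 * (g a2 * h b))"
      using \<beta> bgh by (simp add: tsum_apply \<beta>_def o_def case_prod_unfold pure_tensor_def)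
    also have "\<dots> = g (lact f a) * h b"
      unfolding functional_lact[OF f g qs]
      by (simp add: sum_list_pair_mult_const mult.assoc)
    finally show "\<phi> (\<Delta> a) b \<beta> = g (lact f a) * h b" .
  qed
  finally show ?thesis using rhs coassoc[of x] l1 l2 by simp
qed

lemma lact_lact:
  assumes f: "functional f" and g: "functional g"
  shows "lact g (lact f x) = lact (\<lambda>y. g (lact f y)) x"
proof (rule functionals_separate)
  fix h assume h: "functional h"
  obtain ps where ps: "\<Delta> x = tens ps" by (rule sweedlerE)
  have "functional (\<lambda>y. h (lact g y))" using g h by (rule functional_comp_lact)
  then show "h (lact g (lact f x)) = h (lact (\<lambda>y. g (lact f y)) x)"
    using functional_lact[OF f _ ps] functional_lact[OF functional_comp_lact[OF f g] h ps]
      coassoc_functionals[OF f g h ps] by simp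
qed

lemma ract_lact_commute:
  assumes f: "functional f" and h: "functional h"
  shows "ract h (lact f x) = lact f (ract h x)"
proof (rule functionals_separate)
  fix g assume g: "functional g"
  have "g (ract h (lact f x)) = h (lact g (lact f x))"
    using g h by (simp add: lact_ract_adjoint)
  also have "\<dots> = h (lact (\<lambda>y. g (lact f y)) x)" using f g by (simp add: lact_lact)
  also have "\<dots> = g (lact f (ract h x))"
    using h functional_comp_lact[OF f g] by (simp add: lact_ract_adjoint)
  finally show "g (ract h (lact f x)) = g (lact f (ract h x))" .
qed

subsection \<open>The coproduct of a product\<close>

definition sw_mult :: "('h \<times> 'h) list \<Rightarrow> ('h \<times> 'h) list \<Rightarrow> ('h \<times> 'h) list"
  where "sw_mult ps qs = concat (map (\<lambda>(a, b). map (\<lambda>(c, d). (a * c, b * d)) qs) ps)"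

lemma sum_sw_mult:
  "(\<Sum>(u, v)\<leftarrow>sw_mult ps qs. \<phi> u v) =
    (\<Sum>(a, b)\<leftarrow>ps. \<Sum>(c, d)\<leftarrow>qs. (\<phi> (a * c) (b * d) :: 'z::comm_monoid_add))"
  unfolding sw_mult_def sum_list_concat_map by (simp add: o_def case_prod_unfold)

lemma sweedler_mult:
  assumes x: "\<Delta> x = tens ps" and y: "\<Delta> y = tens qs"
  shows "\<Delta> (x * y) = tens (sw_mult ps qs)"
proof -
  note pt = bilinD[OF bilin_pure_tensor[OF vs vs]]
  have b1: "bilin scale scale fun_scale (\<lambda>c d. pure_tensor scale scale (a * c) (b * d))" for a b
    using pt by (intro bilinI vs fun_vs.vector_space_axioms) (auto simp: algebra_simps scale_mult_right)
  have inner: "tensor_lift scale scale UNIV UNIV (\<lambda>c d. pure_tensor scale scale (a * c) (b * d)) (\<Delta> y) =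
     (\<Sum>(c, d)\<leftarrow>qs. pure_tensor scale scale (a * c) (b * d))" for a b
    unfolding y by (rule lift_tens[OF b1])
  have ls: "Vector_Spaces.linear fun_scale fun_scale (fun_scale r)" for r :: 'k
    by (intro linearI fun_vs.vector_space_axioms) (auto simp: fun_scale_def fun_eq_iff algebra_simps)
  have b2: "bilin scale scale fun_scale (\<lambda>a b. \<Sum>(c, d)\<leftarrow>qs. pure_tensor scale scale (a * c) (b * d))"
    by (intro bilinI vs fun_vs.vector_space_axioms)
      (simp_all only: linear_sum_list_pair[OF ls] scale_mult_left distrib_right pt sum_list_pair_add)
  have "\<Delta> (x * y) = (\<Sum>(a, b)\<leftarrow>ps. \<Sum>(c, d)\<leftarrow>qs. pure_tensor scale scale (a * c) (b * d))"
    unfolding comult_mult tensor_mult_def inner unfolding x by (rule lift_tens[OF b2])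
  also have "\<dots> = tens (sw_mult ps qs)"
    unfolding tsum_def sum_sw_mult ..
  finally show ?thesis .
qed

section \<open>The convolution algebra of endomorphisms\<close>

lemma convolution_sweedler:
  assumes P: "endo P" and Q: "endo Q" and x: "\<Delta> x = tens ps"
  shows "convolution P Q x = (\<Sum>(a, b)\<leftarrow>ps. P a * Q b)"
proof -
  have b: "bilin scale scale fun_scale (\<lambda>a b. pure_tensor scale scale (P a) (Q b))"
    using bilinD[OF bilin_pure_tensor[OF vs vs]] P Q
    by (intro bilinI vs fun_vs.vector_space_axioms) (auto simp: linearD)
  have "tensor_map P Q (\<Delta> x) = (\<Sum>(a, b)\<leftarrow>ps. pure_tensor scale scale (P a) (Q b))"
    unfolding tensor_map_def x by (rule lift_tens[OF b])
  also have "\<dots> = tens (map (\<lambda>(a, b). (P a, Q b)) ps)"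
    by (simp add: tsum_def o_def case_prod_unfold)
  finally show ?thesis
    unfolding convolution_def mult_map_def by (simp add: lift_tens[OF bilin_mult] o_def case_prod_unfold)
qed

lemma convolution_eq_lift:
  assumes P: "endo P" and Q: "endo Q"
  shows "convolution P Q = (\<lambda>x. tensor_lift scale scale UNIV UNIV (\<lambda>a b. P a * Q b) (\<Delta> x))"
proof
  fix x
  obtain ps where "\<Delta> x = tens ps" by (rule sweedlerE)
  then show "convolution P Q x = tensor_lift scale scale UNIV UNIV (\<lambda>a b. P a * Q b) (\<Delta> x)"
    by (simp add: convolution_sweedler[OF P Q] lift_tens[OF bilin_mult_map[OF P Q]])
qed

lemma endo_convolution: "endo P \<Longrightarrow> endo Q \<Longrightarrow> endo (convolution P Q)"
  by (simp add: convolution_eq_lift linear_lift_comult bilin_mult_map)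

lemma endo_conv_unit: "endo conv_unit"
  unfolding conv_unit_def using counit_linear by (intro endoI) (auto simp: linearD algebra_simps)

lemma endo_id: "endo id" "endo (\<lambda>x. x)"
  by (intro endoI; simp)+

lemma convolution_unit_left:
  assumes P: "endo P" shows "convolution conv_unit P = P"
proof
  fix x
  obtain ps where x: "\<Delta> x = tens ps" by (rule sweedlerE)
  have "convolution conv_unit P x = (\<Sum>(a, b)\<leftarrow>ps. P (\<epsilon> a *s b))"
    using P by (simp add: convolution_sweedler[OF endo_conv_unit P x] conv_unit_def scale_mult_left linearD)
  also have "\<dots> = P x"
    unfolding linear_sum_list_pair[OF P, symmetric] by (simp add: counit_sweedler[OF x])
  finally show "convolution conv_unit P x = P x" .
qed

lemma convolution_unit_right:
  assumes P: "endo P" shows "convolution P conv_unit = P"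
proof
  fix x
  obtain ps where x: "\<Delta> x = tens ps" by (rule sweedlerE)
  have "convolution P conv_unit x = (\<Sum>(a, b)\<leftarrow>ps. P (\<epsilon> b *s a))"
    using P by (simp add: convolution_sweedler[OF P endo_conv_unit x] conv_unit_def scale_mult_right linearD)
  also have "\<dots> = P x"
    unfolding linear_sum_list_pair[OF P, symmetric] by (simp add: counit_sweedler[OF x])
  finally show "convolution P conv_unit x = P x" .
qed

text \<open>
  Coassociativity is known for product functionals, and \<open>tensor_eqI\<close> promotes it to multiplication
  of endomorphisms in two rounds: a functional is put on the third factor and the first two are
  treated as a tensor, to which \<open>P \<otimes> Q\<close> is applied; then the product of the first two factors and
  the third are treated as a tensor.
\<close>

lemma convolution_assoc:
  assumes P: "endo P" and Q: "endo Q" and R: "endo R"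
  shows "convolution (convolution P Q) R = convolution P (convolution Q R)"
proof
  fix x
  obtain ps where x: "\<Delta> x = tens ps" by (rule sweedlerE)
  define sw where "sw = (\<lambda>y. SOME qs. \<Delta> y = tens qs)"
  have sw: "\<Delta> y = tens (sw y)" for y
    unfolding sw_def by (rule someI_ex) (meson sweedlerE)
  define l1 where "l1 = concat (map (\<lambda>(a, b). map (\<lambda>(a1, a2). (P a1 * Q a2, b)) (sw a)) ps)"
  define l2 where "l2 = concat (map (\<lambda>(a, b). map (\<lambda>(b1, b2). (P a * Q b1, b2)) (sw b)) ps)"
  have "tens l1 = tens l2"
  proof (rule tensor_eqI[OF vs vs])
    fix g h assume g: "functional g" and h: "functional h"
    define m1 where "m1 = concat (map (\<lambda>(a, b). map (\<lambda>(a1, a2). (a1, h b *s a2)) (sw a)) ps)"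
    define m2 where "m2 = concat (map (\<lambda>(a, b). map (\<lambda>(b1, b2). (a, h b2 *s b1)) (sw b)) ps)"
    have m: "tens m1 = tens m2"
    proof (rule tensor_eqI[OF vs vs])
      fix f k assume f: "functional f" and k: "functional k"
      have "(\<Sum>(a, b)\<leftarrow>m1. f a * k b) = (\<Sum>(a, b)\<leftarrow>ps. \<Sum>(a1, a2)\<leftarrow>sw a. f a1 * k (h b *s a2))"
        unfolding m1_def sum_list_concat_map by (simp add: o_def case_prod_unfold)
      also have "\<dots> = (\<Sum>(a, b)\<leftarrow>ps. k (lact f a) * h b)"
        by (intro sum_list_pair_cong)
          (simp add: functional_lact[OF f k sw] linearD[OF k] sum_list_pair_mult_const sum_list_pair_const_mult mult_ac)
      also have "\<dots> = (\<Sum>(a, b)\<leftarrow>ps. f a * h (lact k b))"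
        by (rule coassoc_functionals[OF f k h x])
      also have "\<dots> = (\<Sum>(a, b)\<leftarrow>ps. \<Sum>(b1, b2)\<leftarrow>sw b. f a * k (h b2 *s b1))"
        by (intro sum_list_pair_cong)
          (simp add: functional_lact[OF k h sw] linearD[OF k] sum_list_pair_const_mult sum_list_pair_mult_const mult_ac)
      also have "\<dots> = (\<Sum>(a, b)\<leftarrow>m2. f a * k b)"
        unfolding m2_def sum_list_concat_map by (simp add: o_def case_prod_unfold)
      finally show "(\<Sum>(a, b)\<leftarrow>m1. f a * k b) = (\<Sum>(a, b)\<leftarrow>m2. f a * k b)" .
    qed
    have b: "bilin scale scale (*) (\<lambda>a b. g (P a * Q b))"
      using bilin_compose[OF bilin_mult_map[OF P Q] g] .
    have "(\<Sum>(a, b)\<leftarrow>m1. g (P a * Q b)) = (\<Sum>(a, b)\<leftarrow>m2. g (P a * Q b))"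
      by (rule tsum_eq_imp_sum_eq[OF b m])
    then show "(\<Sum>(a, b)\<leftarrow>l1. g a * h b) = (\<Sum>(a, b)\<leftarrow>l2. g a * h b)"
      unfolding m1_def m2_def l1_def l2_def sum_list_concat_map
      by (simp add: o_def case_prod_unfold linearD[OF Q] linearD[OF g] scale_mult_right mult.commute)
  qed
  then have "(\<Sum>(a, b)\<leftarrow>l1. a * R b) = (\<Sum>(a, b)\<leftarrow>l2. a * R b)"
    by (rule tsum_eq_imp_sum_eq[OF bilin_mult_map[OF endo_id(2) R]])
  then show "convolution (convolution P Q) R x = convolution P (convolution Q R) x"
    unfolding convolution_sweedler[OF endo_convolution[OF P Q] R x]
      convolution_sweedler[OF P endo_convolution[OF Q R] x]
      convolution_sweedler[OF P Q sw] convolution_sweedler[OF Q R sw]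
      l1_def l2_def sum_list_concat_map
    by (simp add: o_def split_def sum_list_const_mult[symmetric] sum_list_mult_const[symmetric] mult.assoc)
qed

lemma convolution_left_add:
  assumes P: "endo P" "endo P'" and Q: "endo Q"
  shows "convolution (\<lambda>x. P x + P' x) Q x = convolution P Q x + convolution P' Q x"
proof -
  obtain ps where x: "\<Delta> x = tens ps" by (rule sweedlerE)
  have "endo (\<lambda>x. P x + P' x)" using P by (intro endoI) (auto simp: linearD algebra_simps)
  then show ?thesis
    by (simp add: convolution_sweedler[OF _ _ x] P Q distrib_right sum_list_pair_add)
qed

lemma antipode_unique:
  assumes S: "is_antipode S" and T: "is_antipode T"
  shows "S = T"
proof -
  have "S = convolution S (convolution id T)"
    using S T by (simp add: is_antipode_def convolution_unit_right)
  also have "\<dots> = convolution (convolution S id) T"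
    using S T endo_id(1) convolution_assoc[of S id T] by (simp only: is_antipode_def)
  also have "convolution S id = conv_unit" using S by (simp add: is_antipode_def)
  also have "convolution conv_unit T = T" using T by (simp add: is_antipode_def convolution_unit_left)
  finally show ?thesis .
qed

lemma antipode_eqI: "is_antipode S \<Longrightarrow> antipode = S"
  unfolding antipode_def by (rule the_equality) (auto intro: antipode_unique)

lemma endo_conv_power: "endo P \<Longrightarrow> endo (conv_power P k)"
  unfolding conv_power_def by (induction k) (auto simp: endo_conv_unit endo_convolution)

lemma conv_power_simps [simp]:
  "conv_power P 0 = conv_unit" "conv_power P (Suc k) = convolution P (conv_power P k)"
  by (simp_all add: conv_power_def)

lemma conv_power_Suc_right:
  assumes "endo P" shows "conv_power P (Suc k) = convolution (conv_power P k) P"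
proof (induction k)
  case 0
  then show ?case using assms by (simp add: convolution_unit_left convolution_unit_right)
next
  case (Suc k)
  have "conv_power P (Suc (Suc k)) = convolution P (convolution (conv_power P k) P)"
    using Suc by simp
  also have "\<dots> = convolution (convolution P (conv_power P k)) P"
    using assms by (simp add: convolution_assoc endo_conv_power)
  finally show ?case by simp
qed

text \<open>
  The coproduct expanded in a basis in the first factor: \<open>\<Delta> x\<close> is the sum of the \<open>c \<otimes> lact c\<^sup>* x\<close>
  over basis elements \<open>c\<close>, with \<open>c\<^sup>*\<close> the coordinate functional. Zero terms are dropped, so that
  adapted bases give control of every pair in the list.
\<close>

lemma sweedler_basis:
  assumes C: "independent C" "span C = UNIV"
  obtains ps where "\<Delta> x = tens ps"
    "\<And>a b. (a, b) \<in> set ps \<Longrightarrow> a \<in> C \<and> b = lact (\<lambda>v. representation C v a) x \<and> b \<noteq> 0"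
proof -
  let ?r = "\<lambda>c v. representation C v c"
  obtain qs where qs: "\<Delta> x = tens qs" by (rule sweedlerE)
  define F where "F = (\<Union>(a, b)\<in>set qs. {c. ?r c a \<noteq> 0})"
  have F: "finite F" "F \<subseteq> C" unfolding F_def by (auto simp: finite_representation dest: representation_ne_zero)
  have lin: "functional (?r c)" for c
    using C by (intro linear_representation_UNIV) auto
  obtain cs where cs: "distinct cs" "set cs = {c \<in> F. lact (?r c) x \<noteq> 0}"
    using F finite_distinct_list[of "{c \<in> F. lact (?r c) x \<noteq> 0}"] by auto
  have "\<Delta> x = tens (map (\<lambda>c. (c, lact (?r c) x)) cs)"
    unfolding qs
  proof (rule tensor_eqI[OF vs vs])
    fix f g assume f: "functional f" and g: "functional g"
    have fa: "f a = (\<Sum>c\<in>F. ?r c a * f c)" if "(a, b) \<in> set qs" for a b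
    proof -
      have "a = (\<Sum>c\<in>{c. ?r c a \<noteq> 0}. ?r c a *s c)"
        using C by (subst sum_nonzero_representation_eq) auto
      also have "\<dots> = (\<Sum>c\<in>F. ?r c a *s c)"
        using F that by (intro sum.mono_neutral_left) (auto simp: F_def)
      finally have "f a = f (\<Sum>c\<in>F. ?r c a *s c)" by simp
      then show ?thesis using f by (simp add: linearD)
    qed
    have "(\<Sum>(a, b)\<leftarrow>qs. f a * g b) = (\<Sum>(a, b)\<leftarrow>qs. \<Sum>c\<in>F. f c * (?r c a * g b))"
      by (intro sum_list_pair_cong) (simp add: fa sum_distrib_right sum_distrib_left mult_ac)
    also have "\<dots> = (\<Sum>c\<in>F. \<Sum>(a, b)\<leftarrow>qs. f c * (?r c a * g b))"
      by (induction qs) (auto simp: sum.distrib)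
    also have "\<dots> = (\<Sum>c\<in>F. f c * g (lact (?r c) x))"
      unfolding functional_lact[OF lin g qs] by (simp add: sum_list_pair_const_mult)
    also have "\<dots> = (\<Sum>c\<in>set cs. f c * g (lact (?r c) x))"
      using F(1) cs(2) g by (intro sum.mono_neutral_right) (auto simp: linearD)
    also have "\<dots> = (\<Sum>(a, b)\<leftarrow>map (\<lambda>c. (c, lact (?r c) x)) cs. f a * g b)"
      using cs(1) by (simp add: sum_list_distinct_conv_sum_set o_def)
    finally show "(\<Sum>(a, b)\<leftarrow>qs. f a * g b) = (\<Sum>(a, b)\<leftarrow>map (\<lambda>c. (c, lact (?r c) x)) cs. f a * g b)" .
  qed
  then show ?thesis using that cs F by fastforce
qed

lemma one_neq_zero_h: "(1::'h) \<noteq> 0"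
  using counit_one functional_counit linearD(3) by fastforce

lemma subcoalgebra_lact:
  assumes "subcoalgebra C" "functional f" "x \<in> C"
  shows "lact f x \<in> C"
proof -
  have sC: "subspace C" and t: "\<Delta> x \<in> tensor_space scale scale C C"
    using assms by (auto simp: subcoalgebra_def)
  obtain ps where ps: "\<Delta> x = tens ps" "set ps \<subseteq> C \<times> C"
    using tensor_spaceE[OF vs vs sC t] by metis
  show ?thesis
    unfolding lact_sweedler[OF assms(2) ps(1)]
    using ps sC by (intro subspace_sum_list_pair) (auto simp: subspace_scale)
qed

end

context graded_connected_hopf_algebra
begin

section \<open>Homogeneous components\<close>

definition hcomp :: "nat \<Rightarrow> 'h \<Rightarrow> 'h"
  where "hcomp m x = (THE c. (\<forall>m. c m \<in> H m) \<and> finite {m. c m \<noteq> 0} \<and> x = Sum_any c) m"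

lemma hcomp_props:
  "hcomp m x \<in> H m" "finite {m. hcomp m x \<noteq> 0}" "x = Sum_any (\<lambda>m. hcomp m x)"
  using theI'[OF direct_sum_H[of x]] by (auto simp: hcomp_def)

lemma hcomp_unique:
  assumes "\<And>m. c m \<in> H m" "finite {m. c m \<noteq> 0}" "x = Sum_any c"
  shows "hcomp m x = c m"
  unfolding hcomp_def using the1_equality[OF direct_sum_H[of x], of c] assms by simp

lemma endo_hcomp: "endo (hcomp m)"
proof (rule endoI)
  fix x y
  have *: "{m. hcomp m x + hcomp m y \<noteq> 0} \<subseteq> {m. hcomp m x \<noteq> 0} \<union> {m. hcomp m y \<noteq> 0}" by auto
  show "hcomp m (x + y) = hcomp m x + hcomp m y"
  proof (rule hcomp_unique)
    show "finite {m. hcomp m x + hcomp m y \<noteq> 0}"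
      using finite_subset[OF *] by (simp add: hcomp_props)
    show "x + y = (\<Sum>m. hcomp m x + hcomp m y)"
      using hcomp_props(3)[of x] hcomp_props(3)[of y] by (simp add: Sum_any.distrib hcomp_props(2))
  qed (auto intro: subspace_add subspace_H hcomp_props)
next
  fix c x
  have *: "{m. c *s hcomp m x \<noteq> 0} \<subseteq> {m. hcomp m x \<noteq> 0}" by auto
  show "hcomp m (c *s x) = c *s hcomp m x"
  proof (rule hcomp_unique)
    show "finite {m. c *s hcomp m x \<noteq> 0}"
      using finite_subset[OF *] by (simp add: hcomp_props)
    have "c *s Sum_any (\<lambda>m. hcomp m x) = (\<Sum>m. c *s hcomp m x)"
      using hcomp_props(2)[of x] *
      by (simp add: Sum_any.expand_superset[of "{m. hcomp m x \<noteq> 0}"] scale_sum_right)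
    then show "c *s x = (\<Sum>m. c *s hcomp m x)"
      using hcomp_props(3)[of x] by simp
  qed (auto intro: subspace_scale subspace_H hcomp_props)
qed

lemma hcomp_H:
  assumes "x \<in> H p"
  shows "hcomp m x = (if m = p then x else 0)"
proof (rule hcomp_unique)
  show "x = (\<Sum>m. if m = p then x else 0)" by simp
  show "finite {m. (if m = p then x else 0) \<noteq> 0}" by (rule finite_subset[of _ "{p}"]) auto
qed (use assms subspace_H in \<open>auto intro: subspace_0\<close>)

lemma hcomp_bound: "\<exists>N. \<forall>m>N. hcomp m x = 0"
proof -
  obtain N where "\<forall>m\<in>{m. hcomp m x \<noteq> 0}. m \<le> N"
    using hcomp_props(2) finite_nat_set_iff_bounded_le by blast
  then show ?thesis by (intro exI[of _ N]) force
qed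

lemma hcomp_sum:
  assumes "\<And>m. m > N \<Longrightarrow> hcomp m x = 0"
  shows "x = (\<Sum>m\<le>N. hcomp m x)"
proof -
  have "{m. hcomp m x \<noteq> 0} \<subseteq> {..N}" using assms by (auto simp: not_less[symmetric])
  then show ?thesis
    using hcomp_props(3)[of x] by (simp add: Sum_any.expand_superset[of "{..N}"])
qed

lemma homogeneous_induct [case_names add H]:
  assumes "\<And>x y. P x \<Longrightarrow> P y \<Longrightarrow> P (x + y)" "\<And>m x. x \<in> H m \<Longrightarrow> P x"
  shows "P x"
proof -
  obtain N where N: "\<forall>m>N. hcomp m x = 0" using hcomp_bound by blast
  have "P (\<Sum>m\<le>n. hcomp m x)" for n
    by (induction n) (auto intro: assms hcomp_props)
  then show ?thesis using hcomp_sum[of N x] N by metis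
qed

lemma H_0: assumes "x \<in> H 0" shows "x = \<epsilon> x *s 1"
proof -
  obtain B where B: "B \<subseteq> H 0" "independent B" "H 0 \<subseteq> span B" "card B = 1"
    using basis_exists[of "H 0"] connected by metis
  then obtain b where b: "B = {b}" using card_1_singletonE by blast
  obtain c where c: "1 = c *s b" using one_H B b by (auto simp: span_singleton)
  obtain d where d: "x = d *s b" using assms B b by (auto simp: span_singleton)
  have "c \<noteq> 0" using c one_neq_zero_h by auto
  then have "b = (1 / c) *s 1" using c by (metis scale_scale nonzero_divide_eq_eq scale_one)
  then have x: "x = (d / c) *s 1" using d by simp
  then have "\<epsilon> x = d / c" by (subst x) (simp add: linearD[OF counit_linear] counit_one)
  then show ?thesis using x by simp
qed

lemma counit_eq_0: "x \<in> H m \<Longrightarrow> m \<noteq> 0 \<Longrightarrow> \<epsilon> x = 0"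
  using counit_H by auto

lemma homogeneous_sweedlerE:
  assumes "x \<in> H m"
  obtains ps where "\<Delta> x = tens ps" "\<And>a b. (a, b) \<in> set ps \<Longrightarrow> \<exists>p\<le>m. a \<in> H p \<and> b \<in> H (m - p)"
proof -
  let ?R = "\<lambda>a b. \<exists>p\<le>m. a \<in> H p \<and> b \<in> H (m - p)"
  let ?S = "{pure_tensor scale scale a b | a b. ?R a b}"
  have "fun_vs.span (\<Union>{tensor_space scale scale (H p) (H q) | p q. p + q = m}) \<subseteq> fun_vs.span ?S"
  proof (rule fun_vs.span_minimal)
    have "tensor_space scale scale (H p) (H q) \<subseteq> fun_vs.span ?S" if "p + q = m" for p q
    proof -
      have "?R a b" if "a \<in> H p" "b \<in> H q" for a b
        using that \<open>p + q = m\<close> by (intro exI[of _ p]) auto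
      then show ?thesis unfolding tensor_space_def by (intro fun_vs.span_mono) blast
    qed
    then show "\<Union>{tensor_space scale scale (H p) (H q) | p q. p + q = m} \<subseteq> fun_vs.span ?S" by auto
  qed simp
  then have "\<Delta> x \<in> fun_vs.span ?S" using comult_H[OF assms] by auto
  then show ?thesis
  proof (rule span_pure_tensors[OF vs vs])
    show "?R (c *s a) b" if "?R a b" for c a b
      using that subspace_H by (auto intro: subspace_scale)
  qed (use that in metis)
qed

lemma functional_hcomp: "functional f \<Longrightarrow> functional (\<lambda>x. f (hcomp p x))"
  by (intro functionalI) (simp_all add: linearD[OF endo_hcomp] linearD(1,2))

text \<open>
  A functional supported in degree \<open>p\<close> acts with degree \<open>-p\<close>, because \<open>\<Delta>\<close> is graded.
\<close>

lemma lact_hcomp_H: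
  assumes f: "functional f" and x: "x \<in> H m"
  shows "p \<le> m \<Longrightarrow> lact (\<lambda>x. f (hcomp p x)) x \<in> H (m - p)"
    and "m < p \<Longrightarrow> lact (\<lambda>x. f (hcomp p x)) x = 0"
    and "lact f x = (\<Sum>p\<le>m. lact (\<lambda>x. f (hcomp p x)) x)"
proof -
  obtain ps where ps: "\<Delta> x = tens ps" "\<And>a b. (a, b) \<in> set ps \<Longrightarrow> \<exists>p\<le>m. a \<in> H p \<and> b \<in> H (m - p)"
    using homogeneous_sweedlerE[OF x] by metis
  note l = lact_sweedler[OF functional_hcomp[OF f] ps(1)]
  have f0: "f 0 = 0" using f by (simp add: linearD)
  show "lact (\<lambda>x. f (hcomp p x)) x \<in> H (m - p)" if "p \<le> m"
    unfolding l
  proof (rule subspace_sum_list_pair[OF subspace_H])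
    fix a b assume "(a, b) \<in> set ps"
    then obtain q where "q \<le> m" "a \<in> H q" "b \<in> H (m - q)" using ps by blast
    then show "f (hcomp p a) *s b \<in> H (m - p)"
      using subspace_H f0 by (auto simp: hcomp_H intro: subspace_scale subspace_0)
  qed
  show "lact (\<lambda>x. f (hcomp p x)) x = 0" if "m < p"
  proof -
    have "(\<Sum>(a, b)\<leftarrow>ps. f (hcomp p a) *s b) = (\<Sum>(a, b)\<leftarrow>ps. 0)"
    proof (rule sum_list_pair_cong)
      fix a b assume "(a, b) \<in> set ps"
      then obtain q where "q \<le> m" "a \<in> H q" "b \<in> H (m - q)" using ps by blast
      then show "f (hcomp p a) *s b = 0" using that f0 by (simp add: hcomp_H)
    qed
    then show ?thesis unfolding l by (simp add: split_def)
  qed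
  have "(\<Sum>p\<le>m. lact (\<lambda>x. f (hcomp p x)) x) = (\<Sum>(a, b)\<leftarrow>ps. \<Sum>p\<le>m. f (hcomp p a) *s b)"
    unfolding l by (induction ps) (auto simp: sum.distrib)
  also have "\<dots> = (\<Sum>(a, b)\<leftarrow>ps. f a *s b)"
  proof (rule sum_list_pair_cong)
    fix a b assume "(a, b) \<in> set ps"
    then obtain q where q: "q \<le> m" "a \<in> H q" using ps by blast
    then have "(\<Sum>p\<le>m. f (hcomp p a) *s b) = (\<Sum>p\<le>m. if p = q then f a *s b else 0)"
      using f0 by (intro sum.cong) (auto simp: hcomp_H)
    then show "(\<Sum>p\<le>m. f (hcomp p a) *s b) = f a *s b" using q by simp
  qed
  finally show "lact f x = (\<Sum>p\<le>m. lact (\<lambda>x. f (hcomp p x)) x)"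
    using lact_sweedler[OF f ps(1)] by simp
qed

lemma lact_hcomp_commute:
  assumes f: "functional f" and pm: "p \<le> m"
  shows "lact (\<lambda>x. f (hcomp p x)) (hcomp m x) = hcomp (m - p) (lact (\<lambda>x. f (hcomp p x)) x)"
proof (induction x rule: homogeneous_induct)
  case (add x y)
  then show ?case by (simp add: linearD[OF endo_hcomp] linearD[OF endo_lact[OF functional_hcomp[OF f]]])
next
  case (H q x)
  note l = lact_hcomp_H[OF f H]
  show ?case
  proof (cases "q < p")
    case True
    then show ?thesis using pm l(2) H
      by (simp add: hcomp_H linearD[OF endo_hcomp] linearD[OF endo_lact[OF functional_hcomp[OF f]]])
  next
    case False
    then have "hcomp i (lact (\<lambda>x. f (hcomp p x)) x) = (if i = q - p then lact (\<lambda>x. f (hcomp p x)) x else 0)" for i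
      using l(1)[of p] by (intro hcomp_H) simp
    moreover have "m - p = q - p \<longleftrightarrow> m = q" using False pm by auto
    ultimately show ?thesis
      using H by (auto simp: hcomp_H linearD[OF endo_lact[OF functional_hcomp[OF f]]])
  qed
qed

section \<open>The coradical filtration\<close>

text \<open>
  Let \<open>x\<close> lie in the subcoalgebra with component of highest degree \<open>m\<close>. A functional \<open>f\<close> of degree
  \<open>m\<close> acts by zero on the lower components, and maps the highest one to a multiple of \<open>1\<close>, namely
  \<open>f x\<close>. Hence a suitable \<open>f\<close> maps \<open>x\<close> to \<open>1\<close>.
\<close>

lemma one_in_subcoalgebra:
  assumes C: "subcoalgebra C" and "C \<noteq> {0}"
  shows "1 \<in> C"
proof -
  have "0 \<in> C" using C by (simp add: subcoalgebra_def subspace_0)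
  then obtain x where x: "x \<in> C" "x \<noteq> 0" using assms(2) by blast
  define m where "m = Max {m. hcomp m x \<noteq> 0}"
  have ne: "{m. hcomp m x \<noteq> 0} \<noteq> {}"
  proof
    assume "{m. hcomp m x \<noteq> 0} = {}"
    then have "x = 0" using hcomp_sum[of 0 x] by auto
    then show False using x by simp
  qed
  have m: "hcomp m x \<noteq> 0" using Max_in[OF hcomp_props(2) ne] unfolding m_def by simp
  have m': "hcomp i x = 0" if "i > m" for i
    using Max_ge[OF hcomp_props(2)[of x], of i] that unfolding m_def by fastforce
  obtain f where f: "functional f" "f (hcomp m x) = 1"
    using exists_functional[OF subspace_single_0, of "hcomp m x"] m by auto
  let ?f = "\<lambda>x. f (hcomp m x)"
  have f': "functional ?f" by (rule functional_hcomp[OF f(1)])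
  have "lact ?f x = lact ?f (\<Sum>i\<le>m. hcomp i x)" using hcomp_sum[of m x] m' by simp
  also have "\<dots> = (\<Sum>i\<le>m. lact ?f (hcomp i x))" by (rule linearD(6)[OF endo_lact[OF f']])
  also have "\<dots> = (\<Sum>i\<le>m. if i = m then lact ?f (hcomp m x) else 0)"
    using lact_hcomp_H(2)[OF f(1) hcomp_props(1)] by (intro sum.cong) auto
  also have "\<dots> = lact ?f (hcomp m x)" by simp
  also have "\<dots> = \<epsilon> (lact ?f (hcomp m x)) *s 1"
    using lact_hcomp_H(1)[OF f(1) hcomp_props(1), of m m x] by (intro H_0) simp
  also have "\<epsilon> (lact ?f (hcomp m x)) = 1"
    using lact_ract_adjoint[OF f' functional_counit] hcomp_H[OF hcomp_props(1)]
    by (simp add: ract_counit f)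
  finally have "lact ?f x = 1" by simp
  then show ?thesis using subcoalgebra_lact[OF C f' x(1)] by simp
qed

lemma coradical_eq: "coradical = span {1}"
proof -
  have s1: "subcoalgebra (span {1})"
    unfolding subcoalgebra_def
  proof safe
    fix x assume "x \<in> span {1::'h}"
    then obtain c where "x = c *s 1" by (auto simp: span_singleton)
    then have "\<Delta> x = tens [(c *s 1, 1)]"
      using sweedler_scale[OF sweedler_one, of c] by simp
    moreover have "tens [(c *s 1, 1)] \<in> tensor_space scale scale (span {1}) (span {1})"
      by (rule tsum_in_tensor_space) (auto intro: span_base span_scale)
    ultimately show "\<Delta> x \<in> tensor_space scale scale (span {1}) (span {1})" by simp
  qed
  have min: "span {1} \<subseteq> C" if "subcoalgebra C" "C \<noteq> {0}" for C
    using one_in_subcoalgebra[OF that] that by (intro span_minimal) (auto simp: subcoalgebra_def)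
  have ne: "span {1::'h} \<noteq> {0}" using one_neq_zero_h span_base[of 1 "{1::'h}"] by auto
  have "simple_subcoalgebra C \<longleftrightarrow> C = span {1}" for C
    unfolding simple_subcoalgebra_def using s1 min ne by (metis order_refl subset_antisym)
  then have "{C. simple_subcoalgebra C} = {span {1}}" by auto
  then show ?thesis unfolding coradical_def by (simp add: span_span)
qed

lemma corad_below_simps [simp]:
  "corad_below 0 = {0}" "corad_below (Suc j) = corad_filt j"
  by (simp_all add: corad_below_def)

lemma corad_filt_0_iff: "x \<in> corad_filt 0 \<longleftrightarrow> (\<forall>f. functional f \<and> f 1 = 0 \<longrightarrow> lact f x = 0)"
proof
  assume "x \<in> corad_filt 0"
  then obtain c where "x = c *s 1" by (auto simp: coradical_eq span_singleton)
  then show "\<forall>f. functional f \<and> f 1 = 0 \<longrightarrow> lact f x = 0"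
    by (auto simp: linearD[OF endo_lact] lact_one)
next
  assume r: "\<forall>f. functional f \<and> f 1 = 0 \<longrightarrow> lact f x = 0"
  show "x \<in> corad_filt 0"
  proof (rule ccontr)
    assume "x \<notin> corad_filt 0"
    then obtain h where h: "functional h" "h x = 1" "\<And>x. x \<in> span {1} \<Longrightarrow> h x = 0"
      using exists_functional[of "span {1}" x] by (auto simp: coradical_eq)
    then have "h 1 = 0" by (simp add: span_base)
    then have "lact h x = 0" using r h by auto
    then have "h x = 0"
      using lact_ract_adjoint[OF h(1) functional_counit, of x]
      by (simp add: ract_counit linearD[OF functional_counit])
    then show False using h by simp
  qed
qed

text \<open>
  Extend \<open>1\<close> to a basis and expand \<open>\<Delta> x\<close> in it: the basis elements other than \<open>1\<close> have coordinate
  functionals killing \<open>1\<close>, and the term of \<open>1\<close> lies in \<open>coradical \<otimes> H\<close>.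
\<close>

lemma corad_filt_Suc_iff_aux:
  assumes "subspace (corad_filt j)"
  shows "x \<in> corad_filt (Suc j) \<longleftrightarrow> (\<forall>f. functional f \<and> f 1 = 0 \<longrightarrow> lact f x \<in> corad_filt j)"
proof
  assume "x \<in> corad_filt (Suc j)"
  then obtain t u where tu: "t \<in> tensor_space scale scale UNIV (corad_filt j)"
      "u \<in> tensor_space scale scale coradical UNIV" "\<Delta> x = t + u" by auto
  obtain ps where ps: "t = tens ps" "set ps \<subseteq> UNIV \<times> corad_filt j"
    using tensor_spaceE[OF vs vs subspace_UNIV tu(1)] by metis
  have "subspace coradical" by (simp add: coradical_def)
  then obtain qs where qs: "u = tens qs" "set qs \<subseteq> coradical \<times> UNIV"
    using tensor_spaceE[OF vs vs _ tu(2)] by metis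
  have x: "\<Delta> x = tens (ps @ qs)" using tu ps qs by simp
  show "\<forall>f. functional f \<and> f 1 = 0 \<longrightarrow> lact f x \<in> corad_filt j"
  proof safe
    fix f assume f: "functional f" "f 1 = 0"
    show "lact f x \<in> corad_filt j"
      unfolding lact_sweedler[OF f(1) x]
    proof (rule subspace_sum_list_pair[OF assms])
      fix a b assume "(a, b) \<in> set (ps @ qs)"
      then consider "b \<in> corad_filt j" | "a \<in> coradical" using ps qs by auto
      then show "f a *s b \<in> corad_filt j"
      proof cases
        case 2
        then obtain c where "a = c *s 1" by (auto simp: coradical_eq span_singleton)
        then have "f a = 0" using f by (simp add: linearD)
        then show ?thesis using assms by (simp add: subspace_0)
      qed (simp add: assms subspace_scale)
    qed
  qed
next
  assume r: "\<forall>f. functional f \<and> f 1 = 0 \<longrightarrow> lact f x \<in> corad_filt j"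
  have i1: "independent {1::'h}" using one_neq_zero_h by simp
  obtain C where C: "{1} \<subseteq> C" "independent C" "UNIV \<subseteq> span C"
    using maximal_independent_subset_extend[OF _ i1, of UNIV] by auto
  have sC: "span C = UNIV" using C by auto
  obtain ps where ps: "\<Delta> x = tens ps"
      "\<And>a b. (a, b) \<in> set ps \<Longrightarrow> a \<in> C \<and> b = lact (\<lambda>v. representation C v a) x \<and> b \<noteq> 0"
    using sweedler_basis[OF C(2) sC, of x] by metis
  define ps1 where "ps1 = filter (\<lambda>(a, b). a \<noteq> 1) ps"
  define ps2 where "ps2 = filter (\<lambda>(a, b). a = 1) ps"
  have "tens ps = tens ps1 + tens ps2"
    unfolding ps1_def ps2_def by (induction ps) (auto simp: add_ac)
  moreover have "tens ps1 \<in> tensor_space scale scale UNIV (corad_filt j)"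
  proof (rule tsum_in_tensor_space, safe)
    fix a b assume ab: "(a, b) \<in> set ps1"
    then have *: "a \<noteq> 1" "a \<in> C" "b = lact (\<lambda>v. representation C v a) x"
      using ps(2)[of a b] unfolding ps1_def by auto
    moreover have "representation C 1 a = 0" using C * by (simp add: representation_basis)
    ultimately show "b \<in> corad_filt j" using r linear_representation_UNIV[OF C(2) sC] by auto
  qed simp
  moreover have "tens ps2 \<in> tensor_space scale scale coradical UNIV"
    by (rule tsum_in_tensor_space) (auto simp: ps2_def coradical_eq span_base)
  ultimately show "x \<in> corad_filt (Suc j)" using ps(1) by auto
qed

lemma subspace_corad_filt: "subspace (corad_filt j)"
proof (induction j)
  case 0
  show ?case by (simp add: coradical_def)
next
  case (Suc j)
  show ?case
    using Suc
    by (intro subspaceI; simp only: corad_filt_Suc_iff_aux[OF Suc])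
      (auto simp: linearD[OF endo_lact] intro: subspace_0 subspace_add subspace_scale)
qed

lemma subspace_corad_below: "subspace (corad_below k)"
  by (cases k) (auto simp: subspace_corad_filt)

text \<open>
  The description of the filtration used from here on, in place of its definition by tensors.
\<close>

lemma corad_below_Suc_iff:
  "x \<in> corad_below (Suc k) \<longleftrightarrow> (\<forall>f. functional f \<and> f 1 = 0 \<longrightarrow> lact f x \<in> corad_below k)"
proof (cases k)
  case 0
  then show ?thesis using corad_filt_0_iff[of x] by simp
next
  case (Suc j)
  show ?thesis
    unfolding Suc corad_below_simps(2) using subspace_corad_filt by (rule corad_filt_Suc_iff_aux)
qed

declare corad_filt.simps [simp del]

lemma corad_below_mono_Suc: "x \<in> corad_below k \<Longrightarrow> x \<in> corad_below (Suc k)"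
proof (induction k arbitrary: x)
  case 0
  then show ?case using subspace_0[OF subspace_corad_below[of "Suc 0"]] by simp
next
  case (Suc k)
  show ?case
    unfolding corad_below_Suc_iff[of x "Suc k"]
    using Suc.IH Suc.prems[unfolded corad_below_Suc_iff[of x k]] by blast
qed

lemma corad_below_mono: "x \<in> corad_below k \<Longrightarrow> k \<le> l \<Longrightarrow> x \<in> corad_below l"
  using lift_Suc_mono_le[of corad_below k l] corad_below_mono_Suc by blast

lemma corad_filt_mono: "x \<in> corad_filt k \<Longrightarrow> k \<le> l \<Longrightarrow> x \<in> corad_filt l"
  using corad_below_mono[of x "Suc k" "Suc l"] by simp

lemma corad_filt_0_eq: "corad_filt 0 = span {1}"
  by (simp add: corad_filt.simps coradical_eq)

lemma corad_filt_0D: assumes "x \<in> corad_filt 0" shows "x = \<epsilon> x *s 1"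
proof -
  obtain c where x: "x = c *s 1" using assms by (auto simp: corad_filt_0_eq span_singleton)
  show ?thesis unfolding x by (simp add: linearD[OF counit_linear] counit_one)
qed

lemma one_corad_filt: "1 \<in> corad_filt j"
  by (rule corad_filt_mono[of _ 0]) (auto simp: corad_filt_0_eq span_base)

text \<open>
  The filtration is defined by the left action, but it is stable under the right action too,
  since the two commute.
\<close>

lemma ract_corad_below: "functional g \<Longrightarrow> x \<in> corad_below k \<Longrightarrow> ract g x \<in> corad_below k"
proof (induction k arbitrary: x)
  case 0
  then show ?case by (simp add: linearD[OF endo_ract])
next
  case (Suc k)
  show ?case
    unfolding corad_below_Suc_iff
  proof safe
    fix f assume f: "functional f" "f 1 = 0"
    then have "lact f x \<in> corad_below k" using Suc.prems corad_below_Suc_iff by blast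
    then show "lact f (ract g x) \<in> corad_below k"
      using Suc.IH Suc.prems f by (simp add: ract_lact_commute[symmetric])
  qed
qed

lemma ract_corad_below_Suc:
  "functional g \<Longrightarrow> g 1 = 0 \<Longrightarrow> x \<in> corad_below (Suc k) \<Longrightarrow> ract g x \<in> corad_below k"
proof (induction k arbitrary: x)
  case 0
  then have "x = \<epsilon> x *s 1" using corad_filt_0D by simp
  moreover have "ract g 1 = 0" using 0 by (simp add: ract_sweedler[OF _ sweedler_one])
  ultimately have "ract g x = 0" using linearD(2)[OF endo_ract[OF 0(1)], of "\<epsilon> x" 1] by simp
  then show ?case by simp
next
  case (Suc k)
  show ?case
    unfolding corad_below_Suc_iff
  proof safe
    fix f assume f: "functional f" "f 1 = 0"
    then have "lact f x \<in> corad_below (Suc k)" using Suc.prems corad_below_Suc_iff by blast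
    then show "lact f (ract g x) \<in> corad_below k"
      using Suc.IH Suc.prems f by (simp add: ract_lact_commute[symmetric])
  qed
qed

text \<open>
  The dual form of \<open>\<Delta> (F a) \<subseteq> (\<Sum>i\<le>a. F i \<otimes> F (a - i))\<close>. In the induction on \<open>l\<close>, if \<open>f\<close> kills
  \<open>F (b - 1)\<close> and \<open>g 1 = 0\<close>, then the convolution of \<open>f\<close> and \<open>g\<close> kills \<open>F b\<close>, because the right
  action of \<open>g\<close> maps \<open>F b\<close> into \<open>F (b - 1)\<close>.
\<close>

lemma lact_annihilator:
  assumes "functional f" "\<And>y. y \<in> corad_below b \<Longrightarrow> f y = 0" "x \<in> corad_below (b + l)"
  shows "lact f x \<in> corad_below l"
  using assms
proof (induction l arbitrary: f b)
  case 0
  have "h (lact f x) = h 0" if h: "functional h" for h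
    using 0 ract_corad_below[OF h, of x b] by (simp add: lact_ract_adjoint[OF 0(1) h] linearD[OF h])
  then have "lact f x = 0" by (rule functionals_separate)
  then show ?case by simp
next
  case (Suc l)
  show ?case
    unfolding corad_below_Suc_iff
  proof safe
    fix g assume g: "functional g" "g 1 = 0"
    have "lact (\<lambda>y. g (lact f y)) x \<in> corad_below l"
    proof (rule Suc.IH[of _ "Suc b"])
      show "functional (\<lambda>y. g (lact f y))" using Suc.prems(1) g(1) by (rule functional_comp_lact)
      show "g (lact f y) = 0" if "y \<in> corad_below (Suc b)" for y
        using ract_corad_below_Suc[OF g that] Suc.prems(2) by (simp add: lact_ract_adjoint[OF Suc.prems(1) g(1)])
    qed (use Suc.prems(3) in simp)
    then show "lact g (lact f x) \<in> corad_below l" by (simp add: lact_lact[OF Suc.prems(1) g(1)])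
  qed
qed

text \<open>
  A functional with \<open>f 1 = 0\<close> has no part of degree zero, so it lowers the grading.
\<close>

lemma H_corad_filt: "x \<in> H m \<Longrightarrow> x \<in> corad_filt m"
proof -
  have "x \<in> corad_below (Suc m)" if "x \<in> H m" for x
    using that
  proof (induction m arbitrary: x rule: less_induct)
    case (less m)
    show ?case
      unfolding corad_below_Suc_iff
    proof safe
      fix f assume f: "functional f" "f 1 = 0"
      show "lact f x \<in> corad_below m"
        unfolding lact_hcomp_H(3)[OF f(1) less.prems]
      proof (rule subspace_sum[OF subspace_corad_below])
        fix p assume p: "p \<in> {..m}"
        show "lact (\<lambda>x. f (hcomp p x)) x \<in> corad_below m"
        proof (cases "p = 0")
          case True
          have *: "f (hcomp 0 a) = 0" for a
          proof -
            have "hcomp 0 a = \<epsilon> (hcomp 0 a) *s 1" using H_0 hcomp_props by blast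
            then have "f (hcomp 0 a) = \<epsilon> (hcomp 0 a) * f 1" using linearD(2)[OF f(1)] by metis
            then show ?thesis using f by simp
          qed
          have "lact (\<lambda>x. f (hcomp 0 x)) x = lact (\<lambda>v. 0 * \<epsilon> v) x" unfolding * by simp
          also have "\<dots> = 0" by (simp add: lact_scale[OF functional_counit, of 0, simplified])
          finally show ?thesis
            unfolding True using subspace_corad_below by (simp add: subspace_0)
        next
          case False
          then have "lact (\<lambda>x. f (hcomp p x)) x \<in> corad_below (Suc (m - p))"
            using p less.IH[of "m - p"] lact_hcomp_H(1)[OF f(1) less.prems, of p] by auto
          then show ?thesis by (rule corad_below_mono) (use False p in auto)
        qed
      qed
    qed
  qed
  then show "x \<in> H m \<Longrightarrow> x \<in> corad_filt m" by simp
qed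

lemma corad_filt_exhaust: "\<exists>j. x \<in> corad_filt j"
proof (induction x rule: homogeneous_induct)
  case (add x y)
  then obtain i j where "x \<in> corad_filt i" "y \<in> corad_filt j" by blast
  then have "x \<in> corad_filt (max i j)" "y \<in> corad_filt (max i j)" using corad_filt_mono by auto
  then show ?case using subspace_corad_filt subspace_add by blast
qed (use H_corad_filt in blast)

text \<open>
  The filtration is by graded subspaces: the homogeneous parts of a functional killing \<open>1\<close> kill
  \<open>1\<close> as well.
\<close>

lemma hcomp_corad_below: "x \<in> corad_below k \<Longrightarrow> hcomp m x \<in> corad_below k"
proof (induction k arbitrary: x m)
  case 0
  then show ?case by (auto simp: linearD[OF endo_hcomp])
next
  case (Suc k)
  show ?case
    unfolding corad_below_Suc_iff
  proof safe
    fix f assume f: "functional f" "f 1 = 0"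
    show "lact f (hcomp m x) \<in> corad_below k"
      unfolding lact_hcomp_H(3)[OF f(1) hcomp_props(1)]
    proof (rule subspace_sum[OF subspace_corad_below])
      fix p assume p: "p \<in> {..m}"
      have "f (hcomp p 1) = 0" using f hcomp_H[OF one_H] by (simp add: linearD)
      then have "lact (\<lambda>x. f (hcomp p x)) x \<in> corad_below k"
        using Suc.prems functional_hcomp[OF f(1)] corad_below_Suc_iff by blast
      then show "lact (\<lambda>x. f (hcomp p x)) (hcomp m x) \<in> corad_below k"
        using p Suc.IH by (simp add: lact_hcomp_commute[OF f(1)])
    qed
  qed
qed

lemma hcomp_corad_filt: "x \<in> corad_filt k \<Longrightarrow> hcomp m x \<in> corad_filt k"
  using hcomp_corad_below[of x "Suc k"] by simp

subsection \<open>A homogeneous basis adapted to the filtration\<close>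

definition homogeneous :: "'h set"
  where "homogeneous = (\<Union>m. H m)"

lemma graded_subspace_span:
  assumes S: "subspace S" and gr: "\<And>x m. x \<in> S \<Longrightarrow> hcomp m x \<in> S"
    and B: "S \<inter> homogeneous \<subseteq> span B"
  shows "S \<subseteq> span B"
proof
  fix x assume x: "x \<in> S"
  obtain N where N: "\<forall>m>N. hcomp m x = 0" using hcomp_bound by blast
  have "x = (\<Sum>m\<le>N. hcomp m x)" using N by (intro hcomp_sum) auto
  also have "\<dots> \<in> span B"
  proof (rule span_sum)
    fix m
    have "hcomp m x \<in> S \<inter> homogeneous" using gr[OF x] hcomp_props(1) by (auto simp: homogeneous_def)
    then show "hcomp m x \<in> span B" using B by blast
  qed
  finally show "x \<in> span B" .
qed

text \<open>
  Extend bases along the filtration, always by homogeneous elements; this is possible because the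
  terms of the filtration are graded.
\<close>

lemma adapted_basisE:
  obtains C where "independent C" "span C = UNIV" "C \<subseteq> homogeneous"
    "\<And>k. corad_below k \<subseteq> span (C \<inter> corad_below k)"
proof -
  let ?P = "\<lambda>k B. B \<subseteq> corad_below k \<inter> homogeneous \<and> independent B \<and> corad_below k \<subseteq> span B"
  have "\<exists>B. ?P 0 B" by (intro exI[of _ "{}"]) (auto simp: independent_empty)
  moreover have "\<exists>B'. ?P (Suc k) B' \<and> B \<subseteq> B'" if B: "?P k B" for k B
  proof -
    have "B \<subseteq> corad_below (Suc k) \<inter> homogeneous" using B corad_below_mono_Suc by auto
    then obtain B' where B': "B \<subseteq> B'" "B' \<subseteq> corad_below (Suc k) \<inter> homogeneous" "independent B'"
        "corad_below (Suc k) \<inter> homogeneous \<subseteq> span B'"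
      using maximal_independent_subset_extend[of B "corad_below (Suc k) \<inter> homogeneous"] B by metis
    have "corad_below (Suc k) \<subseteq> span B'"
      using subspace_corad_below hcomp_corad_below B'(4) by (rule graded_subspace_span)
    then show ?thesis using B' by blast
  qed
  ultimately obtain B where B: "\<And>k. ?P k (B k)" "\<And>k. B k \<subseteq> B (Suc k)"
    using dependent_nat_choice[of ?P "\<lambda>k B B'. B \<subseteq> B'"] by metis
  have mono: "B k \<subseteq> B l" if "k \<le> l" for k l
    using lift_Suc_mono_le[of B] B(2) that by blast
  let ?C = "\<Union>k. B k"
  have ind: "independent ?C"
  proof (rule independent_Union_directed)
    fix c d assume "c \<in> range B" "d \<in> range B"
    then obtain k l where "c = B k" "d = B l" by auto
    then show "c \<subseteq> d \<or> d \<subseteq> c" using mono[of k l] mono[of l k] nat_le_linear[of k l] by blast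
  qed (use B(1) in auto)
  have sub: "corad_below k \<subseteq> span (?C \<inter> corad_below k)" for k
  proof -
    have "B k \<subseteq> ?C \<inter> corad_below k" using B(1)[of k] by auto
    then show ?thesis using B(1)[of k] span_mono by blast
  qed
  have "x \<in> span ?C" for x
  proof -
    obtain j where "x \<in> corad_filt j" using corad_filt_exhaust by blast
    then have "x \<in> span (?C \<inter> corad_below (Suc j))" using sub[of "Suc j"] by auto
    then show ?thesis using span_mono[of "?C \<inter> corad_below (Suc j)" ?C] by auto
  qed
  then have "span ?C = UNIV" by auto
  then show ?thesis using that[of ?C] ind sub B(1) by blast
qed

lemma adapted_basis_dual:
  assumes C: "independent C" "\<And>k. corad_below k \<subseteq> span (C \<inter> corad_below k)"
    and "y \<in> corad_below k" "c \<notin> corad_below k"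
  shows "representation C y c = 0"
  by (rule representation_span_subset[of _ _ "C \<inter> corad_below k"]) (use assms in auto)

text \<open>
  In an adapted basis, the coordinate functional of \<open>u\<close> with \<open>u \<in> F i - F (i - 1)\<close> kills \<open>F (i - 1)\<close>,
  so \<open>lact_annihilator\<close> bounds the degree of the factor next to \<open>u\<close>.
\<close>

lemma filtered_sweedlerE:
  assumes x: "x \<in> corad_filt a"
  obtains ps where "\<Delta> x = tens ps"
    "\<And>u w. (u, w) \<in> set ps \<Longrightarrow> \<exists>i\<le>a. u \<in> corad_filt i \<and> w \<in> corad_filt (a - i)"
proof -
  obtain C where C: "independent C" "span C = UNIV" "C \<subseteq> homogeneous"
      "\<And>k. corad_below k \<subseteq> span (C \<inter> corad_below k)"
    using adapted_basisE by metis
  obtain ps where ps: "\<Delta> x = tens ps"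
      "\<And>a b. (a, b) \<in> set ps \<Longrightarrow> a \<in> C \<and> b = lact (\<lambda>v. representation C v a) x \<and> b \<noteq> 0"
    using sweedler_basis[OF C(1,2), of x] by metis
  have "\<exists>i\<le>a. u \<in> corad_filt i \<and> w \<in> corad_filt (a - i)" if uw: "(u, w) \<in> set ps" for u w
  proof -
    define i where "i = (LEAST i. u \<in> corad_filt i)"
    have ui: "u \<in> corad_filt i" unfolding i_def using corad_filt_exhaust[of u] by (auto intro: LeastI_ex)
    have un: "u \<notin> corad_below i"
    proof (cases i)
      case 0
      have "u \<noteq> 0" using ps(2)[OF uw] C(1) dependent_zero by blast
      then show ?thesis using 0 by simp
    next
      case (Suc i')
      then show ?thesis using not_less_Least[of i' "\<lambda>i. u \<in> corad_filt i"] by (auto simp: i_def)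
    qed
    have r: "functional (\<lambda>v. representation C v u)" by (rule linear_representation_UNIV[OF C(1,2)])
    have w: "w \<in> corad_below l" if "x \<in> corad_below (i + l)" for l
      using lact_annihilator[OF r _ that] adapted_basis_dual[OF C(1,4) _ un] ps(2)[OF uw] by auto
    show ?thesis
    proof (cases "i \<le> a")
      case True
      have "w \<in> corad_below (Suc (a - i))" using w[of "Suc (a - i)"] True x by simp
      then show ?thesis using True ui by auto
    next
      case False
      have "x \<in> corad_below (i + 0)" using x corad_below_mono[of x "Suc a" i] False by simp
      from w[OF this] show ?thesis using ps(2)[OF uw] by simp
    qed
  qed
  then show ?thesis using ps that by blast
qed

section \<open>Products and the filtration\<close>

lemma corad_filt_0_commute: "x \<in> corad_filt 0 \<Longrightarrow> x * y = y * x"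
  using corad_filt_0D[of x] scale_mult_left[of "\<epsilon> x" 1 y] scale_mult_right[of y "\<epsilon> x" 1] by simp

lemma corad_filt_0_mult: "x \<in> corad_filt 0 \<Longrightarrow> y \<in> corad_filt a \<Longrightarrow> x * y \<in> corad_filt a"
  using corad_filt_0D[of x] scale_mult_left[of "\<epsilon> x" 1 y] subspace_scale[OF subspace_corad_filt] by simp

text \<open>
  By induction on \<open>a + b\<close>. In \<open>\<Delta> (x * y)\<close> the terms whose left factor has degree zero vanish under
  \<open>f\<close>, and in the others the right factor has smaller degree.
\<close>

lemma corad_filt_mult:
  assumes "x \<in> corad_filt a" "y \<in> corad_filt b"
  shows "x * y \<in> corad_filt (a + b)"
  using assms
proof (induction "a + b" arbitrary: a b x y rule: less_induct)
  case less
  obtain ps where ps: "\<Delta> x = tens ps"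
    "\<And>u w. (u, w) \<in> set ps \<Longrightarrow> \<exists>i\<le>a. u \<in> corad_filt i \<and> w \<in> corad_filt (a - i)"
    using filtered_sweedlerE[OF less.prems(1)] by metis
  obtain qs where qs: "\<Delta> y = tens qs"
    "\<And>u w. (u, w) \<in> set qs \<Longrightarrow> \<exists>i\<le>b. u \<in> corad_filt i \<and> w \<in> corad_filt (b - i)"
    using filtered_sweedlerE[OF less.prems(2)] by metis
  have "x * y \<in> corad_below (Suc (a + b))"
    unfolding corad_below_Suc_iff
  proof safe
    fix f assume f: "functional f" "f 1 = 0"
    show "lact f (x * y) \<in> corad_below (a + b)"
      unfolding lact_sweedler[OF f(1) sweedler_mult[OF ps(1) qs(1)]] sum_sw_mult
    proof (intro subspace_sum_list_pair[OF subspace_corad_below])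
      fix u w u' w' assume uw: "(u, w) \<in> set ps" "(u', w') \<in> set qs"
      obtain i where i: "i \<le> a" "u \<in> corad_filt i" "w \<in> corad_filt (a - i)" using ps(2) uw by blast
      obtain i' where i': "i' \<le> b" "u' \<in> corad_filt i'" "w' \<in> corad_filt (b - i')" using qs(2) uw by blast
      show "f (u * u') *s (w * w') \<in> corad_below (a + b)"
      proof (cases "i + i' = 0")
        case True
        then have "u * u' \<in> corad_filt 0" using i i' corad_filt_0_mult by auto
        then have "f (u * u') = 0" using corad_filt_0D[of "u * u'"] linearD(2)[OF f(1)] f(2) by (metis mult_zero_right)
        then show ?thesis using subspace_0[OF subspace_corad_below] by simp
      next
        case False
        then have "w * w' \<in> corad_filt ((a - i) + (b - i'))"
          using less.hyps[of "a - i" "b - i'" w w'] i i' by auto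
        then have "w * w' \<in> corad_below (a + b)"
          using corad_below_mono[of "w * w'" "Suc ((a - i) + (b - i'))" "a + b"] i i' False by auto
        then show ?thesis by (rule subspace_scale[OF subspace_corad_below])
      qed
    qed
  qed
  then show ?case by simp
qed

lemma corad_below_mult_left: "x \<in> corad_below a \<Longrightarrow> y \<in> corad_filt b \<Longrightarrow> x * y \<in> corad_below (a + b)"
  by (cases a) (auto simp: corad_filt_mult subspace_0[OF subspace_corad_below])

lemma corad_below_mult_right: "x \<in> corad_filt a \<Longrightarrow> y \<in> corad_below b \<Longrightarrow> x * y \<in> corad_below (a + b)"
  by (cases b) (auto simp: corad_filt_mult subspace_0[OF subspace_corad_below])

lemma corad_below_le_filt: "x \<in> corad_below a \<Longrightarrow> x \<in> corad_filt a"
  using corad_below_mono_Suc[of x a] by simp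

text \<open>
  Commutativity of \<open>gr H\<close>. The coproduct of the commutator is the
  sum of \<open>[u, u'] \<otimes> w w' + u' u \<otimes> [w, w']\<close>. If \<open>u\<close> and \<open>u'\<close> both have positive degree, then the degree of
  \<open>w w'\<close> has dropped by two; otherwise one of them is a scalar and \<open>[u, u'] = 0\<close>. To \<open>[w, w']\<close> the
  induction hypothesis applies.
\<close>

lemma commutator_corad_below:
  assumes "x \<in> corad_filt a" "y \<in> corad_filt b"
  shows "x * y - y * x \<in> corad_below (a + b)"
  using assms
proof (induction "a + b" arbitrary: a b x y rule: less_induct)
  case less
  show ?case
  proof (cases "a = 0 \<or> b = 0")
    case True
    then have "x * y = y * x" using less.prems corad_filt_0_commute[of x y] corad_filt_0_commute[of y x] by auto
    then show ?thesis using subspace_0[OF subspace_corad_below] by simp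
  next
    case False
    obtain ps where ps: "\<Delta> x = tens ps"
      "\<And>u w. (u, w) \<in> set ps \<Longrightarrow> \<exists>i\<le>a. u \<in> corad_filt i \<and> w \<in> corad_filt (a - i)"
      using filtered_sweedlerE[OF less.prems(1)] by metis
    obtain qs where qs: "\<Delta> y = tens qs"
      "\<And>u w. (u, w) \<in> set qs \<Longrightarrow> \<exists>i\<le>b. u \<in> corad_filt i \<and> w \<in> corad_filt (b - i)"
      using filtered_sweedlerE[OF less.prems(2)] by metis
    have "x * y - y * x \<in> corad_below (Suc (a + b - 1))"
      unfolding corad_below_Suc_iff
    proof safe
      fix f assume f: "functional f" "f 1 = 0"
      have "lact f (x * y - y * x) = lact f (x * y) - lact f (y * x)"
        by (simp add: linearD[OF endo_lact[OF f(1)]])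
      also have "lact f (x * y) = (\<Sum>(u, w)\<leftarrow>ps. \<Sum>(u', w')\<leftarrow>qs. f (u * u') *s (w * w'))"
        unfolding lact_sweedler[OF f(1) sweedler_mult[OF ps(1) qs(1)]] sum_sw_mult ..
      also have "lact f (y * x) = (\<Sum>(u, w)\<leftarrow>ps. \<Sum>(u', w')\<leftarrow>qs. f (u' * u) *s (w' * w))"
        unfolding lact_sweedler[OF f(1) sweedler_mult[OF qs(1) ps(1)]] sum_sw_mult by (rule sum_list_pair_swap)
      also have "(\<Sum>(u, w)\<leftarrow>ps. \<Sum>(u', w')\<leftarrow>qs. f (u * u') *s (w * w')) - \<dots> =
          (\<Sum>(u, w)\<leftarrow>ps. \<Sum>(u', w')\<leftarrow>qs. f (u * u' - u' * u) *s (w * w') + f (u' * u) *s (w * w' - w' * w))"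
        by (simp add: sum_list_pair_diff[symmetric] linearD[OF f(1)] algebra_simps)
      also have "\<dots> \<in> corad_below (a + b - 1)"
      proof (intro subspace_sum_list_pair[OF subspace_corad_below])
        fix u w u' w' assume uw: "(u, w) \<in> set ps" "(u', w') \<in> set qs"
        obtain i where i: "i \<le> a" "u \<in> corad_filt i" "w \<in> corad_filt (a - i)" using ps(2) uw by blast
        obtain i' where i': "i' \<le> b" "u' \<in> corad_filt i'" "w' \<in> corad_filt (b - i')" using qs(2) uw by blast
        have 1: "f (u * u' - u' * u) *s (w * w') \<in> corad_below (a + b - 1)"
        proof (cases "i = 0 \<or> i' = 0")
          case True
          then have "u * u' = u' * u" using i i' corad_filt_0_commute[of u u'] corad_filt_0_commute[of u' u] by auto
          then show ?thesis using subspace_0[OF subspace_corad_below] by (simp add: linearD[OF f(1)])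
        next
          case False
          have "w * w' \<in> corad_below (Suc ((a - i) + (b - i')))" using i i' corad_filt_mult[of w "a - i" w' "b - i'"] by (simp only: corad_below_simps)
          then have "w * w' \<in> corad_below (a + b - 1)" by (rule corad_below_mono) (use i i' False in auto)
          then show ?thesis by (rule subspace_scale[OF subspace_corad_below])
        qed
        have 2: "f (u' * u) *s (w * w' - w' * w) \<in> corad_below (a + b - 1)"
        proof (cases "i + i' = 0")
          case True
          then have "u' * u \<in> corad_filt 0" using i i' corad_filt_0_mult by auto
          then have "f (u' * u) = 0" using corad_filt_0D[of "u' * u"] linearD(2)[OF f(1)] f(2) by (metis mult_zero_right)
          then show ?thesis using subspace_0[OF subspace_corad_below] by simp
        next
          case False
          have "w * w' - w' * w \<in> corad_below ((a - i) + (b - i'))"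
            using less.hyps[of "a - i" "b - i'" w w'] i i' False by auto
          then have "w * w' - w' * w \<in> corad_below (a + b - 1)" by (rule corad_below_mono) (use i i' False in auto)
          then show ?thesis by (rule subspace_scale[OF subspace_corad_below])
        qed
        show "f (u * u' - u' * u) *s (w * w') + f (u' * u) *s (w * w' - w' * w) \<in> corad_below (a + b - 1)"
          using 1 2 by (rule subspace_add[OF subspace_corad_below])
      qed
      finally show "lact f (x * y - y * x) \<in> corad_below (a + b - 1)" .
    qed
    moreover have "Suc (a + b - 1) = a + b" using False by simp
    ultimately show ?thesis by (simp only:)
  qed
qed

section \<open>Decomposable elements\<close>

text \<open>
  Modulo \<open>corad_below j\<close> these are the elements of degree \<open>j\<close> of \<open>gr H\<close> which are sums of
  products of elements of positive degree.
\<close>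

definition decomposables :: "nat \<Rightarrow> 'h set"
  where "decomposables j = span (corad_below j \<union>
    {x * y | x y a b. x \<in> corad_filt a \<and> y \<in> corad_filt b \<and> a + b = j \<and> 0 < a \<and> 0 < b})"

lemma subspace_decomposables: "subspace (decomposables j)"
  by (simp add: decomposables_def)

lemma corad_below_decomposables: "x \<in> corad_below j \<Longrightarrow> x \<in> decomposables j"
  unfolding decomposables_def by (rule span_base) simp

lemma mult_decomposables:
  "x \<in> corad_filt a \<Longrightarrow> y \<in> corad_filt b \<Longrightarrow> 0 < a \<Longrightarrow> 0 < b \<Longrightarrow> x * y \<in> decomposables (a + b)"
  unfolding decomposables_def by (rule span_base) blast

lemma decomposables_corad_filt: "decomposables j \<subseteq> corad_filt j"
  unfolding decomposables_def
  by (rule span_minimal) (auto simp: subspace_corad_filt corad_below_le_filt corad_filt_mult)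

lemma corad_filt_0_decomposables: "x \<in> corad_filt 0 \<Longrightarrow> 0 < j \<Longrightarrow> x \<in> decomposables j"
  by (rule corad_below_decomposables) (use corad_below_mono[of x 1 j] in auto)

lemma hcomp_decomposables:
  assumes "x \<in> decomposables j" shows "hcomp m x \<in> decomposables j"
  using assms unfolding decomposables_def[of j]
proof (induction rule: span_induct_alt)
  case base
  show ?case using subspace_0[OF subspace_decomposables[of j]] by (simp add: linearD[OF endo_hcomp] decomposables_def)
next
  case (step c x y)
  have "hcomp m x \<in> decomposables j"
  proof (cases "x \<in> corad_below j")
    case True
    then show ?thesis by (intro corad_below_decomposables hcomp_corad_below)
  next
    case False
    then obtain v w a b where x: "x = v * w" "v \<in> corad_filt a" "w \<in> corad_filt b" "a + b = j" "0 < a" "0 < b"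
      using step by blast
    obtain N where N: "\<forall>m>N. hcomp m v = 0" using hcomp_bound by blast
    obtain M where M: "\<forall>m>M. hcomp m w = 0" using hcomp_bound by blast
    have "x = (\<Sum>p\<le>N. hcomp p v) * (\<Sum>q\<le>M. hcomp q w)"
      using hcomp_sum[of N v] hcomp_sum[of M w] N M x by auto
    then have "x = (\<Sum>p\<le>N. \<Sum>q\<le>M. hcomp p v * hcomp q w)" by (simp add: sum_product)
    then have "hcomp m x = (\<Sum>p\<le>N. \<Sum>q\<le>M. hcomp m (hcomp p v * hcomp q w))"
      by (simp add: linearD[OF endo_hcomp])
    also have "\<dots> \<in> decomposables j"
    proof (intro subspace_sum[OF subspace_decomposables])
      fix p q
      have "hcomp p v * hcomp q w \<in> decomposables j"
        using mult_decomposables[of "hcomp p v" a "hcomp q w" b] x by (auto intro: hcomp_corad_filt)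
      then show "hcomp m (hcomp p v * hcomp q w) \<in> decomposables j"
        using hcomp_H[OF mult_H[OF hcomp_props(1)[of p v] hcomp_props(1)[of q w]], of m]
          subspace_0[OF subspace_decomposables] by simp
    qed
    finally show ?thesis .
  qed
  then show ?case using step
    by (simp add: linearD[OF endo_hcomp] decomposables_def span_add span_scale)
qed

text \<open>
  A functional that kills \<open>decomposables j\<close> satisfies \<open>f (u u') = f u \<epsilon> u' + \<epsilon> u f u'\<close> as long as the degrees
  of \<open>u\<close> and \<open>u'\<close> add up to at most \<open>j\<close>. In \<open>\<Delta> (x y)\<close>, left factors of larger degree come with right factors
  in \<open>corad_below l\<close>. So \<open>f\<close>, a primitive element of the dual of \<open>gr H\<close>, acts on \<open>gr H\<close> as a derivation.
\<close>

lemma lact_derivation: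
  assumes f: "functional f" and ann: "\<And>y. y \<in> decomposables j \<Longrightarrow> f y = 0" and j: "0 < j"
    and x: "x \<in> corad_filt a" and y: "y \<in> corad_filt b" and ab: "a + b = j + l"
  shows "lact f (x * y) - (lact f x * y + x * lact f y) \<in> corad_below l"
proof -
  obtain ps where ps: "\<Delta> x = tens ps"
    "\<And>u w. (u, w) \<in> set ps \<Longrightarrow> \<exists>i\<le>a. u \<in> corad_filt i \<and> w \<in> corad_filt (a - i)"
    using filtered_sweedlerE[OF x] by metis
  obtain qs where qs: "\<Delta> y = tens qs"
    "\<And>u w. (u, w) \<in> set qs \<Longrightarrow> \<exists>i\<le>b. u \<in> corad_filt i \<and> w \<in> corad_filt (b - i)"
    using filtered_sweedlerE[OF y] by metis
  have mult_sums: "(\<Sum>(u, w)\<leftarrow>ps. g u *s w) * (\<Sum>(u', w')\<leftarrow>qs. h u' *s w') =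
      (\<Sum>(u, w)\<leftarrow>ps. \<Sum>(u', w')\<leftarrow>qs. (g u * h u') *s (w * w'))" for g h
    unfolding sum_list_pair_product by (simp add: scale_mult_left scale_mult_right mult.commute)
  have e: "x = (\<Sum>(u, w)\<leftarrow>ps. \<epsilon> u *s w)" "y = (\<Sum>(u', w')\<leftarrow>qs. \<epsilon> u' *s w')"
    using counit_sweedler(1)[OF ps(1)] counit_sweedler(1)[OF qs(1)] by simp_all
  have "lact f x * y = (\<Sum>(u, w)\<leftarrow>ps. \<Sum>(u', w')\<leftarrow>qs. (f u * \<epsilon> u') *s (w * w'))"
    unfolding lact_sweedler[OF f ps(1)] mult_sums[symmetric] using e by simp
  moreover have "x * lact f y = (\<Sum>(u, w)\<leftarrow>ps. \<Sum>(u', w')\<leftarrow>qs. (\<epsilon> u * f u') *s (w * w'))"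
    unfolding lact_sweedler[OF f qs(1)] mult_sums[symmetric] using e by simp
  moreover have "lact f (x * y) = (\<Sum>(u, w)\<leftarrow>ps. \<Sum>(u', w')\<leftarrow>qs. f (u * u') *s (w * w'))"
    unfolding lact_sweedler[OF f sweedler_mult[OF ps(1) qs(1)]] sum_sw_mult ..
  ultimately have "lact f (x * y) - (lact f x * y + x * lact f y) =
    (\<Sum>(u, w)\<leftarrow>ps. \<Sum>(u', w')\<leftarrow>qs. (f (u * u') - (f u * \<epsilon> u' + \<epsilon> u * f u')) *s (w * w'))"
    by (simp add: sum_list_pair_diff[symmetric] sum_list_pair_add[symmetric] algebra_simps)
  also have "\<dots> \<in> corad_below l"
  proof (intro subspace_sum_list_pair[OF subspace_corad_below])
    fix u w u' w' assume uw: "(u, w) \<in> set ps" "(u', w') \<in> set qs"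
    obtain i where i: "i \<le> a" "u \<in> corad_filt i" "w \<in> corad_filt (a - i)" using ps(2) uw by blast
    obtain i' where i': "i' \<le> b" "u' \<in> corad_filt i'" "w' \<in> corad_filt (b - i')" using qs(2) uw by blast
    show "(f (u * u') - (f u * \<epsilon> u' + \<epsilon> u * f u')) *s (w * w') \<in> corad_below l"
    proof (cases "i + i' \<le> j")
      case True
      have f1: "f 1 = 0" using ann corad_filt_0_decomposables[OF one_corad_filt j] by simp
      \<comment> \<open>split off the scalar parts, on which a derivation along the counit holds trivially; \<open>v * v'\<close> is decomposable\<close>
      define v where "v = u - \<epsilon> u *s 1"
      define v' where "v' = u' - \<epsilon> u' *s 1"
      have v: "v \<in> corad_filt i" "v' \<in> corad_filt i'"
        unfolding v_def v'_def using i i' one_corad_filt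
        by (auto intro!: subspace_diff[OF subspace_corad_filt] subspace_scale[OF subspace_corad_filt])
      have "f (v * v') = 0"
      proof (cases "i = 0 \<or> i' = 0")
        case True
        then have "v = 0 \<or> v' = 0" using corad_filt_0D[of u] corad_filt_0D[of u'] i i' by (auto simp: v_def v'_def)
        then show ?thesis by (auto simp: linearD[OF f])
      next
        case False
        show ?thesis
        proof (cases "i + i' = j")
          case True
          then show ?thesis using mult_decomposables[OF v] False ann by auto
        next
          case False
          then have "v * v' \<in> corad_below j"
            using corad_filt_mult[OF v] corad_below_mono[of "v * v'" "Suc (i + i')" j] \<open>i + i' \<le> j\<close> by auto
          then show ?thesis using ann corad_below_decomposables by blast
        qed
      qed
      moreover have "u * u' = v * v' + \<epsilon> u *s v' + \<epsilon> u' *s v + (\<epsilon> u * \<epsilon> u') *s 1"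
      proof -
        have "u = v + \<epsilon> u *s 1" "u' = v' + \<epsilon> u' *s 1" by (simp_all add: v_def v'_def)
        then have "u * u' = (v + \<epsilon> u *s 1) * (v' + \<epsilon> u' *s 1)" by simp
        also have "\<dots> = v * v' + \<epsilon> u *s v' + \<epsilon> u' *s v + (\<epsilon> u * \<epsilon> u') *s 1"
          by (simp add: distrib_left distrib_right scale_mult_left scale_mult_right scale_right_distrib mult.commute)
        finally show ?thesis .
      qed
      ultimately have "f (u * u') = \<epsilon> u * f v' + \<epsilon> u' * f v"
        using f1 by (simp add: linearD[OF f])
      moreover have "f v = f u" "f v' = f u'" using f1 by (simp_all add: v_def v'_def linearD[OF f])
      ultimately show ?thesis using subspace_0[OF subspace_corad_below] by (simp add: mult.commute)
    next
      case False
      have "w * w' \<in> corad_below (Suc ((a - i) + (b - i')))" using i i' corad_filt_mult[of w "a - i" w' "b - i'"] by (simp only: corad_below_simps)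
      then have "w * w' \<in> corad_below l" by (rule corad_below_mono) (use i i' ab False in auto)
      then show ?thesis by (rule subspace_scale[OF subspace_corad_below])
    qed
  qed
  finally show ?thesis .
qed

section \<open>Convolution powers of the identity\<close>

definition ipower :: "nat \<Rightarrow> 'h \<Rightarrow> 'h"
  where "ipower n = conv_power id n"

lemma ipower_simps: "ipower 0 = conv_unit" "ipower (Suc n) = convolution id (ipower n)"
  unfolding ipower_def by (rule conv_power_simps)+

lemma endo_ipower: "endo (ipower n)"
  unfolding ipower_def by (intro endo_conv_power endo_id(1))

lemma ipower_sweedler: "\<Delta> x = tens ps \<Longrightarrow> ipower (Suc n) x = (\<Sum>(u, w)\<leftarrow>ps. u * ipower n w)"
  unfolding ipower_simps by (simp add: convolution_sweedler[OF endo_id(1) endo_ipower])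

lemma ipower_one: "ipower n 1 = 1"
  by (induction n) (simp_all add: ipower_simps(1) conv_unit_def counit_one ipower_sweedler[OF sweedler_one])

lemma ipower_corad_filt: "x \<in> corad_filt a \<Longrightarrow> ipower n x \<in> corad_filt a"
proof (induction n arbitrary: x a)
  case 0
  then show ?case
    using one_corad_filt by (simp add: ipower_simps conv_unit_def subspace_scale[OF subspace_corad_filt])
next
  case (Suc n)
  obtain ps where ps: "\<Delta> x = tens ps"
    "\<And>u w. (u, w) \<in> set ps \<Longrightarrow> \<exists>i\<le>a. u \<in> corad_filt i \<and> w \<in> corad_filt (a - i)"
    using filtered_sweedlerE[OF Suc.prems] by metis
  show ?case
    unfolding ipower_sweedler[OF ps(1)]
  proof (intro subspace_sum_list_pair[OF subspace_corad_filt])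
    fix u w assume "(u, w) \<in> set ps"
    then obtain i where i: "i \<le> a" "u \<in> corad_filt i" "w \<in> corad_filt (a - i)" using ps(2) by blast
    then show "u * ipower n w \<in> corad_filt a"
      using corad_filt_mult[OF i(2) Suc.IH[OF i(3)]] by simp
  qed
qed

lemma ipower_H: "x \<in> H m \<Longrightarrow> ipower n x \<in> H m"
proof (induction n arbitrary: x m)
  case 0
  then show ?case
    using counit_eq_0[of x m] one_H subspace_H by (cases "m = 0") (auto simp: ipower_simps conv_unit_def subspace_scale subspace_0)
next
  case (Suc n)
  obtain ps where ps: "\<Delta> x = tens ps" "\<And>a b. (a, b) \<in> set ps \<Longrightarrow> \<exists>p\<le>m. a \<in> H p \<and> b \<in> H (m - p)"
    using homogeneous_sweedlerE[OF Suc.prems] by metis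
  show ?case
    unfolding ipower_sweedler[OF ps(1)]
  proof (intro subspace_sum_list_pair[OF subspace_H])
    fix u w assume "(u, w) \<in> set ps"
    then obtain p where p: "p \<le> m" "u \<in> H p" "w \<in> H (m - p)" using ps(2) by blast
    then show "u * ipower n w \<in> H m" using mult_H[OF p(2) Suc.IH[OF p(3)]] by simp
  qed
qed

text \<open>
  In \<open>\<Sum> u u' T(w w')\<close> with \<open>T = id\<^sup>*\<^sup>n\<close>, replace \<open>T (w w')\<close> by \<open>T w T w'\<close> and move \<open>u'\<close> past \<open>T w\<close>; both
  steps change only lower terms.
\<close>

lemma ipower_mult:
  "x \<in> corad_filt a \<Longrightarrow> y \<in> corad_filt b \<Longrightarrow> ipower n (x * y) - ipower n x * ipower n y \<in> corad_below (a + b)"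
proof (induction n arbitrary: x y a b)
  case 0
  then show ?case
    using subspace_0[OF subspace_corad_below]
    by (simp add: ipower_simps conv_unit_def counit_mult scale_mult_left)
next
  case (Suc n)
  obtain ps where ps: "\<Delta> x = tens ps"
    "\<And>u w. (u, w) \<in> set ps \<Longrightarrow> \<exists>i\<le>a. u \<in> corad_filt i \<and> w \<in> corad_filt (a - i)"
    using filtered_sweedlerE[OF Suc.prems(1)] by metis
  obtain qs where qs: "\<Delta> y = tens qs"
    "\<And>u w. (u, w) \<in> set qs \<Longrightarrow> \<exists>i\<le>b. u \<in> corad_filt i \<and> w \<in> corad_filt (b - i)"
    using filtered_sweedlerE[OF Suc.prems(2)] by metis
  let ?T = "ipower n"
  have "ipower (Suc n) (x * y) = (\<Sum>(u, w)\<leftarrow>ps. \<Sum>(u', w')\<leftarrow>qs. (u * u') * ?T (w * w'))"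
    unfolding ipower_sweedler[OF sweedler_mult[OF ps(1) qs(1)]] sum_sw_mult ..
  moreover have "ipower (Suc n) x * ipower (Suc n) y =
      (\<Sum>(u, w)\<leftarrow>ps. \<Sum>(u', w')\<leftarrow>qs. (u * ?T w) * (u' * ?T w'))"
    unfolding ipower_sweedler[OF ps(1)] ipower_sweedler[OF qs(1)]
    by (rule sum_list_pair_product)
  ultimately have "ipower (Suc n) (x * y) - ipower (Suc n) x * ipower (Suc n) y =
      (\<Sum>(u, w)\<leftarrow>ps. \<Sum>(u', w')\<leftarrow>qs. (u * u') * ?T (w * w') - (u * ?T w) * (u' * ?T w'))"
    by (simp only: sum_list_pair_diff)
  also have "\<dots> \<in> corad_below (a + b)"
  proof (intro subspace_sum_list_pair[OF subspace_corad_below])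
    fix u w u' w' assume uw: "(u, w) \<in> set ps" "(u', w') \<in> set qs"
    obtain i where i: "i \<le> a" "u \<in> corad_filt i" "w \<in> corad_filt (a - i)" using ps(2) uw by blast
    obtain i' where i': "i' \<le> b" "u' \<in> corad_filt i'" "w' \<in> corad_filt (b - i')" using qs(2) uw by blast
    have "(u * u') * (?T (w * w') - ?T w * ?T w') \<in> corad_below ((i + i') + ((a - i) + (b - i')))"
      using i i' by (intro corad_below_mult_right corad_filt_mult Suc.IH)
    then have 1: "(u * u') * (?T (w * w') - ?T w * ?T w') \<in> corad_below (a + b)"
      using i i' by (simp add: add_ac)
    have "u * ((u' * ?T w - ?T w * u') * ?T w') \<in> corad_below (i + ((i' + (a - i)) + (b - i')))"
      using i i' by (intro corad_below_mult_right corad_below_mult_left commutator_corad_below ipower_corad_filt)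
    then have 2: "u * ((u' * ?T w - ?T w * u') * ?T w') \<in> corad_below (a + b)"
      using i i' by (simp add: add_ac)
    have "(u * u') * ?T (w * w') - (u * ?T w) * (u' * ?T w') =
        (u * u') * (?T (w * w') - ?T w * ?T w') + u * ((u' * ?T w - ?T w * u') * ?T w')"
      by (simp add: algebra_simps)
    then show "(u * u') * ?T (w * w') - (u * ?T w) * (u' * ?T w') \<in> corad_below (a + b)"
      using subspace_add[OF subspace_corad_below 1 2] by (simp only:)
  qed
  finally show ?case .
qed

text \<open>
  In \<open>\<Delta> v\<close> the terms with neither factor of degree zero contribute products to \<open>(id * T) v\<close>; the
  others add up to \<open>v + T v\<close>, up to a scalar.
\<close>

lemma ipower_decomposables:
  assumes v: "v \<in> corad_filt j" and j: "0 < j"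
  shows "ipower n v - of_nat n *s v \<in> decomposables j"
proof (induction n)
  case 0
  then show ?case
    using corad_filt_0_decomposables[OF one_corad_filt j] by (simp add: ipower_simps conv_unit_def subspace_scale[OF subspace_decomposables])
next
  case (Suc n)
  obtain ps where ps: "\<Delta> v = tens ps"
    "\<And>u w. (u, w) \<in> set ps \<Longrightarrow> \<exists>i\<le>j. u \<in> corad_filt i \<and> w \<in> corad_filt (j - i)"
    using filtered_sweedlerE[OF v] by metis
  let ?T = "ipower n"
  have T1: "?T 1 = 1" by (rule ipower_one)
  have v1: "v = (\<Sum>(u, w)\<leftarrow>ps. \<epsilon> w *s u)" and v2: "v = (\<Sum>(u, w)\<leftarrow>ps. \<epsilon> u *s w)"
    using counit_sweedler[OF ps(1)] by simp_all
  have "?T v = (\<Sum>(u, w)\<leftarrow>ps. \<epsilon> u *s ?T w)"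
    by (subst v2) (simp only: linear_sum_list_pair[OF endo_ipower] linearD(2)[OF endo_ipower])
  then have "ipower (Suc n) v - ?T v - v = (\<Sum>(u, w)\<leftarrow>ps. u * ?T w - \<epsilon> u *s ?T w - \<epsilon> w *s u)"
    unfolding ipower_sweedler[OF ps(1)] sum_list_pair_diff using v1 by simp
  also have "\<dots> \<in> decomposables j"
  proof (intro subspace_sum_list_pair[OF subspace_decomposables])
    fix u w assume "(u, w) \<in> set ps"
    then obtain i where i: "i \<le> j" "u \<in> corad_filt i" "w \<in> corad_filt (j - i)" using ps(2) by blast
    have *: "u * ?T w - \<epsilon> u *s ?T w - \<epsilon> w *s u = (u - \<epsilon> u *s 1) * (?T w - \<epsilon> w *s 1) - (\<epsilon> u * \<epsilon> w) *s 1"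
      by (simp add: algebra_simps scale_mult_left scale_mult_right)
    have "(u - \<epsilon> u *s 1) * (?T w - \<epsilon> w *s 1) \<in> decomposables j"
    proof -
      consider "i = 0" | "i = j" | "0 < i" "i < j" using i by linarith
      then show ?thesis
      proof cases
        case 1
        then have "u - \<epsilon> u *s 1 = 0" using corad_filt_0D i by simp
        then show ?thesis using subspace_0[OF subspace_decomposables] by simp
      next
        case 2
        then have "w = \<epsilon> w *s 1" using corad_filt_0D i by simp
        then have "?T w = \<epsilon> w *s 1" using T1 linearD(2)[OF endo_ipower] by metis
        then show ?thesis using subspace_0[OF subspace_decomposables] by simp
      next
        case 3
        have "u - \<epsilon> u *s 1 \<in> corad_filt i" "?T w - \<epsilon> w *s 1 \<in> corad_filt (j - i)"
          using i one_corad_filt ipower_corad_filt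
          by (auto intro!: subspace_diff[OF subspace_corad_filt] subspace_scale[OF subspace_corad_filt])
        then show ?thesis using mult_decomposables[of _ i _ "j - i"] 3 by simp
      qed
    qed
    moreover have "(\<epsilon> u * \<epsilon> w) *s 1 \<in> decomposables j"
      using corad_filt_0_decomposables[OF one_corad_filt j] by (rule subspace_scale[OF subspace_decomposables])
    ultimately show "u * ?T w - \<epsilon> u *s ?T w - \<epsilon> w *s u \<in> decomposables j"
      unfolding * by (rule subspace_diff[OF subspace_decomposables])
  qed
  finally have "ipower (Suc n) v - ?T v - v + (?T v - of_nat n *s v) \<in> decomposables j"
    using Suc by (intro subspace_add[OF subspace_decomposables])
  then show ?case by (simp add: algebra_simps)
qed

section \<open>Generators and monomials\<close>

text \<open>
  The second and third condition say that \<open>B\<close> maps to a basis of the indecomposables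
  \<open>corad_filt j / decomposables j\<close> of \<open>gr H\<close> in degree \<open>j\<close>.
\<close>

definition complement_basis :: "nat \<Rightarrow> 'h set \<Rightarrow> bool"
  where "complement_basis j B \<longleftrightarrow> B \<subseteq> corad_filt j \<inter> homogeneous \<and>
    corad_filt j \<subseteq> span (decomposables j \<union> B) \<and>
    (\<forall>v\<in>B. v \<notin> span (decomposables j \<union> (B - {v})))"

lemma complement_basis_exists: "\<exists>B. complement_basis j B"
proof -
  obtain S where S: "S \<subseteq> decomposables j \<inter> homogeneous" "independent S"
      "decomposables j \<inter> homogeneous \<subseteq> span S"
    using maximal_independent_subset by metis
  have "S \<subseteq> corad_filt j \<inter> homogeneous" using S decomposables_corad_filt by auto
  then obtain T where T: "S \<subseteq> T" "T \<subseteq> corad_filt j \<inter> homogeneous" "independent T"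
      "corad_filt j \<inter> homogeneous \<subseteq> span T"
    using maximal_independent_subset_extend[of S "corad_filt j \<inter> homogeneous"] S(2) by metis
  have D: "decomposables j \<subseteq> span S"
    using subspace_decomposables hcomp_decomposables S(3) by (rule graded_subspace_span)
  have F: "corad_filt j \<subseteq> span T"
    using subspace_corad_filt hcomp_corad_filt T(4) by (rule graded_subspace_span)
  have "T \<subseteq> span (decomposables j \<union> (T - S))"
    using S(1) by (auto intro: span_base)
  then have "span T \<subseteq> span (decomposables j \<union> (T - S))" by (simp add: span_minimal)
  moreover have "v \<notin> span (decomposables j \<union> (T - S - {v}))" if v: "v \<in> T - S" for v
  proof
    assume "v \<in> span (decomposables j \<union> (T - S - {v}))"
    moreover have "span S \<subseteq> span (T - {v})" using T(1) v by (intro span_mono) auto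
    then have "decomposables j \<union> (T - S - {v}) \<subseteq> span (T - {v})"
      using D by (auto intro: span_base)
    then have "span (decomposables j \<union> (T - S - {v})) \<subseteq> span (T - {v})" by (simp add: span_minimal)
    ultimately show False using T(3) v by (auto simp: dependent_def)
  qed
  ultimately have "complement_basis j (T - S)"
    unfolding complement_basis_def using T(2) F by auto
  then show ?thesis by blast
qed

definition gens_at :: "nat \<Rightarrow> 'h set"
  where "gens_at j = (SOME B. complement_basis j B)"

lemma gens_at: "complement_basis j (gens_at j)"
  unfolding gens_at_def by (rule someI_ex) (rule complement_basis_exists)

text \<open>
  Degree zero is excluded: \<open>gens_at 0\<close> spans the line of \<open>1\<close>.
\<close>

definition gens :: "'h set"
  where "gens = (\<Union>j\<in>{0<..}. gens_at j)"

definition fdeg :: "'h \<Rightarrow> nat"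
  where "fdeg v = (LEAST j. v \<in> corad_filt j)"

definition gdeg :: "'h \<Rightarrow> nat"
  where "gdeg v = (LEAST m. v \<in> H m)"

lemma fdeg_gens_at:
  assumes "v \<in> gens_at j" "0 < j"
  shows "fdeg v = j"
  unfolding fdeg_def
proof (rule Least_equality)
  show "v \<in> corad_filt j" using gens_at[of j] assms by (auto simp: complement_basis_def)
next
  fix i assume i: "v \<in> corad_filt i"
  have "v \<notin> span (decomposables j \<union> (gens_at j - {v}))"
    using gens_at[of j] assms by (auto simp: complement_basis_def)
  then have "v \<notin> decomposables j" using span_base[of v "decomposables j \<union> (gens_at j - {v})"] by auto
  then have "v \<notin> corad_below j" using corad_below_decomposables by blast
  then show "j \<le> i" using corad_below_mono[of v "Suc i" j] i by (auto simp: not_less_eq_eq[symmetric])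
qed

lemma gensD:
  assumes "v \<in> gens"
  shows "0 < fdeg v" "v \<in> gens_at (fdeg v)" "v \<in> corad_filt (fdeg v)" "v \<in> H (gdeg v)"
    "v \<notin> corad_below (fdeg v)" "0 < gdeg v"
proof -
  obtain j where j: "0 < j" "v \<in> gens_at j" using assms by (auto simp: gens_def)
  have fj: "fdeg v = j" using fdeg_gens_at j by simp
  show "0 < fdeg v" "v \<in> gens_at (fdeg v)" using fj j by auto
  have "v \<in> corad_filt j \<inter> homogeneous" using gens_at[of j] j by (auto simp: complement_basis_def)
  then show "v \<in> corad_filt (fdeg v)" "v \<in> H (gdeg v)"
    using fj by (auto simp: gdeg_def homogeneous_def intro: LeastI)
  have n: "v \<notin> span (decomposables j \<union> (gens_at j - {v}))"
    using gens_at[of j] j by (auto simp: complement_basis_def)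
  then have "v \<notin> decomposables j" using span_base[of v "decomposables j \<union> (gens_at j - {v})"] by auto
  then show nb: "v \<notin> corad_below (fdeg v)" using corad_below_decomposables fj by blast
  show "0 < gdeg v"
  proof (rule ccontr)
    assume "\<not> 0 < gdeg v"
    then have "v \<in> corad_filt 0" using \<open>v \<in> H (gdeg v)\<close> H_corad_filt by auto
    then have "v \<in> corad_below (fdeg v)" using corad_below_mono[of v 1 "fdeg v"] fj j by auto
    then show False using nb by simp
  qed
qed

lemma in_gens: "v \<in> gens_at j \<Longrightarrow> 0 < j \<Longrightarrow> v \<in> gens"
  by (auto simp: gens_def)

lemma corad_filt_gens: "corad_filt j \<subseteq> span (decomposables j \<union> gens_at j)"
  using gens_at[of j] by (simp add: complement_basis_def)

text \<open>
  The homogeneous functional dual to a generator \<open>v\<close>. Composing with the projection to the degree of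
  \<open>v\<close> keeps the other conditions, as the decomposables are graded and the generators homogeneous.
\<close>

lemma gens_functionalE:
  assumes v: "v \<in> gens"
  obtains f where "functional f" "f v = 1" "\<And>y. y \<in> decomposables (fdeg v) \<Longrightarrow> f y = 0"
    "\<And>w. w \<in> gens_at (fdeg v) \<Longrightarrow> w \<noteq> v \<Longrightarrow> f w = 0"
    "\<And>m x. x \<in> H m \<Longrightarrow> m \<noteq> gdeg v \<Longrightarrow> f x = 0"
proof -
  let ?S = "decomposables (fdeg v) \<union> (gens_at (fdeg v) - {v})"
  have "v \<notin> span ?S" using gens_at[of "fdeg v"] gensD[OF v] by (auto simp: complement_basis_def)
  then obtain h where h: "functional h" "h v = 1" "\<And>x. x \<in> span ?S \<Longrightarrow> h x = 0"
    using exists_functional[of "span ?S" v] by auto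
  let ?f = "\<lambda>x. h (hcomp (gdeg v) x)"
  have hv: "hcomp (gdeg v) v = v" using gensD(4)[OF v] by (simp add: hcomp_H)
  show ?thesis
  proof (rule that[of ?f])
    show "functional ?f" by (rule functional_hcomp[OF h(1)])
    show "?f v = 1" using hv h by simp
    show "?f y = 0" if "y \<in> decomposables (fdeg v)" for y
      using hcomp_decomposables[OF that] h(3) span_base by blast
    show "?f w = 0" if w: "w \<in> gens_at (fdeg v)" "w \<noteq> v" for w
    proof -
      obtain m where "w \<in> H m" using gens_at[of "fdeg v"] w by (auto simp: complement_basis_def homogeneous_def)
      then show ?thesis using h w by (auto simp: hcomp_H linearD[OF h(1)] span_base)
    qed
    show "?f x = 0" if "x \<in> H m" "m \<noteq> gdeg v" for m x
      using that by (simp add: hcomp_H linearD[OF h(1)])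
  qed
qed

subsection \<open>Congruence modulo lower filtration\<close>

text \<open>
  For elements of \<open>corad_filt k\<close> this is equality of their classes in \<open>gr H\<close>.
\<close>

definition eqm :: "nat \<Rightarrow> 'h \<Rightarrow> 'h \<Rightarrow> bool"
  where "eqm k x y \<longleftrightarrow> x - y \<in> corad_below k"

lemma eqm_refl [simp]: "eqm k x x"
  by (simp add: eqm_def subspace_0[OF subspace_corad_below])

lemma eqm_sym: "eqm k x y \<Longrightarrow> eqm k y x"
  unfolding eqm_def using subspace_neg[OF subspace_corad_below, of "x - y" k] by simp

lemma eqm_trans [trans]: "eqm k x y \<Longrightarrow> eqm k y z \<Longrightarrow> eqm k x z"
  unfolding eqm_def using subspace_add[OF subspace_corad_below, of "x - y" k "y - z"] by simp

lemma eqm_add: "eqm k x y \<Longrightarrow> eqm k x' y' \<Longrightarrow> eqm k (x + x') (y + y')"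
  unfolding eqm_def using subspace_add[OF subspace_corad_below, of "x - y" k "x' - y'"] by (simp add: algebra_simps)

lemma eqm_scale: "eqm k x y \<Longrightarrow> eqm k (c *s x) (c *s y)"
  unfolding eqm_def using subspace_scale[OF subspace_corad_below, of "x - y" k c] by (simp add: algebra_simps)

lemma eqm_sum: "(\<And>i. i \<in> I \<Longrightarrow> eqm k (f i) (g i)) \<Longrightarrow> eqm k (\<Sum>i\<in>I. f i) (\<Sum>i\<in>I. g i)"
  unfolding eqm_def sum_subtractf[symmetric] by (rule subspace_sum[OF subspace_corad_below])

lemma eqm_mult_left: "eqm k x y \<Longrightarrow> z \<in> corad_filt a \<Longrightarrow> eqm (a + k) (z * x) (z * y)"
  unfolding eqm_def using corad_below_mult_right[of z a "x - y" k] by (simp add: algebra_simps)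

lemma eqm_mult_right: "eqm k x y \<Longrightarrow> z \<in> corad_filt a \<Longrightarrow> eqm (k + a) (x * z) (y * z)"
  unfolding eqm_def using corad_below_mult_left[of "x - y" k z a] by (simp add: algebra_simps)

lemma eqm_in: "eqm k x y \<Longrightarrow> y \<in> corad_below k \<Longrightarrow> x \<in> corad_below k"
  unfolding eqm_def using subspace_add[OF subspace_corad_below, of "x - y" k y] by simp

subsection \<open>Monomials\<close>

definition lfdeg :: "'h list \<Rightarrow> nat"
  where "lfdeg xs = sum_list (map fdeg xs)"

definition mfdeg :: "'h multiset \<Rightarrow> nat"
  where "mfdeg M = \<Sum>\<^sub># (image_mset fdeg M)"

definition mgdeg :: "'h multiset \<Rightarrow> nat"
  where "mgdeg M = \<Sum>\<^sub># (image_mset gdeg M)"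

lemma mfdeg_mset: "mfdeg (mset xs) = lfdeg xs"
  unfolding mfdeg_def lfdeg_def mset_map[symmetric] by (rule sum_mset_sum_list)

lemma mgdeg_mset: "mgdeg (mset xs) = sum_list (map gdeg xs)"
  unfolding mgdeg_def mset_map[symmetric] by (rule sum_mset_sum_list)

lemma lfdeg_simps [simp]: "lfdeg [] = 0" "lfdeg (x # xs) = fdeg x + lfdeg xs" "lfdeg (xs @ ys) = lfdeg xs + lfdeg ys"
  by (auto simp: lfdeg_def)

lemma prod_list_corad_filt: "set xs \<subseteq> gens \<Longrightarrow> prod_list xs \<in> corad_filt (lfdeg xs)"
  by (induction xs) (auto simp: one_corad_filt intro: corad_filt_mult gensD)

lemma prod_list_H: "set xs \<subseteq> gens \<Longrightarrow> prod_list xs \<in> H (sum_list (map gdeg xs))"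
  by (induction xs) (auto simp: one_H intro: mult_H gensD)

lemma prod_list_perm:
  "mset xs = mset ys \<Longrightarrow> set xs \<subseteq> gens \<Longrightarrow> eqm (lfdeg xs) (prod_list xs) (prod_list ys)"
proof (induction xs arbitrary: ys)
  case Nil
  then show ?case by simp
next
  case (Cons x xs)
  then have "x \<in> set ys" by (metis list.set_intros(1) set_mset_mset)
  then obtain l r where ys: "ys = l @ x # r" by (meson split_list)
  have m: "mset xs = mset (l @ r)" using Cons.prems(1) by (simp add: ys)
  have sub: "set (l @ r) \<subseteq> gens" using Cons.prems(2) mset_eq_setD[OF m] by auto
  have deg: "lfdeg xs = lfdeg l + lfdeg r" using mfdeg_mset[of xs] mfdeg_mset[of "l @ r"] m by simp
  have x: "x \<in> corad_filt (fdeg x)" using Cons.prems by (auto intro: gensD)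
  have l: "prod_list l \<in> corad_filt (lfdeg l)" and r: "prod_list r \<in> corad_filt (lfdeg r)"
    using sub by (auto intro: prod_list_corad_filt)
  have "eqm (fdeg x + lfdeg xs) (x * prod_list xs) (x * prod_list (l @ r))"
    using Cons.IH[OF m] Cons.prems x by (intro eqm_mult_left) auto
  also have "eqm (fdeg x + lfdeg l + lfdeg r) (x * prod_list l * prod_list r) (prod_list l * x * prod_list r)"
    using commutator_corad_below[OF x l] r by (intro eqm_mult_right) (auto simp: eqm_def)
  then have "eqm (fdeg x + lfdeg xs) (x * prod_list (l @ r)) (prod_list ys)"
    by (simp add: ys deg mult.assoc add.assoc)
  finally show ?case by simp
qed

text \<open>
  Different orders of the factors give the same class in \<open>gr H\<close>, so any order may be chosen.
\<close>

definition mon :: "'h multiset \<Rightarrow> 'h"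
  where "mon M = prod_list (SOME xs. mset xs = M)"

lemma monE:
  obtains xs where "mset xs = M" "mon M = prod_list xs"
  unfolding mon_def using someI_ex[OF ex_mset[of M]] by blast

lemma mon_prod_list: "set xs \<subseteq> gens \<Longrightarrow> eqm (lfdeg xs) (mon (mset xs)) (prod_list xs)"
proof -
  assume s: "set xs \<subseteq> gens"
  obtain ys where ys: "mset ys = mset xs" "mon (mset xs) = prod_list ys" by (rule monE)
  have "eqm (lfdeg xs) (prod_list xs) (prod_list ys)" using prod_list_perm[OF ys(1)[symmetric] s] .
  then show ?thesis unfolding ys(2) by (rule eqm_sym)
qed

lemma mon_corad_filt: assumes "set_mset M \<subseteq> gens" shows "mon M \<in> corad_filt (mfdeg M)"
proof -
  obtain xs where xs: "mset xs = M" "mon M = prod_list xs" by (rule monE)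
  have "set xs \<subseteq> gens" using assms xs(1) by auto
  from prod_list_corad_filt[OF this] show ?thesis by (simp only: xs mfdeg_mset[symmetric])
qed

lemma mon_H: assumes "set_mset M \<subseteq> gens" shows "mon M \<in> H (mgdeg M)"
proof -
  obtain xs where xs: "mset xs = M" "mon M = prod_list xs" by (rule monE)
  have "set xs \<subseteq> gens" using assms xs(1) by auto
  from prod_list_H[OF this] show ?thesis by (simp only: xs mgdeg_mset[symmetric])
qed

lemma mon_empty [simp]: "mon {#} = 1"
proof -
  obtain xs where xs: "mset xs = {#}" "mon {#} = prod_list xs" by (rule monE)
  then show ?thesis by simp
qed

lemma mon_single [simp]: "mon {#v#} = v"
proof -
  obtain xs where xs: "mset xs = {#v#}" "mon {#v#} = prod_list xs" by (rule monE)
  then have "xs = [v]" by simp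
  then show ?thesis using xs by simp
qed

lemma mfdeg_simps [simp]: "mfdeg {#} = 0" "mfdeg {#v#} = fdeg v" "mfdeg (M + N) = mfdeg M + mfdeg N"
  "mfdeg (add_mset v M) = fdeg v + mfdeg M"
  by (auto simp: mfdeg_def)

lemma mgdeg_simps [simp]: "mgdeg {#} = 0" "mgdeg {#v#} = gdeg v" "mgdeg (M + N) = mgdeg M + mgdeg N"
  "mgdeg (add_mset v M) = gdeg v + mgdeg M"
  by (auto simp: mgdeg_def)

lemma mon_add:
  assumes "set_mset M \<subseteq> gens" "set_mset N \<subseteq> gens"
  shows "eqm (mfdeg (M + N)) (mon (M + N)) (mon M * mon N)"
proof -
  obtain xs where xs: "mset xs = M" "mon M = prod_list xs" by (rule monE)
  obtain ys where ys: "mset ys = N" "mon N = prod_list ys" by (rule monE)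
  have "set (xs @ ys) \<subseteq> gens" using assms xs(1) ys(1) by auto
  from mon_prod_list[OF this] show ?thesis
    unfolding xs(2) ys(2) mfdeg_mset[symmetric] by (simp add: xs(1) ys(1))
qed

section \<open>Linear independence of the monomials\<close>

text \<open>
  The action of \<open>f\<close> is the partial derivative by \<open>v\<close> on generators of degree at most that of \<open>v\<close>:
  it maps generators of smaller degree to zero, and on those of the same degree it is
  the scalar \<open>f x\<close>.
\<close>

lemma lact_prod_list:
  assumes v: "v \<in> gens" and f: "functional f" "f v = 1"
    and ann: "\<And>y. y \<in> decomposables (fdeg v) \<Longrightarrow> f y = 0"
    and dual: "\<And>w. w \<in> gens_at (fdeg v) \<Longrightarrow> w \<noteq> v \<Longrightarrow> f w = 0"
  shows "set xs \<subseteq> gens \<Longrightarrow> \<forall>x\<in>set xs. fdeg x \<le> fdeg v \<Longrightarrow> lfdeg xs = fdeg v + l \<Longrightarrow>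
    eqm l (lact f (prod_list xs)) (of_nat (count (mset xs) v) *s prod_list (remove1 v xs))"
proof (induction xs arbitrary: l)
  case Nil
  then show ?case using gensD(1)[OF v] by simp
next
  case (Cons x xs)
  have annb: "f y = 0" if "y \<in> corad_below (fdeg v)" for y
    using ann corad_below_decomposables that by blast
  let ?P = "prod_list xs"
  have x: "x \<in> gens" "x \<in> corad_filt (fdeg x)" "fdeg x \<le> fdeg v" using Cons.prems by (auto intro: gensD)
  have P: "?P \<in> corad_filt (lfdeg xs)" using Cons.prems by (auto intro: prod_list_corad_filt)
  have deg: "fdeg x + lfdeg xs = fdeg v + l" using Cons.prems by simp
  have a1: "eqm l (lact f (x * ?P)) (lact f x * ?P + x * lact f ?P)"
    using lact_derivation[OF f(1) ann gensD(1)[OF v] x(2) P deg] by (simp add: eqm_def)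
  have lx: "lact f x = (if x = v then 1 else 0)"
  proof (cases "fdeg x = fdeg v")
    case True
    have "lact f x \<in> corad_below 1"
      using x(2) True by (intro lact_annihilator[OF f(1) annb]) auto
    then have "lact f x = \<epsilon> (lact f x) *s 1" using corad_filt_0D by auto
    also have "\<epsilon> (lact f x) = f x" using lact_ract_adjoint[OF f(1) functional_counit] by (simp add: ract_counit)
    also have "f x = (if x = v then 1 else 0)"
      using dual[of x] gensD(2)[OF x(1)] True f by auto
    finally show ?thesis by simp
  next
    case False
    have "x \<in> corad_below (fdeg v)" using corad_below_mono[of x "Suc (fdeg x)" "fdeg v"] x False by auto
    then have "lact f x \<in> corad_below 0" by (intro lact_annihilator[OF f(1) annb]) auto
    then show ?thesis using False by auto
  qed
  have a2: "eqm l (x * lact f ?P) (of_nat (count (mset xs) v) *s (x * prod_list (remove1 v xs)))"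
  proof (cases "fdeg v \<le> lfdeg xs")
    case True
    then obtain l' where l': "lfdeg xs = fdeg v + l'" using le_Suc_ex by blast
    have "eqm (fdeg x + l') (x * lact f ?P) (x * (of_nat (count (mset xs) v) *s prod_list (remove1 v xs)))"
      using Cons l' x(2) by (intro eqm_mult_left) auto
    moreover have "l = fdeg x + l'" using deg l' by simp
    ultimately show ?thesis by (simp add: scale_mult_right)
  next
    case False
    have "?P \<in> corad_below (fdeg v)" using corad_below_mono[of ?P "Suc (lfdeg xs)" "fdeg v"] P False by auto
    then have "lact f ?P \<in> corad_below 0" by (intro lact_annihilator[OF f(1) annb]) auto
    moreover have "v \<notin> set xs"
    proof
      assume "v \<in> set xs"
      then have "fdeg v \<le> lfdeg xs" unfolding lfdeg_def by (intro member_le_sum_list) auto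
      then show False using False by simp
    qed
    ultimately show ?thesis by (simp add: count_mset_0_iff[THEN iffD2])
  qed
  have "lact f x * ?P = (if x = v then ?P else 0)" by (simp add: lx)
  then have *: "eqm l (lact f (x * ?P))
      ((if x = v then ?P else 0) + of_nat (count (mset xs) v) *s (x * prod_list (remove1 v xs)))"
    using eqm_trans[OF a1 eqm_add[OF eqm_refl a2]] by simp
  show ?case
  proof (cases "x = v")
    case False
    then show ?thesis using * by simp
  next
    case True
    have "eqm l (of_nat (count (mset xs) v) *s (x * prod_list (remove1 v xs))) (of_nat (count (mset xs) v) *s ?P)"
    proof (cases "v \<in> set xs")
      case False
      then show ?thesis by (simp add: count_mset_0_iff[THEN iffD2])
    next
      case v: True
      have "eqm (lfdeg (x # remove1 v xs)) (prod_list (x # remove1 v xs)) ?P"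
        using Cons.prems v True set_remove1_subset[of v xs] by (intro prod_list_perm) auto
      moreover have "lfdeg (x # remove1 v xs) = l"
        using mfdeg_mset[of "x # remove1 v xs"] mfdeg_mset[of xs] v True deg by simp
      ultimately show ?thesis by (intro eqm_scale) simp
    qed
    note b = eqm_add[OF eqm_refl[of l ?P] this]
    have "eqm l (lact f (x * ?P)) (?P + of_nat (count (mset xs) v) *s (x * prod_list (remove1 v xs)))"
      using * True by simp
    from eqm_trans[OF this b] have "eqm l (lact f (x * ?P)) (?P + of_nat (count (mset xs) v) *s ?P)" .
    then show ?thesis using True by (simp add: algebra_simps)
  qed
qed

lemma lact_mon:
  assumes v: "v \<in> gens" and f: "functional f" "f v = 1"
    and ann: "\<And>y. y \<in> decomposables (fdeg v) \<Longrightarrow> f y = 0"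
    and dual: "\<And>w. w \<in> gens_at (fdeg v) \<Longrightarrow> w \<noteq> v \<Longrightarrow> f w = 0"
    and M: "set_mset M \<subseteq> gens" "\<forall>x\<in>#M. fdeg x \<le> fdeg v" "mfdeg M = fdeg v + l"
  shows "eqm l (lact f (mon M)) (of_nat (count M v) *s mon (M - {#v#}))"
proof -
  obtain xs where xs: "mset xs = M" "mon M = prod_list xs" by (rule monE)
  have sub: "set xs \<subseteq> gens" and le: "\<forall>x\<in>set xs. fdeg x \<le> fdeg v"
    using M(1,2) unfolding xs(1)[symmetric] by auto
  have deg: "lfdeg xs = fdeg v + l" using M(3) unfolding xs(1)[symmetric] by (simp only: mfdeg_mset)
  have 1: "eqm l (lact f (prod_list xs)) (of_nat (count (mset xs) v) *s prod_list (remove1 v xs))"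
    by (intro lact_prod_list[OF v f] ann dual sub le deg)
  have 2: "eqm l (of_nat (count (mset xs) v) *s prod_list (remove1 v xs)) (of_nat (count (mset xs) v) *s mon (mset xs - {#v#}))"
  proof (cases "v \<in> set xs")
    case True
    have "set (remove1 v xs) \<subseteq> gens" using sub set_remove1_subset[of v xs] by auto
    from mon_prod_list[OF this] have "eqm (lfdeg (remove1 v xs)) (mon (mset xs - {#v#})) (prod_list (remove1 v xs))"
      by simp
    moreover have "lfdeg (remove1 v xs) = l"
      using mfdeg_mset[of "v # remove1 v xs"] mfdeg_mset[of xs] True deg by simp
    ultimately show ?thesis by (auto intro: eqm_scale eqm_sym)
  next
    case False
    then have "count (mset xs) v = 0" by (simp add: count_mset_0_iff)
    then show ?thesis by (simp only: of_nat_0 scale_zero_left eqm_refl)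
  qed
  show ?thesis using eqm_trans[OF 1 2] by (simp only: xs)
qed

text \<open>
  Among the generators in a relation pick \<open>v\<close> of highest filtration degree, and differentiate by it.
  The resulting relation has smaller degree, so its coefficients, which are the old ones times the
  exponents of \<open>v\<close>, vanish.
\<close>

lemma mon_independent_graded:
  assumes "finite \<M>" "\<And>M. M \<in> \<M> \<Longrightarrow> set_mset M \<subseteq> gens \<and> mfdeg M = j"
    and "(\<Sum>M\<in>\<M>. c M *s mon M) \<in> corad_below j"
  shows "\<forall>M\<in>\<M>. c M = 0"
  using assms
proof (induction j arbitrary: \<M> c rule: less_induct)
  case (less j)
  show ?case
  proof (rule ccontr)
    assume "\<not> (\<forall>M\<in>\<M>. c M = 0)"
    define \<N> where "\<N> = {M \<in> \<M>. c M \<noteq> 0}"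
    have \<N>: "finite \<N>" "\<N> \<noteq> {}" "\<And>M. M \<in> \<N> \<Longrightarrow> set_mset M \<subseteq> gens \<and> mfdeg M = j"
      using less.prems \<open>\<not> _\<close> by (auto simp: \<N>_def)
    have sum\<N>: "(\<Sum>M\<in>\<N>. c M *s mon M) \<in> corad_below j"
      using less.prems(1,3) by (subst sum.mono_neutral_left[of \<M>]) (auto simp: \<N>_def)
    define U where "U = (\<Union>M\<in>\<N>. set_mset M)"
    have finU: "finite U" using \<N> by (simp add: U_def)
    show False
    proof (cases "U = {}")
      case True
      then have "\<N> = {{#}}" using \<N>(2) by (auto simp: U_def)
      then have "j = 0" "c {#} *s 1 \<in> corad_below j" "c {#} \<noteq> 0"
        using \<N>(3) sum\<N> by (auto simp: \<N>_def)
      then show False using one_neq_zero_h by simp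
    next
      case False
      obtain v where v: "v \<in> U" "\<And>w. w \<in> U \<Longrightarrow> fdeg w \<le> fdeg v"
      proof -
        have "Max (fdeg ` U) \<in> fdeg ` U" using finU False by simp
        then obtain v where "v \<in> U" "fdeg v = Max (fdeg ` U)" by auto
        then show ?thesis using that[of v] finU by simp
      qed
      then obtain M1 where M1: "M1 \<in> \<N>" "v \<in># M1" by (auto simp: U_def)
      have vg: "v \<in> gens" using M1 \<N>(3) by blast
      obtain f where f: "functional f" "f v = 1" "\<And>y. y \<in> decomposables (fdeg v) \<Longrightarrow> f y = 0"
          "\<And>w. w \<in> gens_at (fdeg v) \<Longrightarrow> w \<noteq> v \<Longrightarrow> f w = 0"
        using gens_functionalE[OF vg] by metis
      have "mfdeg M1 = fdeg v + mfdeg (M1 - {#v#})" using mfdeg_simps(4)[of v "M1 - {#v#}"] M1 by simp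
      then have le: "fdeg v \<le> j" using \<N>(3)[OF M1(1)] by simp
      define l where "l = j - fdeg v"
      have j: "j = fdeg v + l" using le by (simp add: l_def)
      have lj: "l < j" using j gensD(1)[OF vg] by simp
      have annb: "f y = 0" if "y \<in> corad_below (fdeg v)" for y
        using f(3) corad_below_decomposables that by blast
      have "lact f (\<Sum>M\<in>\<N>. c M *s mon M) \<in> corad_below l"
        by (rule lact_annihilator[OF f(1), of "fdeg v"]) (use annb sum\<N> j in auto)
      also have "lact f (\<Sum>M\<in>\<N>. c M *s mon M) = (\<Sum>M\<in>\<N>. c M *s lact f (mon M))"
        by (simp add: linearD[OF endo_lact[OF f(1)]])
      finally have 1: "(\<Sum>M\<in>\<N>. c M *s lact f (mon M)) \<in> corad_below l" .
      have "eqm l (\<Sum>M\<in>\<N>. c M *s lact f (mon M)) (\<Sum>M\<in>\<N>. c M *s (of_nat (count M v) *s mon (M - {#v#})))"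
      proof (intro eqm_sum eqm_scale lact_mon[OF vg f(1,2,3,4)])
        fix M assume M: "M \<in> \<N>"
        show "set_mset M \<subseteq> gens" "mfdeg M = fdeg v + l" using \<N>(3)[OF M] j by auto
        show "\<forall>x\<in>#M. fdeg x \<le> fdeg v" using v(2) M by (auto simp: U_def)
      qed auto
      then have 2: "(\<Sum>M\<in>\<N>. c M *s (of_nat (count M v) *s mon (M - {#v#}))) \<in> corad_below l"
        using 1 eqm_in eqm_sym by blast
      define \<N>' where "\<N>' = {M \<in> \<N>. v \<in># M}"
      have inj: "inj_on (\<lambda>M. M - {#v#}) \<N>'"
        unfolding \<N>'_def by (rule inj_onI) (metis (no_types, lifting) insert_DiffM mem_Collect_eq)
      have "(\<Sum>M\<in>\<N>. c M *s (of_nat (count M v) *s mon (M - {#v#}))) =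
          (\<Sum>M\<in>\<N>'. (c M * of_nat (count M v)) *s mon (M - {#v#}))"
        using \<N>(1) by (intro sum.mono_neutral_cong_right) (auto simp: \<N>'_def not_in_iff)
      also have "\<dots> = (\<Sum>N\<in>(\<lambda>M. M - {#v#}) ` \<N>'. (c (N + {#v#}) * of_nat (count (N + {#v#}) v)) *s mon N)"
        using inj by (subst sum.reindex) (auto simp: \<N>'_def intro!: sum.cong)
      finally have 3: "(\<Sum>N\<in>(\<lambda>M. M - {#v#}) ` \<N>'. (c (N + {#v#}) * of_nat (count (N + {#v#}) v)) *s mon N) \<in> corad_below l"
        using 2 by simp
      have "\<forall>N\<in>(\<lambda>M. M - {#v#}) ` \<N>'. c (N + {#v#}) * of_nat (count (N + {#v#}) v) = 0"
      proof (rule less.IH[OF lj _ _ 3])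
        show "finite ((\<lambda>M. M - {#v#}) ` \<N>')" using \<N>(1) by (simp add: \<N>'_def)
        fix N assume "N \<in> (\<lambda>M. M - {#v#}) ` \<N>'"
        then obtain M where M: "N = M - {#v#}" "M \<in> \<N>" "v \<in># M" by (auto simp: \<N>'_def)
        have "mfdeg M = fdeg v + mfdeg N" using mfdeg_simps(4)[of v N] M by simp
        then show "set_mset N \<subseteq> gens \<and> mfdeg N = l"
          using \<N>(3)[OF M(2)] M j by (auto dest: in_diffD)
      qed
      then have "c (M1 - {#v#} + {#v#}) * of_nat (count (M1 - {#v#} + {#v#}) v) = 0"
        using M1 by (auto simp: \<N>'_def)
      moreover have "M1 - {#v#} + {#v#} = M1" using M1 by simp
      ultimately have "c M1 = 0" using M1 by (metis count_eq_zero_iff mult_eq_0_iff of_nat_eq_0_iff)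
      then show False using M1 by (simp add: \<N>_def)
    qed
  qed
qed

lemma mon_independent:
  assumes fin: "finite \<M>" and sub: "\<And>M. M \<in> \<M> \<Longrightarrow> set_mset M \<subseteq> gens"
    and 0: "(\<Sum>M\<in>\<M>. c M *s mon M) = 0"
  shows "\<forall>M\<in>\<M>. c M = 0"
proof (rule ccontr)
  assume "\<not> (\<forall>M\<in>\<M>. c M = 0)"
  define \<N> where "\<N> = {M \<in> \<M>. c M \<noteq> 0}"
  have \<N>: "finite \<N>" "\<N> \<noteq> {}" using fin \<open>\<not> _\<close> by (auto simp: \<N>_def)
  define j where "j = Max (mfdeg ` \<N>)"
  define \<J> where "\<J> = {M \<in> \<N>. mfdeg M = j}"
  have "j \<in> mfdeg ` \<N>" using \<N> by (simp add: j_def)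
  then obtain M0 where M0: "M0 \<in> \<J>" by (auto simp: \<J>_def)
  have le: "mfdeg M \<le> j" if "M \<in> \<N>" for M using that \<N> by (simp add: j_def)
  have "0 = (\<Sum>M\<in>\<N>. c M *s mon M)"
    unfolding 0[symmetric] using fin by (intro sum.mono_neutral_right) (auto simp: \<N>_def)
  also have "\<dots> = (\<Sum>M\<in>\<J>. c M *s mon M) + (\<Sum>M\<in>\<N> - \<J>. c M *s mon M)"
    using \<N> by (subst sum.subset_diff[of \<J> \<N>]) (auto simp: \<J>_def add.commute)
  finally have "(\<Sum>M\<in>\<J>. c M *s mon M) = - (\<Sum>M\<in>\<N> - \<J>. c M *s mon M)"
    by (simp add: eq_neg_iff_add_eq_0)
  also have "\<dots> \<in> corad_below j"
  proof (intro subspace_neg[OF subspace_corad_below] subspace_sum[OF subspace_corad_below] subspace_scale[OF subspace_corad_below])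
    fix M assume M: "M \<in> \<N> - \<J>"
    then have "mfdeg M < j" using le[of M] by (auto simp: \<J>_def)
    moreover have "mon M \<in> corad_below (Suc (mfdeg M))" using mon_corad_filt sub M by (auto simp: \<N>_def)
    ultimately show "mon M \<in> corad_below j" using corad_below_mono by (metis Suc_leI)
  qed
  finally have "(\<Sum>M\<in>\<J>. c M *s mon M) \<in> corad_below j" .
  moreover have "finite \<J>" using \<N> by (simp add: \<J>_def)
  ultimately have "\<forall>M\<in>\<J>. c M = 0"
    using sub by (intro mon_independent_graded) (auto simp: \<J>_def \<N>_def)
  then show False using M0 by (auto simp: \<J>_def \<N>_def)
qed

section \<open>Spanning by monomials\<close>

text \<open>
  Modulo lower filtration, the span of the monomials of degree \<open>j\<close> with at least \<open>k\<close> factors: the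
  filtration of \<open>gr H\<close> by powers of its augmentation ideal.
\<close>

definition mon_span :: "nat \<Rightarrow> nat \<Rightarrow> 'h set"
  where "mon_span j k = span (corad_below j \<union> {mon M | M. set_mset M \<subseteq> gens \<and> mfdeg M = j \<and> k \<le> size M})"

lemma subspace_mon_span: "subspace (mon_span j k)"
  by (simp add: mon_span_def)

lemma corad_below_mon_span: "x \<in> corad_below j \<Longrightarrow> x \<in> mon_span j k"
  unfolding mon_span_def by (rule span_base) simp

lemma mon_in_mon_span: "set_mset M \<subseteq> gens \<Longrightarrow> k \<le> size M \<Longrightarrow> mon M \<in> mon_span (mfdeg M) k"
  unfolding mon_span_def by (rule span_base) blast

lemma mon_span_antimono: "x \<in> mon_span j k \<Longrightarrow> k' \<le> k \<Longrightarrow> x \<in> mon_span j k'"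
  unfolding mon_span_def
  by (rule subsetD[OF span_mono]) auto

lemma mon_span_corad_filt: "mon_span j k \<subseteq> corad_filt j"
  unfolding mon_span_def
  by (rule span_minimal) (auto simp: subspace_corad_filt corad_below_le_filt mon_corad_filt)

lemma mon_span_mult:
  assumes x: "x \<in> mon_span a k" and y: "y \<in> mon_span b l"
  shows "x * y \<in> mon_span (a + b) (k + l)"
proof -
  have 1: "mon M * y \<in> mon_span (a + b) (k + l)"
    if M: "set_mset M \<subseteq> gens" "mfdeg M = a" "k \<le> size M" for M
    using y unfolding mon_span_def[of b l]
  proof (induction rule: span_induct_alt)
    case base
    show ?case by (simp add: subspace_0[OF subspace_mon_span])
  next
    case (step c z w)
    have "mon M * z \<in> mon_span (a + b) (k + l)"
    proof (cases "z \<in> corad_below b")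
      case True
      then show ?thesis using mon_corad_filt[OF M(1)] M(2)
        by (intro corad_below_mon_span corad_below_mult_right) auto
    next
      case False
      then obtain N where N: "z = mon N" "set_mset N \<subseteq> gens" "mfdeg N = b" "l \<le> size N"
        using step by blast
      have "mon (M + N) - mon M * mon N \<in> corad_below (a + b)"
        using mon_add[OF M(1) N(2)] M N by (simp add: eqm_def)
      then have "mon (M + N) - mon M * mon N \<in> mon_span (a + b) (k + l)" by (rule corad_below_mon_span)
      moreover have "mon (M + N) \<in> mon_span (a + b) (k + l)"
        using mon_in_mon_span[of "M + N" "k + l"] M N by auto
      ultimately have "mon (M + N) - (mon (M + N) - mon M * mon N) \<in> mon_span (a + b) (k + l)"
        by (rule subspace_diff[OF subspace_mon_span, rotated])
      then show ?thesis using N by simp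
    qed
    then show ?case using step
      by (simp add: distrib_left scale_mult_right subspace_add[OF subspace_mon_span] subspace_scale[OF subspace_mon_span])
  qed
  have yF: "y \<in> corad_filt b" using y mon_span_corad_filt by blast
  show ?thesis
    using x unfolding mon_span_def[of a k]
  proof (induction rule: span_induct_alt)
    case base
    show ?case by (simp add: subspace_0[OF subspace_mon_span])
  next
    case (step c z w)
    have "z * y \<in> mon_span (a + b) (k + l)"
    proof (cases "z \<in> corad_below a")
      case True
      then show ?thesis using yF by (intro corad_below_mon_span corad_below_mult_left)
    next
      case False
      then show ?thesis using step 1 by blast
    qed
    then show ?case using step
      by (simp add: distrib_right scale_mult_left subspace_add[OF subspace_mon_span] subspace_scale[OF subspace_mon_span])
  qed
qed

lemma decomposables_mon_span_aux:
  assumes "\<And>i. 0 < i \<Longrightarrow> i < j \<Longrightarrow> corad_filt i \<subseteq> mon_span i 1"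
  shows "decomposables j \<subseteq> mon_span j 2"
  unfolding decomposables_def
proof (rule span_minimal[OF _ subspace_mon_span])
  have "x * y \<in> mon_span (a + b) (1 + 1)"
    if "x \<in> corad_filt a" "y \<in> corad_filt b" "a + b = j" "0 < a" "0 < b" for x y a b
    using that assms[of a] assms[of b] by (intro mon_span_mult) auto
  then show "corad_below j \<union> {x * y | x y a b. x \<in> corad_filt a \<and> y \<in> corad_filt b \<and> a + b = j \<and> 0 < a \<and> 0 < b}
      \<subseteq> mon_span j 2"
    by (auto simp: corad_below_mon_span numeral_2_eq_2)
qed

lemma corad_filt_mon_span: "0 < j \<Longrightarrow> corad_filt j \<subseteq> mon_span j 1"
proof (induction j rule: less_induct)
  case (less j)
  have "decomposables j \<subseteq> mon_span j 2" using less by (intro decomposables_mon_span_aux) auto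
  then have D: "decomposables j \<subseteq> mon_span j 1" using mon_span_antimono[of _ j 2 1] by auto
  have "v \<in> mon_span j 1" if "v \<in> gens_at j" for v
    using mon_in_mon_span[of "{#v#}" 1] in_gens[OF that less.prems] fdeg_gens_at[OF that less.prems] by simp
  then have "span (decomposables j \<union> gens_at j) \<subseteq> mon_span j 1"
    using D by (intro span_minimal[OF _ subspace_mon_span]) auto
  then show ?case using corad_filt_gens[of j] by blast
qed

lemma decomposables_mon_span: "decomposables j \<subseteq> mon_span j 2"
  by (rule decomposables_mon_span_aux) (rule corad_filt_mon_span)

lemma corad_filt_mon_span_0: "corad_filt j \<subseteq> mon_span j 0"
proof (cases "j = 0")
  case True
  have "1 \<in> mon_span 0 0" using mon_in_mon_span[of "{#}" 0] by simp
  then show ?thesis unfolding True corad_filt_0_eq by (intro span_minimal[OF _ subspace_mon_span]) auto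
next
  case False
  then show ?thesis using corad_filt_mon_span[of j] mon_span_antimono[of _ j 1 0] by auto
qed

lemma corad_below_span_mon: "corad_below j \<subseteq> span {mon M | M. set_mset M \<subseteq> gens \<and> mfdeg M < j}"
proof (induction j)
  case 0
  show ?case by (simp add: span_zero)
next
  case (Suc j)
  let ?S = "\<lambda>j. {mon M | M. set_mset M \<subseteq> gens \<and> mfdeg M < j}"
  have "span (?S j) \<subseteq> span (?S (Suc j))" by (intro span_mono) force
  then have below: "corad_below j \<subseteq> span (?S (Suc j))" using Suc by blast
  have "mon_span j 0 \<subseteq> span (?S (Suc j))"
    unfolding mon_span_def
  proof (rule span_minimal)
    from below
    show "corad_below j \<union> {mon M | M. set_mset M \<subseteq> gens \<and> mfdeg M = j \<and> 0 \<le> size M} \<subseteq> span (?S (Suc j))"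
      by (auto intro!: span_base)
  qed simp
  then show ?case using corad_filt_mon_span_0[of j] by auto
qed

lemma hcomp_span_mon:
  assumes "x \<in> span {mon M | M. set_mset M \<subseteq> gens \<and> P M}"
  shows "hcomp m x \<in> span {mon M | M. set_mset M \<subseteq> gens \<and> P M \<and> mgdeg M = m}"
  using assms
proof (induction rule: span_induct_alt)
  case base
  show ?case by (simp add: linearD[OF endo_hcomp] span_zero)
next
  case (step c x y)
  then obtain M where M: "x = mon M" "set_mset M \<subseteq> gens" "P M" by blast
  have "hcomp m x \<in> span {mon M | M. set_mset M \<subseteq> gens \<and> P M \<and> mgdeg M = m}"
    using hcomp_H[OF mon_H[OF M(2)], of m] M by (auto simp: span_zero intro!: span_base)
  then show ?case using step by (simp add: linearD[OF endo_hcomp] span_add span_scale)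
qed

definition monomials :: "nat \<Rightarrow> 'h multiset set"
  where "monomials m = {M. set_mset M \<subseteq> gens \<and> mgdeg M = m}"

lemma span_monomials: "span (mon ` monomials m) = H m"
proof
  show "span (mon ` monomials m) \<subseteq> H m"
    using mon_H by (intro span_minimal subspace_H) (auto simp: monomials_def)
  show "H m \<subseteq> span (mon ` monomials m)"
  proof
    fix x assume x: "x \<in> H m"
    then have "x \<in> corad_below (Suc m)" using H_corad_filt by simp
    then have "x \<in> span {mon M | M. set_mset M \<subseteq> gens \<and> mfdeg M < Suc m}"
      using corad_below_span_mon by blast
    from hcomp_span_mon[OF this, of m] have "x \<in> span {mon M | M. set_mset M \<subseteq> gens \<and> mfdeg M < Suc m \<and> mgdeg M = m}"
      using x by (simp add: hcomp_H)
    then show "x \<in> span (mon ` monomials m)"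
      by (rule subsetD[OF span_mono, rotated]) (auto simp: monomials_def)
  qed
qed

section \<open>Convolution powers on monomials\<close>

text \<open>
  Write \<open>id\<^sup>*\<^sup>n v = n v + d\<close> with \<open>d\<close> decomposable; every product that involves such a \<open>d\<close> has more
  factors.
\<close>

lemma ipower_prod_list:
  "set xs \<subseteq> gens \<Longrightarrow>
    ipower n (prod_list xs) - of_nat n ^ length xs *s prod_list xs \<in> mon_span (lfdeg xs) (Suc (length xs))"
proof (induction xs)
  case Nil
  then show ?case by (simp add: ipower_one subspace_0[OF subspace_mon_span])
next
  case (Cons v xs)
  let ?P = "prod_list xs" and ?k = "length xs" and ?n = "of_nat n :: 'k"
  have v: "v \<in> gens" and sub: "set xs \<subseteq> gens" using Cons.prems by auto
  define e where "e = ipower n ?P - ?n ^ ?k *s ?P"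
  define d where "d = ipower n v - ?n *s v"
  have e: "e \<in> mon_span (lfdeg xs) (Suc ?k)" using Cons sub by (simp add: e_def)
  have d: "d \<in> mon_span (fdeg v) 2"
    unfolding d_def using ipower_decomposables[OF gensD(3,1)[OF v]] decomposables_mon_span by blast
  have v1: "v \<in> mon_span (fdeg v) 1" using mon_in_mon_span[of "{#v#}" 1] v by simp
  have P: "?P \<in> mon_span (lfdeg xs) ?k"
  proof -
    have "mon (mset xs) - ?P \<in> mon_span (lfdeg xs) ?k"
      using mon_prod_list[OF sub] by (auto simp: eqm_def intro: corad_below_mon_span)
    moreover have "mon (mset xs) \<in> mon_span (lfdeg xs) ?k"
      using mon_in_mon_span[of "mset xs" ?k] sub by (simp add: mfdeg_mset)
    ultimately have "mon (mset xs) - (mon (mset xs) - ?P) \<in> mon_span (lfdeg xs) ?k"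
      by (rule subspace_diff[OF subspace_mon_span, rotated])
    then show ?thesis by simp
  qed
  have "ipower n (v * ?P) - ipower n v * ipower n ?P \<in> mon_span (fdeg v + lfdeg xs) (Suc (Suc ?k))"
    using gensD(3)[OF v] prod_list_corad_filt[OF sub] by (intro corad_below_mon_span ipower_mult)
  moreover have "?n *s (v * e) \<in> mon_span (fdeg v + lfdeg xs) (Suc (Suc ?k))"
    using mon_span_mult[OF v1 e] by (simp add: subspace_scale[OF subspace_mon_span])
  moreover have "?n ^ ?k *s (d * ?P) \<in> mon_span (fdeg v + lfdeg xs) (Suc (Suc ?k))"
    using mon_span_mult[OF d P] by (simp add: subspace_scale[OF subspace_mon_span])
  moreover have "d * e \<in> mon_span (fdeg v + lfdeg xs) (Suc (Suc ?k))"
    using mon_span_mult[OF d e] by (rule mon_span_antimono) simp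
  ultimately have "(ipower n (v * ?P) - ipower n v * ipower n ?P) + (?n *s (v * e) + (?n ^ ?k *s (d * ?P) + d * e))
      \<in> mon_span (fdeg v + lfdeg xs) (Suc (Suc ?k))"
    by (intro subspace_add[OF subspace_mon_span])
  also have "(ipower n (v * ?P) - ipower n v * ipower n ?P) + (?n *s (v * e) + (?n ^ ?k *s (d * ?P) + d * e)) =
      ipower n (v * ?P) - ?n ^ Suc ?k *s (v * ?P)"
    by (simp add: e_def d_def algebra_simps scale_mult_left scale_mult_right scale_right_diff_distrib)
  finally show ?case by simp
qed

text \<open>
  The error term involves monomials of lower filtration degree or of the same degree and greater
  length, never \<open>M\<close> itself; projecting to \<open>H m\<close> leaves those of weight \<open>m\<close>.
\<close>

lemma ipower_mon:
  assumes M: "M \<in> monomials m"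
  shows "ipower n (mon M) - of_nat n ^ size M *s mon M \<in> span (mon ` (monomials m - {M}))"
proof -
  obtain xs where xs: "mset xs = M" "mon M = prod_list xs" by (rule monE)
  have sub: "set xs \<subseteq> gens" using M xs by (auto simp: monomials_def)
  let ?x = "ipower n (mon M) - of_nat n ^ size M *s mon M"
  let ?S = "{mon N | N. set_mset N \<subseteq> gens \<and> N \<noteq> M}"
  have "?x \<in> mon_span (mfdeg M) (Suc (size M))"
    using ipower_prod_list[OF sub, of n] xs mfdeg_mset[of xs] size_mset[of xs] by simp
  moreover have "mon_span (mfdeg M) (Suc (size M)) \<subseteq> span ?S"
    unfolding mon_span_def
  proof (rule span_minimal)
    have "span {mon N | N. set_mset N \<subseteq> gens \<and> mfdeg N < mfdeg M} \<subseteq> span ?S" by (intro span_mono) auto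
    then have "corad_below (mfdeg M) \<subseteq> span ?S" using corad_below_span_mon by blast
    then show "corad_below (mfdeg M) \<union> {mon N | N. set_mset N \<subseteq> gens \<and> mfdeg N = mfdeg M \<and> Suc (size M) \<le> size N} \<subseteq> span ?S"
      by (auto intro!: span_base)
  qed simp
  ultimately have "?x \<in> span ?S" by blast
  from hcomp_span_mon[OF this, of m] have "hcomp m ?x \<in> span {mon N | N. set_mset N \<subseteq> gens \<and> N \<noteq> M \<and> mgdeg N = m}" .
  moreover have "mon M \<in> H m" using mon_H M by (auto simp: monomials_def)
  then have "?x \<in> H m"
    by (intro subspace_diff[OF subspace_H] subspace_scale[OF subspace_H] ipower_H)
  then have "hcomp m ?x = ?x" by (simp add: hcomp_H)
  moreover have "{mon N | N. set_mset N \<subseteq> gens \<and> N \<noteq> M \<and> mgdeg N = m} = mon ` (monomials m - {M})"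
    by (auto simp: monomials_def)
  ultimately show ?thesis by simp
qed

end

locale locally_finite_hopf_algebra = graded_connected_hopf_algebra scale \<Delta> \<epsilon> H
  for scale :: "'k::field_char_0 \<Rightarrow> 'h::ring_1 \<Rightarrow> 'h" (infixr \<open>*s\<close> 75)
    and \<Delta> :: "'h \<Rightarrow> ('h, 'h, 'k) tensor"
    and \<epsilon> :: "'h \<Rightarrow> 'k"
    and H :: "nat \<Rightarrow> 'h set" +
  assumes finite_dim_H: "finite_dim (H m)"
begin

lemma independent_H_bound: "\<exists>N. \<forall>B. independent B \<and> B \<subseteq> H m \<longrightarrow> finite B \<and> card B \<le> N"
proof -
  obtain C where C: "finite C" "span C = H m" using finite_dim_H[of m] unfolding finite_dim_def by blast
  have "finite B \<and> card B \<le> card C" if "independent B" "B \<subseteq> H m" for B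
    using independent_span_bound[OF C(1) that(1)] C(2) that(2) by simp
  then show ?thesis by blast
qed

lemma finite_monomials: "finite (monomials m)"
proof -
  obtain N where N: "\<forall>B. independent B \<and> B \<subseteq> H m \<longrightarrow> finite B \<and> card B \<le> N"
    using independent_H_bound[of m] by blast
  have "card \<M> \<le> N" if \<M>: "finite \<M>" "\<M> \<subseteq> monomials m" for \<M>
  proof -
    have sub: "set_mset M \<subseteq> gens" if "M \<in> \<M>" for M using \<M>(2) that by (auto simp: monomials_def)
    have ind: "\<forall>M\<in>\<M>. c M = 0" if "(\<Sum>M\<in>\<M>. c M *s mon M) = 0" for c
      using \<M>(1) sub that by (rule mon_independent)
    have inj: "inj_on mon \<M>" and "independent (mon ` \<M>)"
      by (rule independent_family[OF \<M>(1)], erule ind)+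
    moreover have "mon ` \<M> \<subseteq> H m"
    proof safe
      fix M assume "M \<in> \<M>"
      then show "mon M \<in> H m" using \<M>(2) mon_H[of M] by (auto simp: monomials_def)
    qed
    ultimately have "card (mon ` \<M>) \<le> N" using N by blast
    then show ?thesis using inj by (simp add: card_image)
  qed
  then have "finite (monomials m) \<and> card (monomials m) \<le> N"
    by (intro finite_if_finite_subsets_card_bdd)
  then show ?thesis ..
qed

lemma trace_ipower: "trace_on (H m) (ipower n) = (\<Sum>M\<in>monomials m. of_nat n ^ size M)"
proof (rule trace_on_eigenfamily[where b = mon])
  show "ipower n ` H m \<subseteq> H m" using ipower_H by auto
  show "\<forall>i\<in>monomials m. c i = 0" if "(\<Sum>i\<in>monomials m. c i *s mon i) = 0" for c
    using mon_independent[OF finite_monomials _ that] by (auto simp: monomials_def)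
qed (auto simp: finite_monomials span_monomials endo_ipower ipower_mon)

end

context graded_connected_hopf_algebra
begin

section \<open>The associated graded algebra by representatives\<close>

text \<open>
  The operations of \<open>gr H\<close> are defined on cosets. Passing to representatives makes the linear
  structure of \<open>H\<close> available for computations.
\<close>

definition families :: "(nat \<Rightarrow> 'h) set"
  where "families = {x. (\<forall>j. x j \<in> corad_filt j) \<and> finite {j. x j \<noteq> 0}}"

definition cls :: "(nat \<Rightarrow> 'h) \<Rightarrow> nat \<Rightarrow> 'h set"
  where "cls x = (\<lambda>j. corad_coset j (x j))"

definition family_mult :: "(nat \<Rightarrow> 'h) \<Rightarrow> (nat \<Rightarrow> 'h) \<Rightarrow> nat \<Rightarrow> 'h"
  where "family_mult x y j = (\<Sum>i\<le>j. x i * y (j - i))"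

definition single :: "nat \<Rightarrow> 'h \<Rightarrow> nat \<Rightarrow> 'h"
  where "single j x i = (if i = j then x else 0)"

lemma in_corad_coset: "y \<in> corad_coset j x \<longleftrightarrow> eqm j y x"
  by (simp add: corad_coset_def eqm_def)

lemma corad_coset_eq_iff: "corad_coset j x = corad_coset j y \<longleftrightarrow> eqm j x y"
  using in_corad_coset eqm_refl eqm_sym eqm_trans by blast

lemma corad_coset_cong: "eqm j x y \<Longrightarrow> corad_coset j x = corad_coset j y"
  by (simp add: corad_coset_eq_iff)

lemma corad_coset_0 [simp]: "corad_coset 0 x = {x}"
  by (auto simp: corad_coset_def)

lemma familiesD: "x \<in> families \<Longrightarrow> x j \<in> corad_filt j"
  by (simp add: families_def)

lemma families_bound:
  assumes "x \<in> families" obtains N where "\<And>j. N < j \<Longrightarrow> x j = 0"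
proof -
  have "finite {j. x j \<noteq> 0}" using assms by (simp add: families_def)
  then obtain N where "\<forall>j\<in>{j. x j \<noteq> 0}. j \<le> N" using finite_nat_set_iff_bounded_le by blast
  then show ?thesis using that[of N] by force
qed

lemma familiesI:
  assumes "\<And>j. x j \<in> corad_filt j" "\<And>j. N < j \<Longrightarrow> x j = 0"
  shows "x \<in> families"
proof -
  have "{j. x j \<noteq> 0} \<subseteq> {..N}" using assms(2) by (force simp: not_less[symmetric])
  then show ?thesis using assms(1) finite_subset by (auto simp: families_def)
qed

lemma corad_zero [simp]: "0 \<in> corad_filt j"
  by (rule subspace_0[OF subspace_corad_filt])

lemma single_families: "x \<in> corad_filt j \<Longrightarrow> single j x \<in> families"
  by (rule familiesI[of _ j]) (auto simp: single_def)

lemma families_add: "x \<in> families \<Longrightarrow> y \<in> families \<Longrightarrow> (\<lambda>j. x j + y j) \<in> families"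
proof -
  assume x: "x \<in> families" and y: "y \<in> families"
  obtain N where N: "\<And>j. N < j \<Longrightarrow> x j = 0" using families_bound[OF x] by metis
  obtain M where M: "\<And>j. M < j \<Longrightarrow> y j = 0" using families_bound[OF y] by metis
  show ?thesis
    by (rule familiesI[of _ "max N M"]) (auto simp: N M familiesD[OF x] familiesD[OF y] subspace_add[OF subspace_corad_filt])
qed

lemma families_scale: "x \<in> families \<Longrightarrow> (\<lambda>j. c *s x j) \<in> families"
proof -
  assume x: "x \<in> families"
  obtain N where N: "\<And>j. N < j \<Longrightarrow> x j = 0" using families_bound[OF x] by metis
  show ?thesis
    by (rule familiesI[of _ N]) (auto simp: N familiesD[OF x] subspace_scale[OF subspace_corad_filt])
qed

lemma family_mult_bound:
  assumes "\<And>j. N < j \<Longrightarrow> x j = 0" "\<And>j. M < j \<Longrightarrow> y j = 0" "N + M < j"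
  shows "family_mult x y j = 0"
  unfolding family_mult_def
proof (rule sum.neutral, safe)
  fix i assume "i \<le> j"
  then have "N < i \<or> M < j - i" using assms(3) by linarith
  then show "x i * y (j - i) = 0" using assms(1,2) by auto
qed

lemma family_mult_families: "x \<in> families \<Longrightarrow> y \<in> families \<Longrightarrow> family_mult x y \<in> families"
proof -
  assume x: "x \<in> families" and y: "y \<in> families"
  obtain N where N: "\<And>j. N < j \<Longrightarrow> x j = 0" using families_bound[OF x] by metis
  obtain M where M: "\<And>j. M < j \<Longrightarrow> y j = 0" using families_bound[OF y] by metis
  show ?thesis
  proof (rule familiesI[of _ "N + M"])
    show "family_mult x y j \<in> corad_filt j" for j
      unfolding family_mult_def
    proof (rule subspace_sum[OF subspace_corad_filt])
      fix i assume "i \<in> {..j}"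
      then show "x i * y (j - i) \<in> corad_filt j"
        using corad_filt_mult[OF familiesD[OF x, of i] familiesD[OF y, of "j - i"]] by simp
    qed
  qed (rule family_mult_bound[OF N M])
qed

lemma cls_gr: "x \<in> families \<Longrightarrow> cls x \<in> gr"
proof -
  assume x: "x \<in> families"
  then have "finite {j. x j \<noteq> 0}" by (simp add: families_def)
  then have "finite {j. cls x j \<noteq> corad_coset j 0}"
    by (rule rev_finite_subset) (auto simp: cls_def)
  then show ?thesis unfolding gr_def using familiesD[OF x] by (auto simp: cls_def)
qed

lemma gr_cls:
  assumes "X \<in> gr" obtains x where "x \<in> families" "X = cls x"
proof -
  have ex: "\<exists>x. x \<in> corad_filt j \<and> X j = corad_coset j x \<and> (X j = corad_coset j 0 \<longrightarrow> x = 0)" for j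
  proof (cases "X j = corad_coset j 0")
    case True
    then show ?thesis by (intro exI[of _ 0]) simp
  next
    case False
    then show ?thesis using assms by (auto simp: gr_def)
  qed
  obtain x where *: "\<forall>j. x j \<in> corad_filt j \<and> X j = corad_coset j (x j) \<and> (X j = corad_coset j 0 \<longrightarrow> x j = 0)"
    using choice[of "\<lambda>j x. x \<in> corad_filt j \<and> X j = corad_coset j x \<and> (X j = corad_coset j 0 \<longrightarrow> x = 0)"] ex by blast
  then have x: "\<And>j. x j \<in> corad_filt j" "\<And>j. X j = corad_coset j (x j)" "\<And>j. X j = corad_coset j 0 \<Longrightarrow> x j = 0"
    by auto
  have "finite {j. X j \<noteq> corad_coset j 0}" using assms by (simp add: gr_def)
  moreover have "{j. x j \<noteq> 0} \<subseteq> {j. X j \<noteq> corad_coset j 0}" using x(3) by auto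
  ultimately have "x \<in> families" using x(1) finite_subset unfolding families_def by blast
  moreover have "X = cls x" using x(2) by (auto simp: cls_def)
  ultimately show ?thesis using that by blast
qed

lemma gr_add_cls: "gr_add (cls x) (cls y) = cls (\<lambda>j. x j + y j)"
proof
  fix j
  have "corad_coset j (x' + y') = corad_coset j (x j + y j)" if "x' \<in> cls x j" "y' \<in> cls y j" for x' y'
    using that by (intro corad_coset_cong eqm_add) (auto simp: cls_def in_corad_coset)
  then have "{corad_coset j (x' + y') | x' y'. x' \<in> cls x j \<and> y' \<in> cls y j} \<subseteq> {corad_coset j (x j + y j)}" by blast
  moreover have "x j \<in> cls x j" "y j \<in> cls y j" by (auto simp: cls_def in_corad_coset)
  ultimately have "{corad_coset j (x' + y') | x' y'. x' \<in> cls x j \<and> y' \<in> cls y j} = {corad_coset j (x j + y j)}" by blast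
  then show "gr_add (cls x) (cls y) j = cls (\<lambda>j. x j + y j) j" unfolding gr_add_def by (simp add: cls_def)
qed

lemma gr_scale_cls: "gr_scale c (cls x) = cls (\<lambda>j. c *s x j)"
proof
  fix j
  have "corad_coset j (c *s x') = corad_coset j (c *s x j)" if "x' \<in> cls x j" for x'
    using that by (intro corad_coset_cong eqm_scale) (auto simp: cls_def in_corad_coset)
  then have "{corad_coset j (c *s x') | x'. x' \<in> cls x j} \<subseteq> {corad_coset j (c *s x j)}" by blast
  moreover have "x j \<in> cls x j" by (auto simp: cls_def in_corad_coset)
  ultimately have "{corad_coset j (c *s x') | x'. x' \<in> cls x j} = {corad_coset j (c *s x j)}" by blast
  then show "gr_scale c (cls x) j = cls (\<lambda>j. c *s x j) j" unfolding gr_scale_def by (simp add: cls_def)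
qed

lemma eqm_corad_filt: "eqm j x y \<Longrightarrow> y \<in> corad_filt j \<Longrightarrow> x \<in> corad_filt j"
  using subspace_add[OF subspace_corad_filt, of "x - y" j y] corad_below_le_filt[of "x - y" j] by (simp add: eqm_def)

lemma gr_mult_cls:
  assumes x: "x \<in> families" and y: "y \<in> families"
  shows "gr_mult (cls x) (cls y) = cls (family_mult x y)"
proof
  fix j
  have "corad_coset j (\<Sum>i\<le>j. x' i * y' (j - i)) = corad_coset j (family_mult x y j)"
    if x': "\<forall>i. x' i \<in> cls x i" and y': "\<forall>i. y' i \<in> cls y i" for x' y'
    unfolding family_mult_def
  proof (intro corad_coset_cong eqm_sum)
    fix i assume i: "i \<in> {..j}"
    have ex: "eqm i (x' i) (x i)" and ey: "eqm (j - i) (y' (j - i)) (y (j - i))"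
      using x' y' by (auto simp: cls_def in_corad_coset)
    have "eqm (i + (j - i)) (x' i * y' (j - i)) (x' i * y (j - i))"
      using ey eqm_corad_filt[OF ex familiesD[OF x]] by (rule eqm_mult_left)
    also have "eqm (i + (j - i)) (x' i * y (j - i)) (x i * y (j - i))"
      using ex familiesD[OF y] by (rule eqm_mult_right)
    finally show "eqm j (x' i * y' (j - i)) (x i * y (j - i))" using i by simp
  qed
  then have "{corad_coset j (\<Sum>i\<le>j. x' i * y' (j - i)) | x' y'. (\<forall>i. x' i \<in> cls x i) \<and> (\<forall>i. y' i \<in> cls y i)} \<subseteq>
      {corad_coset j (family_mult x y j)}" by blast
  moreover have "\<forall>i. x i \<in> cls x i" "\<forall>i. y i \<in> cls y i" by (auto simp: cls_def in_corad_coset)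
  ultimately have "{corad_coset j (\<Sum>i\<le>j. x' i * y' (j - i)) | x' y'. (\<forall>i. x' i \<in> cls x i) \<and> (\<forall>i. y' i \<in> cls y i)} =
      {corad_coset j (family_mult x y j)}" unfolding family_mult_def by blast
  then show "gr_mult (cls x) (cls y) j = cls (family_mult x y) j" unfolding gr_mult_def by (simp add: cls_def)
qed

lemma gr_counit_cls: "gr_counit (cls x) = \<epsilon> (x 0)"
  by (simp add: gr_counit_def cls_def)

lemma gr_gradeI: "x \<in> families \<Longrightarrow> (\<And>j. x j \<in> H m) \<Longrightarrow> cls x \<in> gr_grade m"
  unfolding gr_grade_def using cls_gr familiesD by (auto simp: cls_def)

text \<open>
  Representatives of homogeneous elements can be taken homogeneous in all components at once, by
  projecting arbitrary representatives.
\<close>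

lemma gr_gradeE:
  assumes "X \<in> gr_grade m" obtains x where "x \<in> families" "X = cls x" "\<And>j. x j \<in> H m"
proof -
  have X: "X \<in> gr" and ex: "\<And>j. \<exists>x \<in> corad_filt j \<inter> H m. X j = corad_coset j x"
    using assms by (auto simp: gr_grade_def)
  obtain y where y: "y \<in> families" "X = cls y" by (rule gr_cls[OF X])
  define x where "x = (\<lambda>j. hcomp m (y j))"
  have eq: "eqm j (y j) (x j)" for j
  proof -
    obtain z where z: "z \<in> H m" "X j = corad_coset j z" using ex[of j] by auto
    have "eqm j (y j) z" using z y(2) by (simp add: cls_def corad_coset_eq_iff)
    then have "hcomp m (y j - z) \<in> corad_below j" unfolding eqm_def by (rule hcomp_corad_below)
    then have "eqm j (x j) z" using z by (simp add: eqm_def x_def linearD[OF endo_hcomp] hcomp_H)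
    then show ?thesis using \<open>eqm j (y j) z\<close> eqm_sym eqm_trans by blast
  qed
  obtain N where N: "\<And>j. N < j \<Longrightarrow> y j = 0" using families_bound[OF y(1)] by metis
  have "x \<in> families"
    by (rule familiesI[of _ N]) (auto simp: x_def N linearD[OF endo_hcomp] hcomp_corad_filt familiesD[OF y(1)])
  moreover have "X = cls x" unfolding y(2) cls_def using corad_coset_cong[OF eq] by blast
  ultimately show ?thesis using that by (auto simp: x_def hcomp_props)
qed

section \<open>The graded dual\<close>

text \<open>
  A functional on \<open>gr H\<close> amounts to functionals on the quotients \<open>corad_filt j / corad_below j\<close>.
  Here they are lifted to functionals \<open>F j\<close> on the whole of \<open>H\<close>, so that linearity holds
  without restriction; the values outside \<open>corad_filt j\<close> are arbitrary.
\<close>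

definition dual_coords :: "((nat \<Rightarrow> 'h set) \<Rightarrow> 'k) \<Rightarrow> (nat \<Rightarrow> 'h \<Rightarrow> 'k) \<Rightarrow> bool"
  where "dual_coords f F \<longleftrightarrow> (\<forall>j. functional (F j)) \<and> (\<forall>j. \<forall>x\<in>corad_below j. F j x = 0) \<and>
    (\<forall>x\<in>families. \<forall>N. (\<forall>j>N. x j = 0) \<longrightarrow> f (cls x) = (\<Sum>j\<le>N. F j (x j)))"

lemma dual_coords_functional: "dual_coords f F \<Longrightarrow> functional (F j)"
  by (simp add: dual_coords_def)

lemma dual_coords_below: "dual_coords f F \<Longrightarrow> x \<in> corad_below j \<Longrightarrow> F j x = 0"
  by (simp add: dual_coords_def)

lemma dual_coords_cls:
  "dual_coords f F \<Longrightarrow> x \<in> families \<Longrightarrow> (\<And>j. N < j \<Longrightarrow> x j = 0) \<Longrightarrow> f (cls x) = (\<Sum>j\<le>N. F j (x j))"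
  by (simp add: dual_coords_def)

lemma dual_coords_single:
  assumes "dual_coords f F" "x \<in> corad_filt j"
  shows "f (cls (single j x)) = F j x"
proof -
  have "f (cls (single j x)) = (\<Sum>i\<le>j. F i (single j x i))"
    using single_families[OF assms(2)] by (rule dual_coords_cls[OF assms(1)]) (auto simp: single_def)
  also have "\<dots> = (\<Sum>i\<le>j. if i = j then F j x else 0)"
    using linearD(3)[OF dual_coords_functional[OF assms(1)]] by (intro sum.cong) (auto simp: single_def)
  finally show ?thesis by simp
qed

lemma gr_dual_coords:
  assumes f: "f \<in> gr_dual"
  obtains F where "dual_coords f F"
proof -
  have add: "f (cls (\<lambda>j. x j + y j)) = f (cls x) + f (cls y)" if "x \<in> families" "y \<in> families" for x y
    using f that cls_gr by (simp add: gr_dual_def gr_add_cls[symmetric])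
  have scale: "f (cls (\<lambda>j. c *s x j)) = c * f (cls x)" if "x \<in> families" for c x
    using f that cls_gr by (simp add: gr_dual_def gr_scale_cls[symmetric])
  have "\<exists>P. endo P \<and> (\<forall>x. P x \<in> corad_filt j) \<and> (\<forall>x\<in>corad_filt j. P x = x)" for j
    by (rule exists_projection[OF subspace_corad_filt[of j]]) blast
  then have "\<forall>j. \<exists>P. endo P \<and> (\<forall>x. P x \<in> corad_filt j) \<and> (\<forall>x\<in>corad_filt j. P x = x)" by blast
  from choice[OF this] obtain P where
    *: "\<forall>j. endo (P j) \<and> (\<forall>x. P j x \<in> corad_filt j) \<and> (\<forall>x\<in>corad_filt j. P j x = x)" by blast
  then have P: "\<And>j. endo (P j)" "\<And>j x. P j x \<in> corad_filt j" "\<And>j x. x \<in> corad_filt j \<Longrightarrow> P j x = x"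
    by auto
  define F where "F = (\<lambda>j x. f (cls (single j (P j x))))"
  have fz: "f (cls (\<lambda>j. 0)) = 0"
  proof -
    have "(\<lambda>j. 0) \<in> families" by (rule familiesI) auto
    from scale[OF this, of 0] show ?thesis by simp
  qed
  have s_add: "single j (x + y) = (\<lambda>i. single j x i + single j y i)" for j x y
    by (auto simp: single_def)
  have s_scale: "single j (c *s x) = (\<lambda>i. c *s single j x i)" for j c x
    by (auto simp: single_def)
  have lin: "functional (F j)" for j
    unfolding F_def
  proof (rule functionalI)
    fix x y show "f (cls (single j (P j (x + y)))) = f (cls (single j (P j x))) + f (cls (single j (P j y)))"
      by (simp add: linearD(1)[OF P(1)] s_add add single_families P(2))
    fix c show "f (cls (single j (P j (c *s x)))) = c * f (cls (single j (P j x)))"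
      by (simp add: linearD(2)[OF P(1)] s_scale scale single_families P(2))
  qed
  have below: "F j x = 0" if x: "x \<in> corad_below j" for j x
  proof -
    have "cls (single j x) = cls (\<lambda>j. 0)"
    proof
      fix i show "cls (single j x) i = cls (\<lambda>j. 0) i"
        using x by (auto simp: cls_def single_def corad_coset_eq_iff eqm_def subspace_0[OF subspace_corad_below])
    qed
    then show ?thesis using fz P(3)[OF corad_below_le_filt[OF x]] by (simp add: F_def)
  qed
  have sum: "f (cls x) = (\<Sum>j\<le>N. F j (x j))" if "x \<in> families" "\<forall>j>N. x j = 0" for x N
    using that
  proof (induction N arbitrary: x)
    case 0
    then have "x = single 0 (x 0)" by (auto simp: single_def)
    then show ?case using P(3) familiesD[OF 0(1)] by (simp add: F_def)
  next
    case (Suc N)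
    define y where "y = (\<lambda>j. if j \<le> N then x j else 0)"
    have y: "y \<in> families" by (rule familiesI[of _ N]) (auto simp: y_def familiesD[OF Suc(2)])
    have xy: "x = (\<lambda>j. y j + single (Suc N) (x (Suc N)) j)"
    proof
      fix j show "x j = y j + single (Suc N) (x (Suc N)) j"
        using Suc.prems(2)[rule_format, of j] by (cases "j \<le> N"; cases "j = Suc N") (auto simp: y_def single_def)
    qed
    have "f (cls x) = f (cls y) + f (cls (single (Suc N) (x (Suc N))))"
      by (subst xy) (rule add[OF y single_families[OF familiesD[OF Suc(2)]]])
    also have "f (cls y) = (\<Sum>j\<le>N. F j (y j))" using y by (rule Suc.IH) (simp add: y_def)
    also have "\<dots> = (\<Sum>j\<le>N. F j (x j))" by (simp add: y_def)
    also have "f (cls (single (Suc N) (x (Suc N)))) = F (Suc N) (x (Suc N))"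
      using P(3) familiesD[OF Suc(2)] by (simp add: F_def)
    finally show ?case by simp
  qed
  show ?thesis using that[of F] lin below sum by (simp add: dual_coords_def)
qed

lemma gr_dual_bound:
  assumes "f \<in> gr_dual" "dual_coords f F"
  obtains N where "\<And>j m x. N < m \<Longrightarrow> x \<in> corad_filt j \<Longrightarrow> x \<in> H m \<Longrightarrow> F j x = 0"
proof -
  have "finite {m. \<exists>X\<in>gr_grade m. f X \<noteq> 0}" using assms(1) by (simp add: gr_dual_def)
  then obtain N where N: "\<forall>m\<in>{m. \<exists>X\<in>gr_grade m. f X \<noteq> 0}. m \<le> N"
    using finite_nat_set_iff_bounded_le by blast
  have "F j x = 0" if "N < m" "x \<in> corad_filt j" "x \<in> H m" for j m x
  proof -
    have "cls (single j x) \<in> gr_grade m"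
      using single_families[OF that(2)] by (rule gr_gradeI) (auto simp: single_def that(3) subspace_0[OF subspace_H])
    then have "f (cls (single j x)) = 0" using N that(1) by force
    then show ?thesis using dual_coords_single[OF assms(2) that(2)] by simp
  qed
  then show ?thesis using that by blast
qed

text \<open>
  The converse of \<open>gr_dual_coords\<close> and \<open>gr_dual_bound\<close>: the bound \<open>N\<close> expresses finite support with respect to the
  second grading.
\<close>

lemma gr_dualI:
  assumes F: "dual_coords f F" and out: "\<And>X. X \<notin> gr \<Longrightarrow> f X = 0"
    and N: "\<And>j m x. N < m \<Longrightarrow> x \<in> corad_filt j \<Longrightarrow> x \<in> H m \<Longrightarrow> F j x = 0"
  shows "f \<in> gr_dual"
proof -
  note lin = dual_coords_functional[OF F]
  have add: "f (gr_add X Y) = f X + f Y" if X: "X \<in> gr" and Y: "Y \<in> gr" for X Y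
  proof -
    obtain x where x: "x \<in> families" "X = cls x" by (rule gr_cls[OF X])
    obtain y where y: "y \<in> families" "Y = cls y" by (rule gr_cls[OF Y])
    obtain M where M: "\<And>j. M < j \<Longrightarrow> x j = 0" using families_bound[OF x(1)] by metis
    obtain K where K: "\<And>j. K < j \<Longrightarrow> y j = 0" using families_bound[OF y(1)] by metis
    have "f (cls (\<lambda>j. x j + y j)) = (\<Sum>j\<le>M + K. F j (x j + y j))"
      by (rule dual_coords_cls[OF F families_add[OF x(1) y(1)]]) (simp add: M K)
    also have "\<dots> = (\<Sum>j\<le>M + K. F j (x j)) + (\<Sum>j\<le>M + K. F j (y j))"
      by (simp add: linearD(1)[OF lin] sum.distrib)
    also have "(\<Sum>j\<le>M + K. F j (x j)) = f X"
      unfolding x(2) by (rule dual_coords_cls[OF F x(1), symmetric]) (simp add: M)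
    also have "(\<Sum>j\<le>M + K. F j (y j)) = f Y"
      unfolding y(2) by (rule dual_coords_cls[OF F y(1), symmetric]) (simp add: K)
    finally show ?thesis using x y by (simp add: gr_add_cls)
  qed
  have scale: "f (gr_scale c X) = c * f X" if X: "X \<in> gr" for X c
  proof -
    obtain x where x: "x \<in> families" "X = cls x" by (rule gr_cls[OF X])
    obtain M where M: "\<And>j. M < j \<Longrightarrow> x j = 0" using families_bound[OF x(1)] by metis
    have "f (cls (\<lambda>j. c *s x j)) = (\<Sum>j\<le>M. F j (c *s x j))"
      by (rule dual_coords_cls[OF F families_scale[OF x(1)]]) (simp add: M)
    also have "\<dots> = c * (\<Sum>j\<le>M. F j (x j))" by (simp add: linearD(2)[OF lin] sum_distrib_left)
    also have "(\<Sum>j\<le>M. F j (x j)) = f X"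
      unfolding x(2) by (rule dual_coords_cls[OF F x(1), symmetric]) (rule M)
    finally show ?thesis using x by (simp add: gr_scale_cls)
  qed
  have "f X = 0" if m: "N < m" and X: "X \<in> gr_grade m" for m X
  proof -
    obtain x where x: "x \<in> families" "X = cls x" "\<And>j. x j \<in> H m" using gr_gradeE[OF X] by metis
    obtain M where M: "\<And>j. M < j \<Longrightarrow> x j = 0" using families_bound[OF x(1)] by metis
    have "f (cls x) = (\<Sum>j\<le>M. F j (x j))"
      by (rule dual_coords_cls[OF F x(1)]) (rule M)
    then show ?thesis using N[OF m familiesD[OF x(1)] x(3)] x(2) by simp
  qed
  then have "{m. \<exists>X\<in>gr_grade m. f X \<noteq> 0} \<subseteq> {..N}" by (force simp: not_less[symmetric])
  then have "finite {m. \<exists>X\<in>gr_grade m. f X \<noteq> 0}" by (rule finite_subset) simp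
  then show ?thesis unfolding gr_dual_def using out add scale by blast
qed

text \<open>The value does not depend on the representative if \<open>h\<close> kills \<open>corad_below j\<close>.\<close>

definition gr_functional :: "nat \<Rightarrow> ('h \<Rightarrow> 'k) \<Rightarrow> (nat \<Rightarrow> 'h set) \<Rightarrow> 'k"
  where "gr_functional j h X = (if X \<in> gr then h (SOME x. x \<in> X j) else 0)"

lemma gr_functional_cls:
  assumes h: "functional h" "\<And>x. x \<in> corad_below j \<Longrightarrow> h x = 0" and x: "x \<in> families"
  shows "gr_functional j h (cls x) = h (x j)"
proof -
  have "x j \<in> cls x j" by (simp add: cls_def in_corad_coset)
  then have "(SOME y. y \<in> cls x j) \<in> cls x j" by (rule someI)
  then have "(SOME y. y \<in> cls x j) - x j \<in> corad_below j" by (simp add: cls_def in_corad_coset eqm_def)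
  then have "h ((SOME y. y \<in> cls x j) - x j) = 0" by (rule h(2))
  then show ?thesis using cls_gr[OF x] by (simp add: gr_functional_def linearD[OF h(1)])
qed

lemma gr_functional_coords:
  assumes h: "functional h" "\<And>x. x \<in> corad_below j \<Longrightarrow> h x = 0"
  shows "dual_coords (gr_functional j h) (\<lambda>i. if i = j then h else (\<lambda>x. 0))"
  unfolding dual_coords_def
proof (intro conjI allI ballI impI)
  show "functional (if i = j then h else (\<lambda>x. 0))" for i
    using h(1) functionalI[of "\<lambda>x. 0"] by simp
  show "(if i = j then h else (\<lambda>x. 0)) x = 0" if "x \<in> corad_below i" for i x
    using that h(2)[of x] by auto
  fix x N assume x: "x \<in> families" "\<forall>i>N. x i = 0"
  have "(\<Sum>i\<le>N. (if i = j then h else (\<lambda>x. 0)) (x i)) = (\<Sum>i\<le>N. if i = j then h (x j) else 0)"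
    by (intro sum.cong) auto
  also have "\<dots> = h (x j)" using x(2) by (auto simp: linearD(3)[OF h(1)])
  finally show "gr_functional j h (cls x) = (\<Sum>i\<le>N. (if i = j then h else (\<lambda>x. 0)) (x i))"
    using gr_functional_cls[OF h x(1)] by simp
qed

lemma gr_functional_dual:
  assumes h: "functional h" "\<And>x. x \<in> corad_below j \<Longrightarrow> h x = 0"
    and m: "\<And>i x. x \<in> H i \<Longrightarrow> i \<noteq> m \<Longrightarrow> h x = 0"
  shows "gr_functional j h \<in> gr_dual_grade m"
proof -
  have "gr_functional j h \<in> gr_dual"
  proof (rule gr_dualI)
    show "dual_coords (gr_functional j h) (\<lambda>i. if i = j then h else (\<lambda>x. 0))"
      using h by (rule gr_functional_coords)
    show "(if i = j then h else (\<lambda>x. 0)) x = 0" if "m < k" "x \<in> H k" for i k x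
      using m[of x k] that by simp
  qed (simp add: gr_functional_def)
  moreover have "gr_functional j h X = 0" if "i \<noteq> m" and X: "X \<in> gr_grade i" for i X
  proof -
    obtain x where x: "x \<in> families" "X = cls x" "\<And>j. x j \<in> H i" using gr_gradeE[OF X] by metis
    show ?thesis using gr_functional_cls[OF h x(1)] m[OF x(3) that(1)] x(2) by simp
  qed
  ultimately show ?thesis by (simp add: gr_dual_grade_def)
qed

lemma dual_one_eq: "dual_one = gr_functional 0 \<epsilon>"
proof
  fix X show "dual_one X = gr_functional 0 \<epsilon> X"
  proof (cases "X \<in> gr")
    case True
    then obtain x where x: "x \<in> families" "X = cls x" by (rule gr_cls)
    have "gr_functional 0 \<epsilon> (cls x) = \<epsilon> (x 0)"
      by (rule gr_functional_cls[OF functional_counit _ x(1)]) (simp add: linearD[OF functional_counit])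
    then show ?thesis using True x by (simp add: dual_one_def gr_counit_cls)
  qed (simp add: dual_one_def gr_functional_def)
qed

lemma dual_one_in: "dual_one \<in> gr_dual"
proof -
  have "dual_one \<in> gr_dual_grade 0"
    unfolding dual_one_eq by (rule gr_functional_dual) (auto simp: functional_counit linearD[OF functional_counit] counit_eq_0)
  then show ?thesis by (simp add: gr_dual_grade_def)
qed

section \<open>The coproduct of the graded dual\<close>

abbreviation dual_pairing ::
  "((nat \<Rightarrow> 'h set) \<Rightarrow> 'k, (nat \<Rightarrow> 'h set) \<Rightarrow> 'k, 'k) tensor \<Rightarrow> (nat \<Rightarrow> 'h set) \<Rightarrow> (nat \<Rightarrow> 'h set) \<Rightarrow> 'k"
  where "dual_pairing t X Y \<equiv> tensor_lift fun_scale fun_scale gr_dual gr_dual (\<lambda>\<phi> \<psi>. \<phi> X * \<psi> Y) t"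

lemma dual_pairing_tsum:
  assumes "set ps \<subseteq> gr_dual \<times> gr_dual"
  shows "dual_pairing (tsum fun_scale fun_scale ps) X Y = (\<Sum>(\<phi>, \<psi>)\<leftarrow>ps. \<phi> X * \<psi> Y)"
proof (rule tensor_lift_tsum[OF _ assms])
  show "bilin fun_scale fun_scale (*) (\<lambda>\<phi> \<psi>. \<phi> X * \<psi> Y)"
    by (intro bilinI fun_vs.vector_space_axioms vector_space_field) (auto simp: fun_scale_def algebra_simps)
qed simp

lemma subspace_gr_dual: "fun_vs.subspace gr_dual"
proof (rule fun_vs.subspaceI)
  show "0 \<in> gr_dual" by (simp add: gr_dual_def)
next
  fix f g assume fg: "f \<in> gr_dual" "g \<in> gr_dual"
  have "{m. \<exists>X\<in>gr_grade m. (f + g) X \<noteq> 0} \<subseteq> {m. \<exists>X\<in>gr_grade m. f X \<noteq> 0} \<union> {m. \<exists>X\<in>gr_grade m. g X \<noteq> 0}"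
    by auto
  moreover have "finite ({m. \<exists>X\<in>gr_grade m. f X \<noteq> 0} \<union> {m. \<exists>X\<in>gr_grade m. g X \<noteq> 0})"
    using fg by (simp add: gr_dual_def)
  ultimately have "finite {m. \<exists>X\<in>gr_grade m. (f + g) X \<noteq> 0}" by (rule finite_subset)
  then show "f + g \<in> gr_dual" using fg by (simp add: gr_dual_def algebra_simps)
next
  fix c :: 'k and f assume f: "f \<in> gr_dual"
  have "{m. \<exists>X\<in>gr_grade m. (fun_scale c f) X \<noteq> 0} \<subseteq> {m. \<exists>X\<in>gr_grade m. f X \<noteq> 0}"
    by (auto simp: fun_scale_def)
  moreover have "finite {m. \<exists>X\<in>gr_grade m. f X \<noteq> 0}" using f by (simp add: gr_dual_def)
  ultimately have "finite {m. \<exists>X\<in>gr_grade m. (fun_scale c f) X \<noteq> 0}" by (rule finite_subset)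
  then show "fun_scale c f \<in> gr_dual" using f by (simp add: gr_dual_def algebra_simps fun_scale_def)
qed

text \<open>
  Elements of \<open>gr_dual\<close> vanish outside \<open>gr\<close>, so tensors that pair equally with \<open>gr \<times> gr\<close> agree under all
  evaluations, which separate them.
\<close>

lemma dual_comult_unique:
  assumes t: "t \<in> tensor_space fun_scale fun_scale gr_dual gr_dual"
    and u: "u \<in> tensor_space fun_scale fun_scale gr_dual gr_dual"
    and eq: "\<And>X Y. X \<in> gr \<Longrightarrow> Y \<in> gr \<Longrightarrow> dual_pairing t X Y = dual_pairing u X Y"
  shows "t = u"
proof -
  obtain ps where ps: "t = tsum fun_scale fun_scale ps" "set ps \<subseteq> gr_dual \<times> gr_dual"
    using tensor_spaceE[OF fun_vs.vector_space_axioms fun_vs.vector_space_axioms subspace_gr_dual t] by metis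
  obtain qs where qs: "u = tsum fun_scale fun_scale qs" "set qs \<subseteq> gr_dual \<times> gr_dual"
    using tensor_spaceE[OF fun_vs.vector_space_axioms fun_vs.vector_space_axioms subspace_gr_dual u] by metis
  have zero: "(\<Sum>(\<phi>, \<psi>)\<leftarrow>rs. \<phi> X * \<psi> Y) = 0"
    if rs: "set rs \<subseteq> gr_dual \<times> gr_dual" and XY: "X \<notin> gr \<or> Y \<notin> gr"
    for X Y and rs :: "(((nat \<Rightarrow> 'h set) \<Rightarrow> 'k) \<times> ((nat \<Rightarrow> 'h set) \<Rightarrow> 'k)) list"
  proof -
    have "(\<Sum>(\<phi>, \<psi>)\<leftarrow>rs. \<phi> X * \<psi> Y) = (\<Sum>(\<phi>, \<psi>)\<leftarrow>rs. 0)"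
    proof (rule sum_list_pair_cong)
      fix \<phi> \<psi> assume "(\<phi>, \<psi>) \<in> set rs"
      then have "\<phi> \<in> gr_dual" "\<psi> \<in> gr_dual" using rs by auto
      then show "\<phi> X * \<psi> Y = 0" using XY by (auto simp: gr_dual_def)
    qed
    then show ?thesis by (simp add: split_def)
  qed
  show ?thesis
    unfolding ps(1) qs(1)
  proof (rule tensor_eqI_eval)
    fix X Y show "(\<Sum>(f, g)\<leftarrow>ps. f X * g Y) = (\<Sum>(f, g)\<leftarrow>qs. f X * g Y)"
    proof (cases "X \<in> gr \<and> Y \<in> gr")
      case True
      then show ?thesis using eq[of X Y] unfolding ps(1) qs(1) dual_pairing_tsum[OF ps(2)] dual_pairing_tsum[OF qs(2)] by simp
    next
      case False
      then show ?thesis using zero[OF ps(2), of X Y] zero[OF qs(2), of X Y] by simp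
    qed
  qed
qed

lemma dual_coords_mult:
  assumes F: "dual_coords f F" and x: "x \<in> families" "\<And>j. N < j \<Longrightarrow> x j = 0"
    and y: "y \<in> families" "\<And>j. M < j \<Longrightarrow> y j = 0"
  shows "f (gr_mult (cls x) (cls y)) = (\<Sum>i\<le>N. \<Sum>j\<le>M. F (i + j) (x i * y j))"
proof -
  note lin = dual_coords_functional[OF F]
  have "f (gr_mult (cls x) (cls y)) = (\<Sum>k\<le>N + M. F k (family_mult x y k))"
    unfolding gr_mult_cls[OF x(1) y(1)]
    by (rule dual_coords_cls[OF F family_mult_families[OF x(1) y(1)]]) (rule family_mult_bound[OF x(2) y(2)])
  also have "\<dots> = (\<Sum>k\<le>N + M. \<Sum>i\<le>k. F (i + (k - i)) (x i * y (k - i)))"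
    unfolding family_mult_def by (simp add: linearD(6)[OF lin])
  also have "\<dots> = (\<Sum>(i, j)\<in>{(i, j). i + j \<le> N + M}. F (i + j) (x i * y j))"
    by (rule sum.triangle_reindex_eq[symmetric])
  also have "\<dots> = (\<Sum>(i, j)\<in>{..N} \<times> {..M}. F (i + j) (x i * y j))"
  proof (rule sum.mono_neutral_right)
    have "{(i, j). i + j \<le> N + M} \<subseteq> {..N + M} \<times> {..N + M}" by auto
    then show "finite {(i, j). i + j \<le> N + M}" by (rule finite_subset) simp
    show "\<forall>p\<in>{(i, j). i + j \<le> N + M} - {..N} \<times> {..M}. (case p of (i, j) \<Rightarrow> F (i + j) (x i * y j)) = 0"
    proof (rule ballI)
      fix p assume p: "p \<in> {(i, j). i + j \<le> N + M} - {..N} \<times> {..M}"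
      obtain i j where ij: "p = (i, j)" by force
      then have "x i * y j = 0" using p x(2)[of i] y(2)[of j] by (auto simp: not_le)
      then show "(case p of (i, j) \<Rightarrow> F (i + j) (x i * y j)) = 0" using ij by (simp add: linearD(3)[OF lin])
    qed
  qed auto
  finally show ?thesis by (simp add: sum.cartesian_product)
qed

end

context locally_finite_hopf_algebra
begin

text \<open>
  With a homogeneous basis \<open>C\<close> adapted to the filtration, \<open>f (X Y)\<close> is the sum of \<open>c\<^sup>* (X) f (c Y)\<close> over
  \<open>c \<in> C\<close>. Since \<open>f\<close> vanishes in degrees above some \<open>N\<close>, only the finitely many \<open>c\<close> of degree at most
  \<open>N\<close> occur.
\<close>

lemma dual_comult_exists:
  assumes f: "f \<in> gr_dual"
  obtains ps where "set ps \<subseteq> gr_dual \<times> gr_dual"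
    "\<And>X Y. X \<in> gr \<Longrightarrow> Y \<in> gr \<Longrightarrow> (\<Sum>(\<phi>, \<psi>)\<leftarrow>ps. \<phi> X * \<psi> Y) = f (gr_mult X Y)"
proof -
  obtain F where F: "dual_coords f F" by (rule gr_dual_coords[OF f])
  note lin = dual_coords_functional[OF F]
  obtain N where N: "\<And>j m x. N < m \<Longrightarrow> x \<in> corad_filt j \<Longrightarrow> x \<in> H m \<Longrightarrow> F j x = 0"
    using gr_dual_bound[OF f F] by blast
  obtain C where C: "independent C" "span C = UNIV" "C \<subseteq> homogeneous"
      "\<And>k. corad_below k \<subseteq> span (C \<inter> corad_below k)"
    using adapted_basisE by metis
  have Cg: "c \<in> H (gdeg c)" if "c \<in> C" for c
    using C(3) that unfolding gdeg_def homogeneous_def by (auto intro: LeastI)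
  have Cf: "c \<in> corad_filt (fdeg c)" for c
    unfolding fdeg_def using corad_filt_exhaust[of c] by (auto intro: LeastI)
  have fdeg_le: "fdeg c \<le> i" if "c \<in> corad_filt i" for c i
    unfolding fdeg_def using that by (rule Least_le)
  have Cn: "c \<notin> corad_below (fdeg c)" if "c \<in> C" for c
  proof (cases "fdeg c")
    case 0
    have "c \<noteq> 0" using that C(1) dependent_zero by blast
    then show ?thesis using 0 by simp
  next
    case (Suc i)
    then show ?thesis using fdeg_le[of c i] by auto
  qed
  define CN where "CN = {c \<in> C. gdeg c \<le> N}"
  have finCN: "finite CN"
  proof -
    have "finite {c \<in> C. gdeg c = m}" for m
    proof -
      have "independent {c \<in> C. gdeg c = m}" using C(1) by (rule independent_mono) auto
      then show ?thesis using independent_H_bound[of m] Cg by auto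
    qed
    then have "finite (\<Union>m\<le>N. {c \<in> C. gdeg c = m})" by simp
    moreover have "CN = (\<Union>m\<le>N. {c \<in> C. gdeg c = m})" by (auto simp: CN_def)
    ultimately show ?thesis by simp
  qed
  \<comment> \<open>composition with the projection makes the coordinate functionals homogeneous\<close>
  define e where "e = (\<lambda>c v. representation C (hcomp (gdeg c) v) c)"
  have lin_e: "functional (e c)" for c
    unfolding e_def by (rule functional_hcomp) (rule linear_representation_UNIV[OF C(1,2)])
  have e_below: "e c v = 0" if "c \<in> C" "v \<in> corad_below (fdeg c)" for c v
    unfolding e_def using adapted_basis_dual[OF C(1,4) hcomp_corad_below[OF that(2)] Cn[OF that(1)]] .
  have e_C: "e c c0 = (if c = c0 then 1 else 0)" if "c \<in> C" "c0 \<in> C" for c c0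
    using that hcomp_H[OF Cg[OF that(2)], of "gdeg c"] C(1)
    by (auto simp: e_def representation_basis representation_zero)
  define \<phi> where "\<phi> = (\<lambda>c. gr_functional (fdeg c) (e c))"
  define \<psi> where "\<psi> = (\<lambda>c Y. if Y \<in> gr then f (gr_mult (cls (single (fdeg c) c)) Y) else 0)"
  have \<phi>_dual: "\<phi> c \<in> gr_dual" if "c \<in> C" for c
  proof -
    have "\<phi> c \<in> gr_dual_grade (gdeg c)"
      unfolding \<phi>_def
    proof (rule gr_functional_dual[OF lin_e])
      show "e c x = 0" if "x \<in> H i" "i \<noteq> gdeg c" for i x
        using that by (simp add: e_def hcomp_H representation_zero)
    qed (rule e_below[OF that])
    then show ?thesis by (simp add: gr_dual_grade_def)
  qed
  have \<psi>_cls: "\<psi> c (cls y) = (\<Sum>j\<le>M. F (fdeg c + j) (c * y j))"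
    if "y \<in> families" "\<forall>j>M. y j = 0" for c y M
  proof -
    have "\<psi> c (cls y) = (\<Sum>i\<le>fdeg c. \<Sum>j\<le>M. F (i + j) (single (fdeg c) c i * y j))"
      using cls_gr[OF that(1)] dual_coords_mult[OF F single_families[OF Cf] _ that(1), of "fdeg c" c M] that(2)
      by (simp add: \<psi>_def single_def)
    also have "\<dots> = (\<Sum>i\<le>fdeg c. if i = fdeg c then (\<Sum>j\<le>M. F (i + j) (c * y j)) else 0)"
      by (intro sum.cong) (auto simp: single_def linearD(3)[OF lin])
    finally show ?thesis by simp
  qed
  have \<psi>_dual: "\<psi> c \<in> gr_dual" if c: "c \<in> C" for c
  proof (rule gr_dualI[of _ "\<lambda>j y. F (fdeg c + j) (c * y)" N])
    show "dual_coords (\<psi> c) (\<lambda>j y. F (fdeg c + j) (c * y))"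
      unfolding dual_coords_def
    proof (intro conjI allI ballI impI)
      show "functional (\<lambda>y. F (fdeg c + j) (c * y))" for j
        by (intro functionalI) (auto simp: distrib_left scale_mult_right linearD[OF lin])
      show "F (fdeg c + j) (c * y) = 0" if "y \<in> corad_below j" for j y
        using dual_coords_below[OF F corad_below_mult_right[OF Cf that]] .
      show "\<psi> c (cls y) = (\<Sum>j\<le>M. F (fdeg c + j) (c * y j))" if "y \<in> families" "\<forall>j>M. y j = 0" for y M
        using that by (rule \<psi>_cls)
    qed
    show "F (fdeg c + j) (c * y) = 0" if "N < m" "y \<in> corad_filt j" "y \<in> H m" for j m y
      by (rule N[of "gdeg c + m"]) (use that corad_filt_mult[OF Cf that(2)] mult_H[OF Cg[OF c] that(3)] in auto)
  qed (simp add: \<psi>_def)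
  obtain cs where cs: "distinct cs" "set cs = CN" using finite_distinct_list[OF finCN] by blast
  let ?ps = "map (\<lambda>c. (\<phi> c, \<psi> c)) cs"
  have "set ?ps \<subseteq> gr_dual \<times> gr_dual" using cs(2) \<phi>_dual \<psi>_dual by (auto simp: CN_def)
  moreover have "(\<Sum>(\<phi>, \<psi>)\<leftarrow>?ps. \<phi> X * \<psi> Y) = f (gr_mult X Y)" if X: "X \<in> gr" and Y: "Y \<in> gr" for X Y
  proof -
    obtain x where x: "x \<in> families" "X = cls x" by (rule gr_cls[OF X])
    obtain y where y: "y \<in> families" "Y = cls y" by (rule gr_cls[OF Y])
    obtain L where L: "\<And>j. L < j \<Longrightarrow> x j = 0" using families_bound[OF x(1)] by metis
    obtain M where M: "\<And>j. M < j \<Longrightarrow> y j = 0" using families_bound[OF y(1)] by metis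
    \<comment> \<open>the expansion of \<open>u\<close> in the basis, where basis elements of lower filtration degree or of degree above \<open>N\<close> contribute zero\<close>
    have K: "F (i + j) (u * y j) = (\<Sum>c\<in>{c \<in> CN. fdeg c = i}. e c u * F (i + j) (c * y j))"
      if u: "u \<in> corad_filt i" for u i j
    proof -
      have "u \<in> span (C \<inter> corad_below (Suc i))" using C(4)[of "Suc i"] u by auto
      then show ?thesis
      proof (induction rule: span_induct_alt)
        case base
        show ?case by (simp add: linearD(3)[OF lin] linearD(3)[OF lin_e])
      next
        case (step a c0 u')
        then have c0: "c0 \<in> C" "c0 \<in> corad_filt i" by auto
        have "F (i + j) (c0 * y j) = (\<Sum>c\<in>{c \<in> CN. fdeg c = i}. e c c0 * F (i + j) (c * y j))"
        proof (cases "c0 \<in> CN \<and> fdeg c0 = i")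
          case True
          have "(\<Sum>c\<in>{c \<in> CN. fdeg c = i}. e c c0 * F (i + j) (c * y j)) =
              (\<Sum>c\<in>{c \<in> CN. fdeg c = i}. if c = c0 then F (i + j) (c0 * y j) else 0)"
            using e_C c0(1) by (intro sum.cong) (auto simp: CN_def)
          also have "\<dots> = F (i + j) (c0 * y j)" using True finCN by simp
          finally show ?thesis by simp
        next
          case False
          have "e c c0 * F (i + j) (c * y j) = 0" if "c \<in> {c \<in> CN. fdeg c = i}" for c
            using e_C[OF _ c0(1), of c] that False by (auto simp: CN_def)
          then have "(\<Sum>c\<in>{c \<in> CN. fdeg c = i}. e c c0 * F (i + j) (c * y j)) = 0" by (rule sum.neutral[OF ballI])
          moreover have "F (i + j) (c0 * y j) = 0"
          proof (cases "fdeg c0 = i")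
            case False
            then have "Suc (fdeg c0) \<le> i" using fdeg_le[OF c0(2)] by simp
            then have "c0 \<in> corad_below i" using corad_below_mono[of c0 "Suc (fdeg c0)" i] Cf[of c0] by simp
            then show ?thesis using dual_coords_below[OF F corad_below_mult_left[OF _ familiesD[OF y(1)]]] by blast
          next
            case True
            then have g: "N < gdeg c0" using False c0(1) by (simp add: CN_def)
            obtain Q where Q: "\<forall>q>Q. hcomp q (y j) = 0" using hcomp_bound by blast
            have "y j = (\<Sum>q\<le>Q. hcomp q (y j))" using Q by (intro hcomp_sum) auto
            then have "c0 * y j = (\<Sum>q\<le>Q. c0 * hcomp q (y j))" by (metis sum_distrib_left)
            then have "F (i + j) (c0 * y j) = (\<Sum>q\<le>Q. F (i + j) (c0 * hcomp q (y j)))"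
              by (simp add: linearD(6)[OF lin])
            also have "\<dots> = 0"
            proof (rule sum.neutral, rule ballI)
              fix q
              show "F (i + j) (c0 * hcomp q (y j)) = 0"
                by (rule N[of "gdeg c0 + q"])
                  (use g mult_H[OF Cg[OF c0(1)] hcomp_props(1)]
                    corad_filt_mult[OF c0(2) hcomp_corad_filt[OF familiesD[OF y(1)]]] in auto)
            qed
            finally show ?thesis .
          qed
          ultimately show ?thesis by simp
        qed
        then show ?case using step
          by (simp add: distrib_right scale_mult_left linearD[OF lin] linearD[OF lin_e] sum.distrib sum_distrib_left algebra_simps)
      qed
    qed
    define \<Psi> where "\<Psi> = (\<lambda>c. \<Sum>j\<le>M. F (fdeg c + j) (c * y j))"
    have "f (gr_mult X Y) = (\<Sum>i\<le>L. \<Sum>j\<le>M. F (i + j) (x i * y j))"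
      unfolding x(2) y(2) by (rule dual_coords_mult[OF F x(1) L y(1) M])
    also have "\<dots> = (\<Sum>i\<le>L. \<Sum>c\<in>{c \<in> CN. fdeg c = i}. e c (x (fdeg c)) * \<Psi> c)"
    proof (rule sum.cong[OF refl])
      fix i
      have "(\<Sum>j\<le>M. F (i + j) (x i * y j)) = (\<Sum>j\<le>M. \<Sum>c\<in>{c \<in> CN. fdeg c = i}. e c (x i) * F (i + j) (c * y j))"
        by (rule sum.cong[OF refl]) (rule K[OF familiesD[OF x(1)]])
      also have "\<dots> = (\<Sum>c\<in>{c \<in> CN. fdeg c = i}. \<Sum>j\<le>M. e c (x i) * F (i + j) (c * y j))"
        by (rule sum.swap)
      also have "\<dots> = (\<Sum>c\<in>{c \<in> CN. fdeg c = i}. e c (x (fdeg c)) * \<Psi> c)"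
        by (intro sum.cong) (auto simp: \<Psi>_def sum_distrib_left)
      finally show "(\<Sum>j\<le>M. F (i + j) (x i * y j)) = (\<Sum>c\<in>{c \<in> CN. fdeg c = i}. e c (x (fdeg c)) * \<Psi> c)" .
    qed
    also have "\<dots> = (\<Sum>i\<le>L. \<Sum>c\<in>{c \<in> {c \<in> CN. fdeg c \<le> L}. fdeg c = i}. e c (x (fdeg c)) * \<Psi> c)"
      by (intro sum.cong refl) auto
    also have "\<dots> = (\<Sum>c\<in>{c \<in> CN. fdeg c \<le> L}. e c (x (fdeg c)) * \<Psi> c)"
      using finCN by (intro sum.group) auto
    also have "\<dots> = (\<Sum>c\<in>CN. e c (x (fdeg c)) * \<Psi> c)"
      using finCN L by (intro sum.mono_neutral_left) (auto simp: linearD(3)[OF lin_e] not_le)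
    also have "\<dots> = (\<Sum>c\<in>CN. \<phi> c X * \<psi> c Y)"
    proof (rule sum.cong[OF refl])
      fix c assume "c \<in> CN"
      then have c: "c \<in> C" by (simp add: CN_def)
      have "\<phi> c X = e c (x (fdeg c))"
        unfolding \<phi>_def x(2) by (rule gr_functional_cls[OF lin_e e_below[OF c] x(1)])
      moreover have "\<psi> c Y = \<Psi> c" unfolding \<Psi>_def y(2) using y(1) M by (intro \<psi>_cls) auto
      ultimately show "e c (x (fdeg c)) * \<Psi> c = \<phi> c X * \<psi> c Y" by simp
    qed
    also have "\<dots> = (\<Sum>(\<phi>, \<psi>)\<leftarrow>?ps. \<phi> X * \<psi> Y)"
      using cs by (simp add: o_def sum_list_distinct_conv_sum_set)
    finally show ?thesis by simp
  qed
  ultimately show ?thesis using that by blast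
qed

text \<open>
  Existence and uniqueness of the coproduct turn the description of \<open>dual_comult\<close> as \<open>THE\<close> into
  an equation between pairings.
\<close>

lemma primitives_iff:
  assumes f: "f \<in> gr_dual"
  shows "f \<in> primitives \<longleftrightarrow>
    (\<forall>X\<in>gr. \<forall>Y\<in>gr. f (gr_mult X Y) = dual_one X * f Y + f X * dual_one Y)"
proof -
  let ?T = "tensor_space fun_scale fun_scale gr_dual gr_dual"
  let ?P = "\<lambda>t. t \<in> ?T \<and> (\<forall>X\<in>gr. \<forall>Y\<in>gr. dual_pairing t X Y = f (gr_mult X Y))"
  let ?ps = "[(dual_one, f), (f, dual_one)]"
  let ?t = "pure_tensor fun_scale fun_scale dual_one f + pure_tensor fun_scale fun_scale f dual_one"
  have sub: "set ?ps \<subseteq> gr_dual \<times> gr_dual" using f dual_one_in by simp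
  have t: "?t = tsum fun_scale fun_scale ?ps" by simp
  have tT: "?t \<in> ?T" unfolding t by (rule tsum_in_tensor_space[OF sub])
  have tp: "dual_pairing ?t X Y = dual_one X * f Y + f X * dual_one Y" for X Y
    unfolding t dual_pairing_tsum[OF sub] by simp
  obtain qs where qs: "set qs \<subseteq> gr_dual \<times> gr_dual"
    "\<And>X Y. X \<in> gr \<Longrightarrow> Y \<in> gr \<Longrightarrow> (\<Sum>(\<phi>, \<psi>)\<leftarrow>qs. \<phi> X * \<psi> Y) = f (gr_mult X Y)"
    using dual_comult_exists[OF f] by blast
  let ?q = "tsum fun_scale fun_scale qs"
  have q: "?P ?q" using tsum_in_tensor_space[OF qs(1)] qs(2) dual_pairing_tsum[OF qs(1)] by auto
  have uniq: "u = ?q" if "?P u" for u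
    by (rule dual_comult_unique) (use that q in auto)
  have dc: "dual_comult f = ?q" unfolding dual_comult_def using q uniq by (rule the_equality)
  have "f \<in> primitives \<longleftrightarrow> ?q = ?t" using f dc by (simp add: primitives_def)
  also have "\<dots> \<longleftrightarrow> ?P ?t" using q uniq[of ?t] by metis
  also have "\<dots> \<longleftrightarrow> (\<forall>X\<in>gr. \<forall>Y\<in>gr. f (gr_mult X Y) = dual_one X * f Y + f X * dual_one Y)"
    unfolding tp using tT by auto
  finally show ?thesis .
qed

lemma primitive_decomposables:
  assumes f: "f \<in> primitives" and F: "dual_coords f F" and x: "x \<in> decomposables j"
  shows "F j x = 0"
proof -
  note lin = dual_coords_functional[OF F]
  have fd: "f \<in> gr_dual" using f by (simp add: primitives_def)
  have prod: "F (a + b) (x * y) = 0" if x: "x \<in> corad_filt a" and y: "y \<in> corad_filt b" and ab: "0 < a" "0 < b" for x y a b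
  proof -
    let ?X = "cls (single a x)" and ?Y = "cls (single b y)"
    have XY: "?X \<in> gr" "?Y \<in> gr" using x y by (auto intro: cls_gr single_families)
    have "dual_one ?X = 0" "dual_one ?Y = 0"
      using XY ab by (simp_all add: dual_one_def gr_counit_cls single_def linearD(3)[OF functional_counit])
    then have "f (gr_mult ?X ?Y) = 0" using f XY primitives_iff[OF fd] by simp
    moreover have "f (gr_mult ?X ?Y) = (\<Sum>i\<le>a. \<Sum>k\<le>b. F (i + k) (single a x i * single b y k))"
      by (rule dual_coords_mult[OF F]) (use x y in \<open>auto intro: single_families simp: single_def\<close>)
    moreover have "\<dots> = (\<Sum>i\<le>a. \<Sum>k\<le>b. if i = a \<and> k = b then F (a + b) (x * y) else 0)"
      by (intro sum.cong refl) (auto simp: single_def linearD(3)[OF lin])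
    moreover have "\<dots> = (\<Sum>i\<le>a. if i = a then (\<Sum>k\<le>b. if k = b then F (a + b) (x * y) else 0) else 0)"
      by (intro sum.cong refl) auto
    ultimately show ?thesis by simp
  qed
  show ?thesis
    using x unfolding decomposables_def
  proof (induction rule: span_induct_alt)
    case base
    show ?case by (simp add: linearD(3)[OF lin])
  next
    case (step c x y)
    then have "F j x = 0" using dual_coords_below[OF F] prod by auto
    then show ?case using step by (simp add: linearD[OF lin])
  qed
qed

section \<open>Dimensions of the primitive components\<close>

definition gen_functional :: "'h \<Rightarrow> 'h \<Rightarrow> 'k"
  where "gen_functional v = (SOME f. functional f \<and> f v = 1 \<and> (\<forall>y\<in>decomposables (fdeg v). f y = 0) \<and>
    (\<forall>w\<in>gens_at (fdeg v). w \<noteq> v \<longrightarrow> f w = 0) \<and> (\<forall>m x. x \<in> H m \<longrightarrow> m \<noteq> gdeg v \<longrightarrow> f x = 0))"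

lemma gen_functional:
  assumes "v \<in> gens"
  shows "functional (gen_functional v)" "gen_functional v v = 1"
    "\<And>y. y \<in> decomposables (fdeg v) \<Longrightarrow> gen_functional v y = 0"
    "\<And>w. w \<in> gens_at (fdeg v) \<Longrightarrow> w \<noteq> v \<Longrightarrow> gen_functional v w = 0"
    "\<And>m x. x \<in> H m \<Longrightarrow> m \<noteq> gdeg v \<Longrightarrow> gen_functional v x = 0"
    "\<And>y. y \<in> corad_below (fdeg v) \<Longrightarrow> gen_functional v y = 0"
proof -
  let ?P = "\<lambda>f. functional f \<and> f v = 1 \<and> (\<forall>y\<in>decomposables (fdeg v). f y = 0) \<and>
    (\<forall>w\<in>gens_at (fdeg v). w \<noteq> v \<longrightarrow> f w = 0) \<and> (\<forall>m x. x \<in> H m \<longrightarrow> m \<noteq> gdeg v \<longrightarrow> f x = 0)"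
  have "\<exists>f. ?P f" by (rule gens_functionalE[OF assms]) blast
  then have *: "?P (gen_functional v)" unfolding gen_functional_def by (rule someI_ex)
  then show "functional (gen_functional v)" "gen_functional v v = 1"
    "\<And>y. y \<in> decomposables (fdeg v) \<Longrightarrow> gen_functional v y = 0"
    "\<And>w. w \<in> gens_at (fdeg v) \<Longrightarrow> w \<noteq> v \<Longrightarrow> gen_functional v w = 0"
    "\<And>m x. x \<in> H m \<Longrightarrow> m \<noteq> gdeg v \<Longrightarrow> gen_functional v x = 0"
    "\<And>y. y \<in> corad_below (fdeg v) \<Longrightarrow> gen_functional v y = 0"
    using corad_below_decomposables by blast+
qed

definition prim_of :: "'h \<Rightarrow> (nat \<Rightarrow> 'h set) \<Rightarrow> 'k"
  where "prim_of v = gr_functional (fdeg v) (gen_functional v)"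

lemma prim_of_cls: "v \<in> gens \<Longrightarrow> x \<in> families \<Longrightarrow> prim_of v (cls x) = gen_functional v (x (fdeg v))"
  unfolding prim_of_def by (rule gr_functional_cls) (auto simp: gen_functional)

lemma prim_of_grade: "v \<in> gens \<Longrightarrow> prim_of v \<in> gr_dual_grade (gdeg v)"
  unfolding prim_of_def by (rule gr_functional_dual) (auto simp: gen_functional)

text \<open>
  In the degree of \<open>v\<close>, a product in \<open>gr H\<close> consists of the two terms with a factor of degree zero, which
  give the primitivity relation, and of decomposables, which are killed.
\<close>

lemma prim_of_primitive:
  assumes v: "v \<in> gens" shows "prim_of v \<in> primitives"
proof -
  note h = gen_functional[OF v]
  let ?d = "fdeg v"
  have d: "prim_of v \<in> gr_dual" using prim_of_grade[OF v] by (simp add: gr_dual_grade_def)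
  have "prim_of v (gr_mult X Y) = dual_one X * prim_of v Y + prim_of v X * dual_one Y"
    if X: "X \<in> gr" and Y: "Y \<in> gr" for X Y
  proof -
    obtain x where x: "x \<in> families" "X = cls x" by (rule gr_cls[OF X])
    obtain y where y: "y \<in> families" "Y = cls y" by (rule gr_cls[OF Y])
    have x0: "x 0 = \<epsilon> (x 0) *s 1" and y0: "y 0 = \<epsilon> (y 0) *s 1"
      using corad_filt_0D familiesD[OF x(1), of 0] familiesD[OF y(1), of 0] by auto
    have "prim_of v (gr_mult X Y) = gen_functional v (family_mult x y ?d)"
      unfolding x(2) y(2) gr_mult_cls[OF x(1) y(1)] by (rule prim_of_cls[OF v family_mult_families[OF x(1) y(1)]])
    also have "\<dots> = (\<Sum>i\<le>?d. gen_functional v (x i * y (?d - i)))"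
      unfolding family_mult_def by (rule linearD(6)[OF h(1)])
    also have "\<dots> = (\<Sum>i\<in>{0, ?d}. gen_functional v (x i * y (?d - i)))"
    proof (rule sum.mono_neutral_right)
      show "\<forall>i\<in>{..?d} - {0, ?d}. gen_functional v (x i * y (?d - i)) = 0"
      proof
        fix i assume "i \<in> {..?d} - {0, ?d}"
        then have "0 < i" "i < ?d" by auto
        then have "x i * y (?d - i) \<in> decomposables (i + (?d - i))"
          by (intro mult_decomposables familiesD[OF x(1)] familiesD[OF y(1)]) auto
        then show "gen_functional v (x i * y (?d - i)) = 0" using h(3) \<open>i < ?d\<close> by simp
      qed
    qed auto
    also have "\<dots> = gen_functional v (x 0 * y ?d) + gen_functional v (x ?d * y 0)"
      using gensD(1)[OF v] by simp
    also have "x 0 * y ?d = \<epsilon> (x 0) *s y ?d" by (subst x0) (simp add: scale_mult_left)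
    also have "x ?d * y 0 = \<epsilon> (y 0) *s x ?d" by (subst y0) (simp add: scale_mult_right)
    finally show ?thesis
      using X Y x y prim_of_cls[OF v x(1)] prim_of_cls[OF v y(1)]
      by (simp add: dual_one_def gr_counit_cls linearD[OF h(1)] mult.commute)
  qed
  then show ?thesis using primitives_iff[OF d] by simp
qed

lemma finite_gens_grade: "finite {v \<in> gens. gdeg v = i}"
proof -
  have "(\<lambda>v. {#v#}) ` {v \<in> gens. gdeg v = i} \<subseteq> monomials i" by (auto simp: monomials_def)
  then have "finite ((\<lambda>v. {#v#}) ` {v \<in> gens. gdeg v = i})" using finite_monomials finite_subset by blast
  then show ?thesis by (rule finite_imageD) (auto intro: inj_onI)
qed

lemma prim_of_gens:
  assumes v: "v \<in> gens" and w: "w \<in> gens"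
  shows "prim_of v (cls (single (fdeg w) w)) = (if v = w then 1 else 0)"
proof -
  have "prim_of v (cls (single (fdeg w) w)) = gen_functional v (if fdeg v = fdeg w then w else 0)"
    using prim_of_cls[OF v single_families[OF gensD(3)[OF w]]] by (simp add: single_def)
  then show ?thesis
    using gen_functional(2,4)[OF v] linearD(3)[OF gen_functional(1)[OF v]] gensD(2)[OF w] by auto
qed

lemma apply_fun_sum: "(\<Sum>i\<in>I. f i) X = (\<Sum>i\<in>I. f i X)"
  by (induction I rule: infinite_finite_induct) auto

text \<open>
  The functionals dual to the generators of degree \<open>i\<close> form a basis of the primitives of degree
  \<open>i\<close>: a primitive functional kills decomposables, so it is determined by its values on generators.
\<close>

theorem prim_dim_eq:
  assumes i: "0 < i"
  shows "prim_dim i = card {v \<in> gens. gdeg v = i}"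
proof -
  let ?G = "{v \<in> gens. gdeg v = i}"
  let ?V = "primitives \<inter> gr_dual_grade i"
  let ?s = "\<lambda>v. cls (single (fdeg v) v)"
  note fin = finite_gens_grade[of i]
  have inj: "inj_on prim_of ?G"
  proof (rule inj_onI)
    fix v w assume "v \<in> ?G" "w \<in> ?G" "prim_of v = prim_of w"
    then show "v = w" using prim_of_gens[of v w] prim_of_gens[of w w] by (auto split: if_splits)
  qed
  have ind: "fun_vs.independent (prim_of ` ?G)"
  proof (rule fun_vs.independent_if_scalars_zero)
    show "finite (prim_of ` ?G)" using fin by simp
    fix u p assume u: "(\<Sum>p\<in>prim_of ` ?G. fun_scale (u p) p) = 0" and "p \<in> prim_of ` ?G"
    then obtain w where w: "w \<in> ?G" "p = prim_of w" by blast
    have "0 = (\<Sum>v\<in>?G. fun_scale (u (prim_of v)) (prim_of v)) (?s w)"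
      using u inj by (simp add: sum.reindex)
    also have "\<dots> = (\<Sum>v\<in>?G. u (prim_of v) * prim_of v (?s w))" by (simp add: apply_fun_sum fun_scale_def)
    also have "\<dots> = (\<Sum>v\<in>?G. if v = w then u p else 0)"
      using w by (intro sum.cong) (auto simp: prim_of_gens)
    also have "\<dots> = u p" using w fin by simp
    finally show "u p = 0" by simp
  qed
  have sub: "prim_of ` ?G \<subseteq> ?V" using prim_of_primitive prim_of_grade by auto
  have span: "?V \<subseteq> fun_vs.span (prim_of ` ?G)"
  proof
    fix f assume "f \<in> ?V"
    then have fp: "f \<in> primitives" and fg: "f \<in> gr_dual_grade i" and fd: "f \<in> gr_dual"
      by (auto simp: gr_dual_grade_def)
    obtain F where F: "dual_coords f F" by (rule gr_dual_coords[OF fd])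
    note lin = dual_coords_functional[OF F]
    have Fgrade: "F j x = 0" if "x \<in> corad_filt j" "x \<in> H m" "m \<noteq> i" for j x m
    proof -
      have "cls (single j x) \<in> gr_grade m"
        using single_families[OF that(1)] by (rule gr_gradeI) (auto simp: single_def that(2) subspace_0[OF subspace_H])
      then have "f (cls (single j x)) = 0" using fg that(3) by (auto simp: gr_dual_grade_def)
      then show ?thesis using dual_coords_single[OF F that(1)] by simp
    qed
    let ?Gj = "\<lambda>j. {v \<in> ?G. fdeg v = j}"
    have Fj: "F j x = (\<Sum>v\<in>?Gj j. F j v * gen_functional v x)" if x: "x \<in> corad_filt j" for j x
    proof (cases "j = 0")
      case True
      have "F 0 1 = 0" using Fgrade[OF one_corad_filt one_H, of 0] i by simp
      moreover have "x = \<epsilon> x *s 1" using x True corad_filt_0D by simp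
      ultimately have "F 0 x = 0" using linearD(2)[OF lin] by (metis mult_zero_right)
      moreover have "?Gj j = {}" using True gensD(1) by fastforce
      ultimately show ?thesis using True by (simp only: sum.empty)
    next
      case False
      have "x \<in> span (decomposables j \<union> gens_at j)" using x corad_filt_gens by blast
      then show ?thesis
      proof (induction rule: span_induct_alt)
        case base
        have "gen_functional v 0 = 0" if "v \<in> ?Gj j" for v
          using that linearD(3)[OF gen_functional(1)] by blast
        then show ?case by (simp add: linearD(3)[OF lin])
      next
        case (step c z y)
        have "F j z = (\<Sum>v\<in>?Gj j. F j v * gen_functional v z)"
        proof (cases "z \<in> decomposables j")
          case True
          then show ?thesis using primitive_decomposables[OF fp F] gen_functional(3) by simp
        next
          case z: False
          then have za: "z \<in> gens_at j" using step by blast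
          then have zg: "z \<in> gens" "fdeg z = j" using False by (auto intro: in_gens fdeg_gens_at)
          have "(\<Sum>v\<in>?Gj j. F j v * gen_functional v z) = (\<Sum>v\<in>?Gj j. if v = z then F j z else 0)"
            using gen_functional(2,4) za by (intro sum.cong) auto
          also have "\<dots> = (if z \<in> ?Gj j then F j z else 0)"
            by (rule sum.delta) (rule finite_subset[OF _ fin], blast)
          also have "\<dots> = F j z"
            using zg gensD(3,4)[OF zg(1)] Fgrade[of z j "gdeg z"] by auto
          finally show ?thesis by simp
        qed
        moreover have "gen_functional v (c *s z + y) = c * gen_functional v z + gen_functional v y" if "v \<in> ?Gj j" for v
          using that by (simp add: linearD(1,2)[OF gen_functional(1)])
        ultimately show ?case using step
          by (simp add: linearD[OF lin] sum.distrib sum_distrib_left algebra_simps)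
      qed
    qed
    have "f = (\<Sum>v\<in>?G. fun_scale (F (fdeg v) v) (prim_of v))"
    proof
      fix X
      show "f X = (\<Sum>v\<in>?G. fun_scale (F (fdeg v) v) (prim_of v)) X"
      proof (cases "X \<in> gr")
        case False
        then show ?thesis using fd by (simp add: gr_dual_def apply_fun_sum fun_scale_def prim_of_def gr_functional_def)
      next
        case True
        then obtain x where x: "x \<in> families" "X = cls x" by (rule gr_cls)
        obtain M where M: "\<And>j. M < j \<Longrightarrow> x j = 0" using families_bound[OF x(1)] by metis
        have "f X = (\<Sum>j\<le>M. F j (x j))"
          unfolding x(2) by (rule dual_coords_cls[OF F x(1)]) (rule M)
        also have "\<dots> = (\<Sum>j\<le>M. \<Sum>v\<in>?Gj j. F (fdeg v) v * gen_functional v (x (fdeg v)))"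
          by (intro sum.cong refl) (simp add: Fj[OF familiesD[OF x(1)]])
        also have "\<dots> = (\<Sum>j\<le>M. \<Sum>v\<in>{v \<in> {v \<in> ?G. fdeg v \<le> M}. fdeg v = j}. F (fdeg v) v * gen_functional v (x (fdeg v)))"
          by (intro sum.cong refl) auto
        also have "\<dots> = (\<Sum>v\<in>{v \<in> ?G. fdeg v \<le> M}. F (fdeg v) v * gen_functional v (x (fdeg v)))"
          by (rule sum.group) (rule finite_subset[OF _ fin], auto)
        also have "\<dots> = (\<Sum>v\<in>?G. F (fdeg v) v * gen_functional v (x (fdeg v)))"
          using fin M by (intro sum.mono_neutral_left) (auto simp: linearD(3)[OF gen_functional(1)] not_le)
        also have "\<dots> = (\<Sum>v\<in>?G. F (fdeg v) v * prim_of v X)"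
          unfolding x(2) by (intro sum.cong refl) (simp add: prim_of_cls[OF _ x(1)])
        finally show ?thesis by (simp add: apply_fun_sum fun_scale_def)
      qed
    qed
    then show "f \<in> fun_vs.span (prim_of ` ?G)"
      by (metis (no_types, lifting) fun_vs.span_base fun_vs.span_scale fun_vs.span_sum imageI)
  qed
  have "card (prim_of ` ?G) = fun_vs.dim ?V"
    using sub span ind by (rule fun_vs.basis_card_eq_dim)
  then show ?thesis unfolding prim_dim_def using inj by (simp add: card_image)
qed

end

section \<open>Counting multisets by their weights\<close>

lemma image_mset_sum_hom: "image_mset w (\<Sum>i\<in>I. N i) = (\<Sum>i\<in>I. image_mset w (N i))"
  by (induction I rule: infinite_finite_induct) auto

lemma image_filter_mset_const:
  "image_mset w {#v \<in># M. w v = i#} = replicate_mset (count (image_mset w M) i) i"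
  by (induction M) auto

text \<open>
  A multiset with prescribed weights is the same as an independent choice, for each weight \<open>i\<close>, of a
  multiset of \<open>count \<pi> i\<close> elements of weight \<open>i\<close>.
\<close>

lemma card_multisets_over:
  fixes w :: "'a \<Rightarrow> nat"
  assumes fin: "\<And>i. i \<in># \<pi> \<Longrightarrow> finite {v \<in> X. w v = i}"
  shows "card {M. set_mset M \<subseteq> X \<and> image_mset w M = \<pi>} =
    (\<Prod>i\<in>set_mset \<pi>. (card {v \<in> X. w v = i} + count \<pi> i - 1) choose count \<pi> i)"
proof -
  let ?A = "{M. set_mset M \<subseteq> X \<and> image_mset w M = \<pi>}"
  let ?B = "\<lambda>i. multisets_of_size {v \<in> X. w v = i} (count \<pi> i)"
  let ?f = "\<lambda>M. \<lambda>i\<in>set_mset \<pi>. {#v \<in># M. w v = i#}"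
  let ?g = "\<lambda>N. \<Sum>i\<in>set_mset \<pi>. N i"
  have "bij_betw ?f ?A (\<Pi>\<^sub>E i\<in>set_mset \<pi>. ?B i)"
  proof (rule bij_betw_byWitness[where f' = ?g])
    show "\<forall>M\<in>?A. ?g (?f M) = M"
    proof
      fix M assume M: "M \<in> ?A"
      have "count (?g (?f M)) v = count M v" for v
      proof -
        have "count (?g (?f M)) v = (\<Sum>i\<in>set_mset \<pi>. if i = w v then count M v else 0)"
          by (auto simp: count_sum intro!: sum.cong)
        also have "\<dots> = count M v"
        proof (cases "v \<in># M")
          case True
          then have "w v \<in># \<pi>" using M by auto
          then show ?thesis by simp
        next
          case False
          then have "count M v = 0" by (simp add: not_in_iff)
          then show ?thesis by simp
        qed
        finally show ?thesis .
      qed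
      then show "?g (?f M) = M" by (rule multiset_eqI)
    qed
    show "\<forall>N\<in>(\<Pi>\<^sub>E i\<in>set_mset \<pi>. ?B i). ?f (?g N) = N"
    proof
      fix N assume N: "N \<in> (\<Pi>\<^sub>E i\<in>set_mset \<pi>. ?B i)"
      show "?f (?g N) = N"
      proof
        fix i
        show "?f (?g N) i = N i"
        proof (cases "i \<in># \<pi>")
          case True
          have "count {#v \<in># ?g N. w v = i#} v = count (N i) v" for v
          proof (cases "w v = i")
            case wi: True
            have "(\<Sum>k\<in>set_mset \<pi>. count (N k) v) = (\<Sum>k\<in>set_mset \<pi>. if k = i then count (N i) v else 0)"
            proof (rule sum.cong[OF refl])
              fix k assume "k \<in># \<pi>"
              then have "set_mset (N k) \<subseteq> {v \<in> X. w v = k}" using N by (auto simp: PiE_def Pi_def multisets_of_size_def)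
              then have "count (N k) v = 0" if "k \<noteq> i" using that wi by (auto simp: not_in_iff[symmetric])
              then show "count (N k) v = (if k = i then count (N i) v else 0)" by auto
            qed
            then show ?thesis using True wi by (simp add: count_sum)
          next
            case False
            have "set_mset (N i) \<subseteq> {v \<in> X. w v = i}" using N True by (auto simp: PiE_def Pi_def multisets_of_size_def)
            then have "v \<notin># N i" using False by auto
            then show ?thesis using False by (simp add: not_in_iff)
          qed
          then have "{#v \<in># ?g N. w v = i#} = N i" by (rule multiset_eqI)
          then show ?thesis using True by simp
        next
          case False
          then show ?thesis using PiE_arb[OF N False] by simp
        qed
      qed
    qed
    show "?f ` ?A \<subseteq> (\<Pi>\<^sub>E i\<in>set_mset \<pi>. ?B i)"
    proof
      fix N assume "N \<in> ?f ` ?A"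
      then obtain M where M: "set_mset M \<subseteq> X" "image_mset w M = \<pi>" "N = ?f M" by blast
      have "size {#v \<in># M. w v = i#} = count \<pi> i" for i
        using arg_cong[OF image_filter_mset_const[of w i M], of size] M(2) by simp
      then show "N \<in> (\<Pi>\<^sub>E i\<in>set_mset \<pi>. ?B i)" using M(1,3) by (auto simp: multisets_of_size_def)
    qed
    show "?g ` (\<Pi>\<^sub>E i\<in>set_mset \<pi>. ?B i) \<subseteq> ?A"
    proof
      fix M assume "M \<in> ?g ` (\<Pi>\<^sub>E i\<in>set_mset \<pi>. ?B i)"
      then obtain N where N: "N \<in> (\<Pi>\<^sub>E i\<in>set_mset \<pi>. ?B i)" "M = ?g N" by blast
      have Ni: "set_mset (N i) \<subseteq> {v \<in> X. w v = i} \<and> size (N i) = count \<pi> i" if "i \<in># \<pi>" for i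
        using N(1) that by (auto simp: PiE_def Pi_def multisets_of_size_def)
      have "set_mset M \<subseteq> X" using Ni unfolding N(2) by (auto simp: set_mset_sum)
      moreover have "image_mset w M = \<pi>"
      proof -
        have "image_mset w (N i) = replicate_mset (count \<pi> i) i" if i: "i \<in># \<pi>" for i
        proof -
          have "image_mset w (N i) = image_mset (\<lambda>_. i) (N i)"
            using Ni[OF i] by (intro image_mset_cong) auto
          then show ?thesis using Ni[OF i] by (simp add: image_mset_const_eq)
        qed
        then have "image_mset w M = (\<Sum>i\<in>set_mset \<pi>. replicate_mset (count \<pi> i) i)"
          unfolding N(2) using image_mset_sum_hom[of w N "set_mset \<pi>"] by simp
        also have "\<dots> = \<pi>"
        proof (rule multiset_eqI)
          fix k
          have "count (\<Sum>i\<in>set_mset \<pi>. replicate_mset (count \<pi> i) i) k = (\<Sum>i\<in>set_mset \<pi>. if i = k then count \<pi> k else 0)"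
            by (auto simp: count_sum intro!: sum.cong)
          also have "\<dots> = count \<pi> k" by (auto simp: not_in_iff)
          finally show "count (\<Sum>i\<in>set_mset \<pi>. replicate_mset (count \<pi> i) i) k = count \<pi> k" .
        qed
        finally show ?thesis .
      qed
      ultimately show "M \<in> ?A" by simp
    qed
  qed
  then have "card ?A = card (\<Pi>\<^sub>E i\<in>set_mset \<pi>. ?B i)" by (rule bij_betw_same_card)
  also have "\<dots> = (\<Prod>i\<in>set_mset \<pi>. card (?B i))" by (simp add: card_PiE)
  also have "\<dots> = (\<Prod>i\<in>set_mset \<pi>. (card {v \<in> X. w v = i} + count \<pi> i - 1) choose count \<pi> i)"
    using fin by (intro prod.cong refl card_multisets_of_size)
  finally show ?thesis .
qed

lemma size_le_sum_mset: "0 \<notin># \<pi> \<Longrightarrow> size \<pi> \<le> \<Sum>\<^sub># (\<pi> :: nat multiset)"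
  by (induction \<pi>) auto

lemma finite_partitions: "finite {\<pi> :: nat multiset. 0 \<notin># \<pi> \<and> \<Sum>\<^sub># \<pi> = m \<and> size \<pi> = k}"
proof (rule finite_subset)
  show "{\<pi> :: nat multiset. 0 \<notin># \<pi> \<and> \<Sum>\<^sub># \<pi> = m \<and> size \<pi> = k} \<subseteq> multisets_of_size {..m} k"
    by (auto simp: multisets_of_size_def dest: multi_member_split)
  show "finite (multisets_of_size {..m} k)" by (rule finite_multisets_of_size) simp
qed

context locally_finite_hopf_algebra
begin

lemma card_monomials: "card {M \<in> monomials m. size M = k} = mul k m"
proof -
  let ?\<Pi> = "{\<pi> :: nat multiset. 0 \<notin># \<pi> \<and> \<Sum>\<^sub># \<pi> = m \<and> size \<pi> = k}"
  let ?S = "{M \<in> monomials m. size M = k}"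
  have finS: "finite ?S" using finite_monomials by simp
  have "card ?S = (\<Sum>\<pi>\<in>?\<Pi>. card {M \<in> ?S. image_mset gdeg M = \<pi>})"
  proof -
    have "image_mset gdeg ` ?S \<subseteq> ?\<Pi>"
      using gensD(6) by (fastforce simp: monomials_def mgdeg_def)
    from sum.group[OF finS finite_partitions this, of "\<lambda>_. 1 :: nat"] show ?thesis by simp
  qed
  also have "\<dots> = (\<Sum>\<pi>\<in>?\<Pi>. partition_binomial \<pi>)"
  proof (rule sum.cong[OF refl])
    fix \<pi> assume \<pi>: "\<pi> \<in> ?\<Pi>"
    have "{M \<in> ?S. image_mset gdeg M = \<pi>} = {M. set_mset M \<subseteq> gens \<and> image_mset gdeg M = \<pi>}"
      using \<pi> by (auto simp: monomials_def mgdeg_def)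
    then have "card {M \<in> ?S. image_mset gdeg M = \<pi>} =
        (\<Prod>i\<in>set_mset \<pi>. (card {v \<in> gens. gdeg v = i} + count \<pi> i - 1) choose count \<pi> i)"
      using card_multisets_over[OF finite_gens_grade] by simp
    also have "\<dots> = partition_binomial \<pi>"
      unfolding partition_binomial_def
    proof (rule prod.cong[OF refl])
      fix i assume "i \<in># \<pi>"
      then have "0 < i" using \<pi> by (cases i) auto
      then show "((card {v \<in> gens. gdeg v = i} + count \<pi> i - 1) choose count \<pi> i) =
          ((prim_dim i + count \<pi> i - 1) choose count \<pi> i)" by (simp add: prim_dim_eq)
    qed
    finally show "card {M \<in> ?S. image_mset gdeg M = \<pi>} = partition_binomial \<pi>" .
  qed
  finally show ?thesis by (simp add: mul_def)
qed

lemma mul_eq_0: "m < k \<Longrightarrow> mul k m = 0"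
proof -
  assume "m < k"
  then have "{\<pi> :: nat multiset. 0 \<notin># \<pi> \<and> \<Sum>\<^sub># \<pi> = m \<and> size \<pi> = k} = {}"
    using size_le_sum_mset by fastforce
  then show ?thesis by (simp only: mul_def sum.empty)
qed

lemma size_monomials: "M \<in> monomials m \<Longrightarrow> size M \<le> m"
proof -
  assume M: "M \<in> monomials m"
  have "0 \<notin># image_mset gdeg M" using M gensD(6) by (fastforce simp: monomials_def)
  then have "size (image_mset gdeg M) \<le> \<Sum>\<^sub># (image_mset gdeg M)" by (rule size_le_sum_mset)
  then show ?thesis using M by (simp add: monomials_def mgdeg_def)
qed

lemma trace_ipower_mul:
  "trace_on (H m) (ipower n) = (\<Sum>k=0..m. of_nat n ^ k * of_nat (mul k m))"
proof -
  have "(\<Sum>M\<in>monomials m. of_nat n ^ size M) =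
      (\<Sum>k\<in>{0..m}. \<Sum>M\<in>{M \<in> monomials m. size M = k}. of_nat n ^ size M :: 'k)"
    by (rule sum.group[symmetric]) (auto simp: finite_monomials size_monomials)
  also have "\<dots> = (\<Sum>k=0..m. of_nat n ^ k * of_nat (mul k m))"
    by (intro sum.cong refl) (simp add: card_monomials[symmetric] mult.commute)
  finally show ?thesis by (simp add: trace_ipower)
qed

section \<open>Dependence on the Adams parameter\<close>

definition augm :: "'h \<Rightarrow> 'h"
  where "augm y = y - conv_unit y"

lemma endo_augm: "endo augm"
  unfolding augm_def using endo_conv_unit by (intro endoI) (auto simp: linearD algebra_simps)

lemma augm_corad_filt_0: "x \<in> corad_filt 0 \<Longrightarrow> augm x = 0"
  using corad_filt_0D[of x] by (simp add: augm_def conv_unit_def)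

text \<open>
  Each convolution factor kills scalars, so it uses up one step of the filtration.
\<close>

lemma augm_power_vanish: "x \<in> corad_below k \<Longrightarrow> conv_power augm k x = 0"
proof (induction k arbitrary: x)
  case 0
  then show ?case by (simp add: conv_unit_def linearD(3)[OF functional_counit])
next
  case (Suc k)
  then have "x \<in> corad_filt k" by simp
  then obtain ps where ps: "\<Delta> x = tens ps"
    "\<And>u w. (u, w) \<in> set ps \<Longrightarrow> \<exists>i\<le>k. u \<in> corad_filt i \<and> w \<in> corad_filt (k - i)"
    using filtered_sweedlerE by metis
  have "conv_power augm (Suc k) x = (\<Sum>(u, w)\<leftarrow>ps. augm u * conv_power augm k w)"
    by (simp add: convolution_sweedler[OF endo_augm endo_conv_power[OF endo_augm] ps(1)])
  also have "\<dots> = (\<Sum>(u, w)\<leftarrow>ps. 0)"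
  proof (rule sum_list_pair_cong)
    fix u w assume "(u, w) \<in> set ps"
    then obtain i where i: "i \<le> k" "u \<in> corad_filt i" "w \<in> corad_filt (k - i)" using ps(2) by blast
    show "augm u * conv_power augm k w = 0"
    proof (cases "i = 0")
      case True
      then show ?thesis using i augm_corad_filt_0 by simp
    next
      case False
      then have "w \<in> corad_below k" using corad_below_mono[of w "Suc (k - i)" k] i by simp
      then show ?thesis using Suc.IH by simp
    qed
  qed
  finally show ?case by (simp add: split_def)
qed

lemma augm_power_vanish_ge: "x \<in> corad_filt j \<Longrightarrow> j < k \<Longrightarrow> conv_power augm k x = 0"
  by (rule augm_power_vanish) (use corad_below_mono[of x "Suc j" k] in auto)

lemma adams_sum:
  assumes "x \<in> corad_filt j" "j \<le> N"
  shows "adams n x = (\<Sum>k\<le>N. (n gchoose k) *s conv_power augm k x)"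
proof -
  have "(\<lambda>y. y - conv_unit y) = augm" by (simp add: augm_def fun_eq_iff)
  then have "adams n x = Sum_any (\<lambda>k. (n gchoose k) *s conv_power augm k x)" by (simp add: adams_def)
  also have "\<dots> = (\<Sum>k\<le>N. (n gchoose k) *s conv_power augm k x)"
  proof (rule Sum_any.expand_superset)
    have "k \<le> N" if "(n gchoose k) *s conv_power augm k x \<noteq> 0" for k
    proof (rule ccontr)
      assume "\<not> k \<le> N"
      then have "conv_power augm k x = 0" using assms by (intro augm_power_vanish_ge[of x j]) auto
      then show False using that by simp
    qed
    then show "{k. (n gchoose k) *s conv_power augm k x \<noteq> 0} \<subseteq> {..N}" by auto
  qed simp
  finally show ?thesis .
qed

lemma endo_sum: "(\<And>k. k \<in> I \<Longrightarrow> endo (P k)) \<Longrightarrow> endo (\<lambda>x. \<Sum>k\<in>I. a k *s P k x)"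
proof (rule endoI)
  assume P: "\<And>k. k \<in> I \<Longrightarrow> endo (P k)"
  show "(\<Sum>k\<in>I. a k *s P k (x + y)) = (\<Sum>k\<in>I. a k *s P k x) + (\<Sum>k\<in>I. a k *s P k y)" for x y
    unfolding sum.distrib[symmetric]
    by (rule sum.cong[OF refl]) (simp add: linearD(1)[OF P] scale_right_distrib)
  show "(\<Sum>k\<in>I. a k *s P k (c *s x)) = c *s (\<Sum>k\<in>I. a k *s P k x)" for c x
    unfolding scale_sum_right
    by (rule sum.cong[OF refl]) (simp add: linearD(2)[OF P] scale_left_commute)
qed

lemma convolution_augm: "endo P \<Longrightarrow> convolution id P x = P x + convolution augm P x"
proof -
  assume P: "endo P"
  have "id = (\<lambda>x. conv_unit x + augm x)" by (simp add: augm_def fun_eq_iff)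
  then show ?thesis
    using convolution_left_add[OF endo_conv_unit endo_augm P] convolution_unit_left[OF P] by simp
qed

text \<open>
  The binomial theorem for \<open>id = conv_unit + augm\<close> in the convolution algebra.
\<close>

lemma ipower_binomial: "ipower n x = (\<Sum>k\<le>n. of_nat (n choose k) *s conv_power augm k x)"
proof (induction n arbitrary: x)
  case 0
  then show ?case by (simp add: ipower_simps)
next
  case (Suc n)
  obtain ps where ps: "\<Delta> x = tens ps" by (rule sweedlerE)
  let ?e = "conv_power augm"
  have ee: "endo (?e k)" for k by (rule endo_conv_power[OF endo_augm])
  have "convolution augm (ipower n) x = (\<Sum>(u, w)\<leftarrow>ps. \<Sum>k\<le>n. of_nat (n choose k) *s (augm u * ?e k w))"
    unfolding convolution_sweedler[OF endo_augm endo_ipower ps]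
    by (intro sum_list_pair_cong) (simp add: Suc sum_distrib_left scale_mult_right)
  also have "\<dots> = (\<Sum>k\<le>n. \<Sum>(u, w)\<leftarrow>ps. of_nat (n choose k) *s (augm u * ?e k w))"
    by (induction ps) (auto simp: sum.distrib)
  also have "\<dots> = (\<Sum>k\<le>n. of_nat (n choose k) *s ?e (Suc k) x)"
  proof (rule sum.cong[OF refl])
    fix k
    have e: "endo (\<lambda>x. of_nat (n choose k) *s x)" by (intro endoI) (auto simp: algebra_simps)
    show "(\<Sum>(u, w)\<leftarrow>ps. of_nat (n choose k) *s (augm u * ?e k w)) = of_nat (n choose k) *s ?e (Suc k) x"
      by (simp add: convolution_sweedler[OF endo_augm ee ps] linear_sum_list_pair[OF e])
  qed
  finally have 1: "convolution augm (ipower n) x = (\<Sum>k\<le>n. of_nat (n choose k) *s ?e (Suc k) x)" .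
  have "ipower n x = of_nat (n choose 0) *s ?e 0 x + (\<Sum>k<n. of_nat (n choose Suc k) *s ?e (Suc k) x)"
    unfolding Suc lessThan_Suc_atMost[symmetric] by (rule sum.lessThan_Suc_shift)
  also have "(\<Sum>k<n. of_nat (n choose Suc k) *s ?e (Suc k) x) = (\<Sum>k\<le>n. of_nat (n choose Suc k) *s ?e (Suc k) x)"
    by (simp add: lessThan_Suc_atMost[symmetric])
  finally have 2: "ipower n x = ?e 0 x + (\<Sum>k\<le>n. of_nat (n choose Suc k) *s ?e (Suc k) x)" by simp
  have "ipower (Suc n) x = ?e 0 x + (\<Sum>k\<le>n. of_nat (Suc n choose Suc k) *s ?e (Suc k) x)"
    unfolding ipower_simps convolution_augm[OF endo_ipower] 1 2
    by (simp add: sum.distrib[symmetric] scale_left_distrib add_ac del: conv_power_simps)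
  also have "\<dots> = (\<Sum>k\<le>Suc n. of_nat (Suc n choose k) *s ?e k x)"
    by (subst sum.atMost_Suc_shift) simp
  finally show ?case .
qed

lemma adams_of_nat: "adams (of_nat n) x = ipower n x"
proof -
  obtain j where j: "x \<in> corad_filt j" using corad_filt_exhaust by blast
  have "adams (of_nat n) x = (\<Sum>k\<le>max j n. of_nat (n choose k) *s conv_power augm k x)"
    using adams_sum[OF j, of "max j n" "of_nat n"] by (simp add: binomial_gbinomial)
  also have "\<dots> = (\<Sum>k\<le>n. of_nat (n choose k) *s conv_power augm k x)"
    by (intro sum.mono_neutral_right) (auto simp: not_le)
  finally show ?thesis by (simp add: ipower_binomial)
qed

lemma augm_power_H: "x \<in> H m \<Longrightarrow> conv_power augm k x \<in> H m"
proof (induction k arbitrary: x m)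
  case 0
  then show ?case
    using ipower_H[of x m 0] by (simp add: ipower_simps)
next
  case (Suc k)
  obtain ps where ps: "\<Delta> x = tens ps" "\<And>a b. (a, b) \<in> set ps \<Longrightarrow> \<exists>p\<le>m. a \<in> H p \<and> b \<in> H (m - p)"
    using homogeneous_sweedlerE[OF Suc.prems] by metis
  have "conv_power augm (Suc k) x = (\<Sum>(u, w)\<leftarrow>ps. augm u * conv_power augm k w)"
    by (simp add: convolution_sweedler[OF endo_augm endo_conv_power[OF endo_augm] ps(1)])
  also have "\<dots> \<in> H m"
  proof (intro subspace_sum_list_pair[OF subspace_H])
    fix u w assume "(u, w) \<in> set ps"
    then obtain p where p: "p \<le> m" "u \<in> H p" "w \<in> H (m - p)" using ps(2) by blast
    have "augm u \<in> H p"
      using subspace_diff[OF subspace_H p(2) ipower_H[OF p(2), of 0]] by (simp add: augm_def ipower_simps)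
    then show "augm u * conv_power augm k w \<in> H m" using mult_H[OF _ Suc.IH[OF p(3)]] p(1) by fastforce
  qed
  finally show ?case .
qed

text \<open>
  On \<open>H m\<close> the series stops at \<open>k = m\<close>, so the trace is a polynomial in \<open>n\<close>.
\<close>

lemma trace_adams_sum:
  "trace_on (H m) (adams n) = (\<Sum>k\<le>m. (n gchoose k) * trace_on (H m) (conv_power augm k))"
proof -
  obtain C where C: "finite C" "span C = H m" using finite_dim_H[of m] by (auto simp: finite_dim_def)
  obtain B where B: "B \<subseteq> H m" "independent B" "H m \<subseteq> span B"
    using maximal_independent_subset[of "H m"] by blast
  have finB: "finite B" using independent_span_bound[OF C(1) B(2)] C B by auto
  have sB: "span B = H m" using B subspace_H by (simp add: span_subspace)
  let ?e = "conv_power augm"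
  have ee: "endo (?e k)" for k by (rule endo_conv_power[OF endo_augm])
  have eH: "?e k ` H m \<subseteq> H m" for k using augm_power_H by auto
  let ?A = "\<lambda>x. \<Sum>k\<le>m. (n gchoose k) *s ?e k x"
  have A: "adams n x = ?A x" if "x \<in> H m" for x
    using adams_sum[OF H_corad_filt[OF that]] by simp
  have "trace_on (H m) (adams n) = trace_on (H m) ?A"
    using A by (intro trace_on_cong[OF B(2) sB])
  also have "\<dots> = (\<Sum>b\<in>B. representation B (?A b) b)"
  proof (rule trace_on_basis[OF finB B(2) sB])
    show "endo ?A" by (intro endo_sum ee)
    show "?A ` H m \<subseteq> H m"
      using augm_power_H by (auto intro!: subspace_sum[OF subspace_H] subspace_scale[OF subspace_H])
  qed
  also have "\<dots> = (\<Sum>b\<in>B. \<Sum>k\<le>m. (n gchoose k) * representation B (?e k b) b)"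
  proof (rule sum.cong[OF refl])
    fix b assume b: "b \<in> B"
    have s: "?e k b \<in> span B" for k using b B(1) augm_power_H sB by auto
    have "representation B (?A b) b = (\<Sum>k\<le>m. representation B ((n gchoose k) *s ?e k b) b)"
      using B(2) s by (subst representation_sum) (auto intro: span_scale)
    then show "representation B (?A b) b = (\<Sum>k\<le>m. (n gchoose k) * representation B (?e k b) b)"
      using B(2) s by (simp add: representation_scale)
  qed
  also have "\<dots> = (\<Sum>k\<le>m. \<Sum>b\<in>B. (n gchoose k) * representation B (?e k b) b)" by (rule sum.swap)
  also have "\<dots> = (\<Sum>k\<le>m. (n gchoose k) * trace_on (H m) (?e k))"
    using trace_on_basis[OF finB B(2) sB ee eH] by (simp add: sum_distrib_left)
  finally show ?thesis .
qed

lemma gbinomial_poly: "\<exists>p. \<forall>n. poly p n = (n gchoose k :: 'k)"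
proof (intro exI allI)
  fix n :: 'k
  show "poly (smult (1 / fact k) (\<Prod>i=0..<k. [:- of_nat i, 1:])) n = (n gchoose k)"
    by (simp add: poly_prod gbinomial_prod_rev)
qed

text \<open>
  Both sides are polynomials in \<open>n\<close> and agree at all natural numbers.
\<close>

theorem trace_adams:
  "trace_on (H m) (adams n) = (\<Sum>k=0..m. n ^ k * of_nat (mul k m))"
proof -
  obtain G where G: "\<And>k n. poly (G k) n = (n gchoose k :: 'k)" using gbinomial_poly by metis
  define p where "p = (\<Sum>k\<le>m. smult (trace_on (H m) (conv_power augm k)) (G k))"
  define q where "q = (\<Sum>k=0..m. monom (of_nat (mul k m) :: 'k) k)"
  have p: "poly p n = trace_on (H m) (adams n)" for n
    by (simp add: p_def trace_adams_sum poly_sum G mult.commute)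
  have q: "poly q n = (\<Sum>k=0..m. n ^ k * of_nat (mul k m))" for n
    by (simp add: q_def poly_sum poly_monom mult.commute)
  have "poly (p - q) (of_nat n) = 0" for n
  proof -
    have "trace_on (H m) (adams (of_nat n)) = trace_on (H m) (ipower n)"
      by (simp add: adams_of_nat[abs_def])
    then show ?thesis by (simp add: p q trace_ipower_mul)
  qed
  then have "range of_nat \<subseteq> {x. poly (p - q) x = 0}" by auto
  moreover have "infinite (range (of_nat :: nat \<Rightarrow> 'k))" by (rule range_inj_infinite) (simp add: inj_of_nat)
  ultimately have "p - q = 0" using poly_roots_finite finite_subset by blast
  then show ?thesis using p q by (metis right_minus_eq)
qed

section \<open>The antipode\<close>

lemma endo_adams: "endo (adams n)"
proof (rule endoI)
  fix x y
  obtain i j where "x \<in> corad_filt i" "y \<in> corad_filt j" using corad_filt_exhaust by blast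
  then have xy: "x \<in> corad_filt (max i j)" "y \<in> corad_filt (max i j)" "x + y \<in> corad_filt (max i j)"
    using corad_filt_mono subspace_add[OF subspace_corad_filt] by (meson max.cobounded1 max.cobounded2)+
  show "adams n (x + y) = adams n x + adams n y"
    using adams_sum[OF xy(1) order_refl] adams_sum[OF xy(2) order_refl] adams_sum[OF xy(3) order_refl]
    by (simp add: linearD(1)[OF endo_conv_power[OF endo_augm]] scale_right_distrib sum.distrib)
next
  fix c x
  obtain j where x: "x \<in> corad_filt j" using corad_filt_exhaust by blast
  then have cx: "c *s x \<in> corad_filt j" by (rule subspace_scale[OF subspace_corad_filt])
  show "adams n (c *s x) = c *s adams n x"
    using adams_sum[OF x order_refl] adams_sum[OF cx order_refl]
    by (simp add: linearD(2)[OF endo_conv_power[OF endo_augm]] scale_sum_right mult.commute)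
qed

lemma adams_minus_one_sum:
  assumes "x \<in> corad_filt j" "j \<le> N"
  shows "adams (- 1) x = (\<Sum>k\<le>N. (- 1) ^ k *s conv_power augm k x)"
proof -
  have "((- 1) gchoose k :: 'k) = (- 1) ^ k" for k
    using gbinomial_minus[of "1 :: 'k" k] binomial_gbinomial[of k k, where 'a = 'k] by simp
  then show ?thesis using adams_sum[OF assms, of "- 1"] by simp
qed

text \<open>
  The geometric series \<open>\<Sum>k. (-1) ^ k J\<^sup>*\<^sup>k\<close> with \<open>J = augm\<close> inverts \<open>id = conv_unit + J\<close>. Sums are
  truncated at an \<open>N\<close> large enough for \<open>x\<close> and all factors of its coproduct.
\<close>

lemma is_antipode_adams: "is_antipode (adams (- 1))"
  unfolding is_antipode_def
proof (intro conjI ext)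
  show "endo (adams (- 1))" by (rule endo_adams)
  let ?e = "conv_power augm" and ?S = "adams (- 1)"
  have ee: "endo (?e k)" for k by (rule endo_conv_power[OF endo_augm])
  fix x
  obtain ps where ps: "\<Delta> x = tens ps" by (rule sweedlerE)
  obtain j where j: "x \<in> corad_filt j" using corad_filt_exhaust by blast
  have "\<exists>N. \<forall>p\<in>set ps. fst p \<in> corad_filt N \<and> snd p \<in> corad_filt N"
  proof (induction ps)
    case (Cons p ps)
    then obtain N where N: "\<forall>p\<in>set ps. fst p \<in> corad_filt N \<and> snd p \<in> corad_filt N" by blast
    obtain i k where "fst p \<in> corad_filt i" "snd p \<in> corad_filt k" using corad_filt_exhaust by blast
    then show ?case
      using N corad_filt_mono[of _ N "max N (max i k)"] corad_filt_mono[of _ i "max N (max i k)"]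
        corad_filt_mono[of _ k "max N (max i k)"]
      by (intro exI[of _ "max N (max i k)"]) auto
  qed simp
  then obtain N0 where N0: "\<forall>p\<in>set ps. fst p \<in> corad_filt N0 \<and> snd p \<in> corad_filt N0" by blast
  define N where "N = max j N0"
  have S: "?S y = (\<Sum>k\<le>N. (- 1) ^ k *s ?e k y)" if "y \<in> corad_filt N0" for y
    using that by (rule adams_minus_one_sum) (simp add: N_def)
  have Sx: "?S x = (\<Sum>k\<le>N. (- 1) ^ k *s ?e k x)"
    using j by (rule adams_minus_one_sum) (simp add: N_def)
  have es: "endo (\<lambda>x. (- 1) ^ k *s x)" for k by (intro endoI) (auto simp: algebra_simps)
  have tele: "?S x + (\<Sum>k\<le>N. (- 1) ^ k *s ?e (Suc k) x) = conv_unit x"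
  proof -
    have "(\<Sum>k\<le>N. (- 1) ^ k *s ?e k x) + (\<Sum>k\<le>N. (- 1) ^ k *s ?e (Suc k) x) = conv_unit x + (- 1) ^ N *s ?e (Suc N) x" for N
      by (induction N) (auto simp: algebra_simps simp del: conv_power_simps(2))
    moreover have "?e (Suc N) x = 0" by (rule augm_power_vanish_ge[OF j]) (simp add: N_def)
    ultimately show ?thesis by (simp add: Sx del: conv_power_simps)
  qed
  have "convolution augm ?S x = (\<Sum>(u, w)\<leftarrow>ps. augm u * ?S w)"
    by (rule convolution_sweedler[OF endo_augm endo_adams ps])
  also have "\<dots> = (\<Sum>(u, w)\<leftarrow>ps. \<Sum>k\<le>N. (- 1) ^ k *s (augm u * ?e k w))"
    using N0 by (intro sum_list_pair_cong) (force simp: S sum_distrib_left scale_mult_right)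
  also have "\<dots> = (\<Sum>k\<le>N. \<Sum>(u, w)\<leftarrow>ps. (- 1) ^ k *s (augm u * ?e k w))"
    by (induction ps) (auto simp: sum.distrib)
  also have "\<dots> = (\<Sum>k\<le>N. (- 1) ^ k *s ?e (Suc k) x)"
    by (simp add: convolution_sweedler[OF endo_augm ee ps] linear_sum_list_pair[OF es])
  finally have "convolution augm ?S x = (\<Sum>k\<le>N. (- 1) ^ k *s ?e (Suc k) x)" .
  then show "convolution id ?S x = conv_unit x"
    using tele convolution_augm[OF endo_adams] by simp
  have "convolution ?S augm x = (\<Sum>(u, w)\<leftarrow>ps. ?S u * augm w)"
    by (rule convolution_sweedler[OF endo_adams endo_augm ps])
  also have "\<dots> = (\<Sum>(u, w)\<leftarrow>ps. \<Sum>k\<le>N. (- 1) ^ k *s (?e k u * augm w))"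
    using N0 by (intro sum_list_pair_cong) (force simp: S sum_distrib_right scale_mult_left)
  also have "\<dots> = (\<Sum>k\<le>N. \<Sum>(u, w)\<leftarrow>ps. (- 1) ^ k *s (?e k u * augm w))"
    by (induction ps) (auto simp: sum.distrib)
  also have "\<dots> = (\<Sum>k\<le>N. (- 1) ^ k *s ?e (Suc k) x)"
    by (simp add: conv_power_Suc_right[OF endo_augm] convolution_sweedler[OF ee endo_augm ps] linear_sum_list_pair[OF es]
        del: conv_power_simps)
  finally have r: "convolution ?S augm x = (\<Sum>k\<le>N. (- 1) ^ k *s ?e (Suc k) x)" .
  have "convolution ?S id x = convolution ?S conv_unit x + convolution ?S augm x"
    by (simp add: convolution_sweedler[OF endo_adams _ ps] endo_id endo_conv_unit endo_augm
        sum_list_pair_add[symmetric] augm_def algebra_simps del: id_apply) (simp add: algebra_simps)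
  also have "convolution ?S conv_unit x = ?S x" by (simp add: convolution_unit_right endo_adams)
  finally have "convolution ?S id x = ?S x + convolution ?S augm x" .
  then show "convolution ?S id x = conv_unit x" unfolding r tele .
qed

lemma antipode_adams: "antipode = adams (- 1)"
  by (rule antipode_eqI) (rule is_antipode_adams)

lemma alternating_mul:
  "(\<Sum>k=0..m. (- 1) ^ k * of_nat (mul k m)) = (of_nat (emul m) - of_nat (omul m) :: 'k)"
proof -
  have le: "k \<le> m" if "mul k m \<noteq> 0" for k
    using that mul_eq_0[of m k] by (cases "k \<le> m") auto
  have e: "emul m = (\<Sum>k=0..m. if even k then mul k m else 0)"
    unfolding emul_def by (rule Sum_any.expand_superset) (use le in \<open>auto split: if_splits\<close>)
  have o: "omul m = (\<Sum>k=0..m. if odd k then mul k m else 0)"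
    unfolding omul_def by (rule Sum_any.expand_superset) (use le in \<open>auto split: if_splits\<close>)
  show ?thesis
    unfolding e o of_nat_sum sum_subtractf[symmetric] by (intro sum.cong refl) auto
qed

end

theorem corollary10:
  fixes scale :: "'k::field_char_0 \<Rightarrow> 'h::ring_1 \<Rightarrow> 'h"
    and \<Delta> :: "'h \<Rightarrow> ('h, 'h, 'k) tensor"
    and \<epsilon> :: "'h \<Rightarrow> 'k"
    and H :: "nat \<Rightarrow> 'h set"
  assumes "graded_connected_hopf_algebra scale \<Delta> \<epsilon> H"
    and "\<And>m. vector_space.finite_dim scale (H m)"
  shows "(\<forall>(n::'k) (m::nat).
            vector_space.trace_on scale (H m) (bialgebra.adams scale \<Delta> \<epsilon> n) =
              (\<Sum>k=0..m. n ^ k * of_nat (graded_connected_hopf_algebra.mul scale \<Delta> \<epsilon> H k m))) \<and>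
         (\<forall>m::nat.
            vector_space.trace_on scale (H m) (bialgebra.antipode scale \<Delta> \<epsilon>) =
              (\<Sum>k=0..m. (- 1) ^ k * of_nat (graded_connected_hopf_algebra.mul scale \<Delta> \<epsilon> H k m)) \<and>
            (\<Sum>k=0..m. (- 1) ^ k * of_nat (graded_connected_hopf_algebra.mul scale \<Delta> \<epsilon> H k m)) =
              (of_nat (graded_connected_hopf_algebra.emul scale \<Delta> \<epsilon> H m)
                - of_nat (graded_connected_hopf_algebra.omul scale \<Delta> \<epsilon> H m) :: 'k))"
proof -
  interpret locally_finite_hopf_algebra scale \<Delta> \<epsilon> H
    by (intro locally_finite_hopf_algebra.intro locally_finite_hopf_algebra_axioms.intro assms)
  show ?thesis
    using trace_adams alternating_mul by (simp add: antipode_adams)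
qed

end
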